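(* There exists an interactive protocol between a verifier $V$ and a prover $P$ with the following properties. The inputs are parameters $\epsilon,\delta>0$ and $t\in\mathbb{N}$; there is an unknown function $f:\mathbb{F}_2^n\to\{-1,1\}$; the verifier has only random example access to $f$ (i.i.d. pairs $(x,f(x))$ with $x$ uniform in $\mathbb{F}_2^n$), while the prover may query $f$. The verifier uses $\mathrm{poly}(t,1/\epsilon,\log(1/\delta))$ random examples (independent of $n$) and outputs $\Lambda$, which is either a subset of $\mathbb{F}_2^n$ of size $t$ or the symbol $\bot$ (reject). The communication complexity is $n\cdot\mathrm{poly}(t,1/\epsilon,\log(1/\delta))$, the protocol has $3$ messages, and both the verifier's running time and the honest prover's running time are $\mathrm{poly}(n,t,1/\epsilon,\log(1/\delta))$. Moreover: (Completeness) there exists an honest prover $P^*$ such that the output $\Lambda$ of the interaction of $P^*$ with $V$ satisfies $\Pr[\Lambda \text{ is } \tfrac{\epsilon}{3}\text{-top}]\ge 1-\delta-o(1)$; (Soundness) for every (possibly computationally unbounded) prover $P$, the output $\Lambda$ of the interaction of $P$ with $V$ satisfies $\Pr[(\Lambda\neq\bot)\wedge(\Lambda\text{ is not }\epsilon\text{-top})]\le\delta+o(1)$.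
   Context: Every $f:\mathbb{F}_2^n\to\mathbb{R}$ has a unique Fourier expansion $f(x)=\sum_{\gamma\in\mathbb{F}_2^n}\hat f(\gamma)\chi_\gamma(x)$ with characters $\chi_\gamma(x)=(-1)^{\langle\gamma,x\rangle}$ and $\hat f(\gamma)=\mathbb{E}_{x}[f(x)\chi_\gamma(x)]$, $x$ uniform. A set $\Gamma\subseteq\mathbb{F}_2^n$ is called $\epsilon$-top with respect to $f$ if for every $\alpha\in\mathbb{F}_2^n\setminus\Gamma$ and every $\beta\in\Gamma$ we have $|\hat f(\alpha)|\le|\hat f(\beta)|+\epsilon$. Probabilities are over the random examples and the internal randomness of the parties; $o(1)$ is with respect to $n\to\infty$. *)

theory Defs
  imports "HOL-Probability.Probability" "HOL-Library.Z2"
begin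

section \<open>Fourier analysis on the Boolean cube\<close>

text \<open>The space \<open>F_2^n\<close>, with vectors as lists of length \<open>n\<close> over the two-element
  field \<^typ>\<open>bit\<close>. Functions on the cube have type \<^typ>\<open>bit list \<Rightarrow> real\<close>; their values
  on lists of other lengths never matter.\<close>

definition cube :: "nat \<Rightarrow> bit list set" where
  "cube n = {x. length x = n}"

definition inner_prod :: "bit list \<Rightarrow> bit list \<Rightarrow> bit" where
  "inner_prod \<gamma> x = (\<Sum>i<length \<gamma>. \<gamma> ! i * x ! i)"

definition chi :: "bit list \<Rightarrow> bit list \<Rightarrow> real" where
  "chi \<gamma> x = (if inner_prod \<gamma> x = 0 then 1 else -1)"

definition fourier :: "nat \<Rightarrow> (bit list \<Rightarrow> real) \<Rightarrow> bit list \<Rightarrow> real" where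
  "fourier n f \<gamma> = measure_pmf.expectation (pmf_of_set (cube n)) (\<lambda>x. f x * chi \<gamma> x)"

definition eps_top :: "nat \<Rightarrow> real \<Rightarrow> (bit list \<Rightarrow> real) \<Rightarrow> bit list set \<Rightarrow> bool" where
  "eps_top n \<epsilon> f \<Gamma> \<longleftrightarrow> \<Gamma> \<subseteq> cube n \<and>
     (\<forall>\<alpha> \<in> cube n - \<Gamma>. \<forall>\<beta> \<in> \<Gamma>. \<bar>fourier n f \<alpha>\<bar> \<le> \<bar>fourier n f \<beta>\<bar> + \<epsilon>)"


section \<open>Probabilistic machines with access to a function\<close>

text \<open>Efficient parties are uniform programs in Jones's WHILE language over binary trees,
  extended by coin tosses and an instruction that consults the outside world
  (for random examples or queries). One step costs one unit of time. Programs
  are fixed finite objects, so every expression has constant size; as trees can only be built,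
  taken apart and tested for being \<open>Nul\<close>, each step takes constant time on a pointer machine,
  and polynomial time is the same notion as for Turing machines.\<close>

datatype sexp = Nul | Cell sexp sexp

type_synonym store = "nat \<Rightarrow> sexp"

datatype expr = Var nat | Null | Mk expr expr | Hd expr | Tl expr

primrec sexp_hd :: "sexp \<Rightarrow> sexp" where
  "sexp_hd Nul = Nul"
| "sexp_hd (Cell a b) = a"

primrec sexp_tl :: "sexp \<Rightarrow> sexp" where
  "sexp_tl Nul = Nul"
| "sexp_tl (Cell a b) = b"

primrec eval_expr :: "store \<Rightarrow> expr \<Rightarrow> sexp" where
  "eval_expr s (Var x) = s x"
| "eval_expr s Null = Nul"
| "eval_expr s (Mk e d) = Cell (eval_expr s e) (eval_expr s d)"
| "eval_expr s (Hd e) = sexp_hd (eval_expr s e)"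
| "eval_expr s (Tl e) = sexp_tl (eval_expr s e)"

text \<open>\<open>Ask x e\<close> passes the value of \<open>e\<close> to the outside and stores the reply in register \<open>x\<close>.\<close>

datatype com =
    Assign nat expr
  | Flip nat
  | Ask nat expr
  | Cond expr "com list" "com list"
  | While expr "com list"

type_synonym prog = "com list"

text \<open>The last two components count the executed steps and the executed \<open>Ask\<close> instructions.\<close>

datatype config =
  Config (code: prog) (store: store) (steps: nat) (asks: nat)

primrec elems :: "sexp \<Rightarrow> sexp list" where
  "elems Nul = []"
| "elems (Cell a b) = a # elems b"

primrec enc_list :: "sexp list \<Rightarrow> sexp" where
  "enc_list [] = Nul"
| "enc_list (a # as) = Cell a (enc_list as)"

definition enc_bit :: "bit \<Rightarrow> sexp" where
  "enc_bit b = (if b = 0 then Nul else Cell Nul Nul)"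

definition dec_bit :: "sexp \<Rightarrow> bit" where
  "dec_bit a = (if a = Nul then 0 else 1)"

definition enc_bits :: "bit list \<Rightarrow> sexp" where
  "enc_bits bs = enc_list (map enc_bit bs)"

definition dec_bits :: "sexp \<Rightarrow> bit list" where
  "dec_bits a = map dec_bit (elems a)"

definition unary :: "nat \<Rightarrow> sexp" where
  "unary k = enc_list (replicate k Nul)"

type_synonym access = "sexp \<Rightarrow> sexp pmf"

fun step :: "access \<Rightarrow> config \<Rightarrow> config pmf" where
  "step acc (Config [] s k q) = return_pmf (Config [] s k q)"
| "step acc (Config (Assign x e # cs) s k q) =
     return_pmf (Config cs (s(x := eval_expr s e)) (Suc k) q)"
| "step acc (Config (Flip x # cs) s k q) =
     map_pmf (\<lambda>b. Config cs (s(x := enc_bit b)) (Suc k) q) (pmf_of_set {0, 1})"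
| "step acc (Config (Ask x e # cs) s k q) =
     map_pmf (\<lambda>a. Config cs (s(x := a)) (Suc k) (Suc q)) (acc (eval_expr s e))"
| "step acc (Config (Cond e as bs # cs) s k q) =
     return_pmf (Config ((if eval_expr s e \<noteq> Nul then as else bs) @ cs) s (Suc k) q)"
| "step acc (Config (While e as # cs) s k q) =
     return_pmf (Config (if eval_expr s e \<noteq> Nul then as @ While e as # cs else cs) s (Suc k) q)"

text \<open>The missing probability mass of \<open>exec\<close> is the probability of divergence.\<close>

partial_function (spmf) exec :: "access \<Rightarrow> config \<Rightarrow> config spmf" where
  "exec acc C = (if code C = [] then return_spmf C
     else bind_spmf (spmf_of_pmf (step acc C)) (exec acc))"


section \<open>The two kinds of access to the unknown function\<close>

definition enc_label :: "real \<Rightarrow> sexp" where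
  "enc_label y = enc_bit (if y = 1 then 0 else 1)"

definition examples :: "nat \<Rightarrow> (bit list \<Rightarrow> real) \<Rightarrow> access" where
  "examples n f = (\<lambda>_. map_pmf (\<lambda>x. Cell (enc_bits x) (enc_label (f x))) (pmf_of_set (cube n)))"

definition queries :: "nat \<Rightarrow> (bit list \<Rightarrow> real) \<Rightarrow> access" where
  "queries n f = (\<lambda>a. return_pmf (if dec_bits a \<in> cube n then enc_label (f (dec_bits a)) else Nul))"


section \<open>Three-message interactions\<close>

text \<open>A party maps its private state and the incoming message to the outgoing message and a new
  private state. This type is used for arbitrary provers as well.\<close>

type_synonym 's party = "'s \<Rightarrow> bit list \<Rightarrow> (bit list \<times> 's) spmf"

text \<open>A machine is restarted for every incoming message, which is placed in register 0; the
  other registers and the counters persist. The reply is read off register 0.\<close>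

definition activate :: "access \<Rightarrow> prog \<Rightarrow> config \<Rightarrow> bit list \<Rightarrow> config spmf" where
  "activate acc p C m = exec acc (Config p ((store C)(0 := enc_bits m)) (steps C) (asks C))"

definition machine :: "access \<Rightarrow> prog \<Rightarrow> config party" where
  "machine acc p C m = map_spmf (\<lambda>C'. (dec_bits (store C' 0), C')) (activate acc p C m)"

text \<open>The common input. Machines cannot read real numbers, so \<open>\<epsilon>\<close> and \<open>\<delta>\<close> are given through
  \<open>\<lceil>1/\<epsilon>\<rceil>\<close> and \<open>\<lceil>log 2 (1/\<delta>)\<rceil>\<close> (which is \<open>0\<close> if \<open>\<delta> \<ge> 1\<close>). All inputs are in unary, in
  accordance with running times polynomial in \<open>n\<close>, \<open>t\<close>, \<open>1/\<epsilon>\<close> and \<open>log (1/\<delta>)\<close>.\<close>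

definition initial :: "nat \<Rightarrow> nat \<Rightarrow> real \<Rightarrow> real \<Rightarrow> config" where
  "initial n t \<epsilon> \<delta> = Config []
     ((\<lambda>_. Nul)(1 := unary n, 2 := unary t,
        3 := unary (nat \<lceil>1 / \<epsilon>\<rceil>), 4 := unary (nat \<lceil>log 2 (1 / \<delta>)\<rceil>)))
     0 0"

text \<open>The verifier's final output: \<open>Nul\<close> stands for rejection (\<^const>\<open>None\<close>), and
  \<open>Cell a b\<close> for the set of the vectors listed in \<open>b\<close>.\<close>

definition dec_output :: "sexp \<Rightarrow> bit list set option" where
  "dec_output a = (case a of Nul \<Rightarrow> None | Cell _ b \<Rightarrow> Some (dec_bits ` set (elems b)))"

datatype 's outcome = Outcome
  (prover_end: 's)
  (verifier_end: config)
  (msg1: "bit list")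
  (msg2: "bit list")
  (msg3: "bit list")
  (result: "bit list set option")

text \<open>The messages go prover, verifier, prover. This is no loss of generality for three
  messages: a final message to the prover cannot influence the output, and the first message
  may be empty. The prover's first activation receives the empty message.\<close>

definition interact ::
  "nat \<Rightarrow> nat \<Rightarrow> real \<Rightarrow> real \<Rightarrow> (bit list \<Rightarrow> real) \<Rightarrow> prog \<Rightarrow> 's party \<Rightarrow> 's \<Rightarrow> 's outcome spmf" where
  "interact n t \<epsilon> \<delta> f V P p0 = do {
     (m1, p1) \<leftarrow> P p0 [];
     (m2, v1) \<leftarrow> machine (examples n f) V (initial n t \<epsilon> \<delta>) m1;
     (m3, p2) \<leftarrow> P p1 m2;
     v2 \<leftarrow> activate (examples n f) V v1 m3;
     return_spmf (Outcome p2 v2 m1 m2 m3 (dec_output (store v2 0)))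
   }"

abbreviation interact_honest ::
  "nat \<Rightarrow> nat \<Rightarrow> real \<Rightarrow> real \<Rightarrow> (bit list \<Rightarrow> real) \<Rightarrow> prog \<Rightarrow> prog \<Rightarrow> config outcome spmf" where
  "interact_honest n t \<epsilon> \<delta> f V Q \<equiv>
     interact n t \<epsilon> \<delta> f V (machine (queries n f) Q) (initial n t \<epsilon> \<delta>)"

text \<open>An arbitrary, computationally unbounded prover. Subprobability distributions have countable
  support, so natural numbers suffice for the private states. The prover may depend on \<open>n\<close>,
  \<open>t\<close>, \<open>\<epsilon>\<close>, \<open>\<delta>\<close> and \<open>f\<close> (by the order of quantification); it only has to answer always.\<close>

definition valid_prover :: "nat party \<Rightarrow> bool" where
  "valid_prover P \<longleftrightarrow> (\<forall>p m. lossless_spmf (P p m))"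


section \<open>Resource bounds\<close>

text \<open>A function of nonnegative quantities is bounded by a polynomial in them iff it is bounded
  by \<open>c * (1 + sum of the quantities) ^ c\<close> for some \<open>c\<close>. The maximum and the summand \<open>1\<close> are
  there since \<open>\<delta> \<ge> 1\<close>, large \<open>\<epsilon>\<close> and \<open>t = 0\<close> are allowed.\<close>

definition param_size :: "nat \<Rightarrow> real \<Rightarrow> real \<Rightarrow> real" where
  "param_size t \<epsilon> \<delta> = 1 + real t + 1 / \<epsilon> + max 0 (log 2 (1 / \<delta>))"

definition sample_bound :: "nat \<Rightarrow> nat \<Rightarrow> real \<Rightarrow> real \<Rightarrow> real" where
  "sample_bound c t \<epsilon> \<delta> = real c * param_size t \<epsilon> \<delta> ^ c"

definition comm_bound :: "nat \<Rightarrow> nat \<Rightarrow> nat \<Rightarrow> real \<Rightarrow> real \<Rightarrow> real" where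
  "comm_bound c n t \<epsilon> \<delta> = real n * (real c * param_size t \<epsilon> \<delta> ^ c)"

definition time_bound :: "nat \<Rightarrow> nat \<Rightarrow> nat \<Rightarrow> real \<Rightarrow> real \<Rightarrow> real" where
  "time_bound c n t \<epsilon> \<delta> = real c * (real n + param_size t \<epsilon> \<delta>) ^ c"

text \<open>What is required of the verifier in every interaction, with whatever prover. The length of
  the prover's messages is not under the verifier's control, so only its own message is
  bounded here; the total communication is bounded for the honest prover.\<close>

definition verifier_admissible :: "nat \<Rightarrow> nat \<Rightarrow> nat \<Rightarrow> real \<Rightarrow> real \<Rightarrow> 's outcome spmf \<Rightarrow> bool" where
  "verifier_admissible c n t \<epsilon> \<delta> I \<longleftrightarrow>
     lossless_spmf I \<and>
     (\<forall>r \<in> set_spmf I.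
        real (asks (verifier_end r)) \<le> sample_bound c t \<epsilon> \<delta> \<and>
        real (steps (verifier_end r)) \<le> time_bound c n t \<epsilon> \<delta> \<and>
        real (length (msg2 r)) \<le> comm_bound c n t \<epsilon> \<delta> \<and>
        (\<forall>\<Lambda>. result r = Some \<Lambda> \<longrightarrow> \<Lambda> \<subseteq> cube n \<and> card \<Lambda> = t))"

definition honest_admissible :: "nat \<Rightarrow> nat \<Rightarrow> nat \<Rightarrow> real \<Rightarrow> real \<Rightarrow> config outcome spmf \<Rightarrow> bool" where
  "honest_admissible c n t \<epsilon> \<delta> I \<longleftrightarrow>
     (\<forall>r \<in> set_spmf I.
        real (steps (prover_end r)) \<le> time_bound c n t \<epsilon> \<delta> \<and>
        real (length (msg1 r) + length (msg2 r) + length (msg3 r)) \<le> comm_bound c n t \<epsilon> \<delta>)"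

end

theory Submission
  imports Defs
begin

text \<open>For \<open>f\<close> with values in \<open>\<plusminus>1\<close> the sum of the \<^emph>\<open>fourth\<close> powers of the Fourier coefficients is the
  expectation of \<open>f(x) f(y) f(z) f(x+y+z)\<close>. The prover first sends a list \<open>L\<close> of candidates that
  contains all large coefficients. The verifier estimates the fourth power of each coefficient in \<open>L\<close> from
  products of four independent examples; if, moreover, the total of all fourth powers exceeds the total over
  \<open>L\<close> only slightly, then no large coefficient is missing from \<open>L\<close>, and the \<open>t\<close> largest ones of \<open>L\<close>
  can be output. For the total, the verifier takes three examples \<open>x\<close>, \<open>y\<close>, \<open>z\<close>
  and needs \<open>f(w)\<close> for \<open>w = x+y+z\<close>. It asks the prover for the values at \<open>z\<close> and \<open>w\<close> in random
  order. The two points are independent and uniform, so the prover cannot tell them apart, and whoever lies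
  about one of them is caught with probability \<open>1/2\<close>; hence only few lies remain undetected.
  The honest prover finds \<open>L\<close> by the Kushilevitz-Mansour search: it extends suffixes letter by
  letter and keeps those whose Fourier weight, estimated by sampling, is large.

  All accuracies are powers of a single number \<open>G\<close>, polynomial in the parameters, see \<open>big_g\<close>.\<close>

section \<open>Hoare triples for randomised programs\<close>

text \<open>Squares would not do: they sum to 1 for every f, and all of this mass may sit on tiny
  coefficients, so the total cannot reveal that L misses a large one. Coefficients of square at most
  \<tau>, however, have fourth powers of total at most \<tau>, by Parseval. The price is that the
  total of the fourth powers is unknown and takes the value of f at a dependent point, which random
  examples do not supply. Lies about it need only be few: each moves a sum of G^64 signs by at most
  2. Scaled by the G^64 trials, a mean has error G^36 (accuracy G^-28), the scores of up to G^16
  candidates have G^52 together, fewer than G lies account for 2G, and an honest list, which has all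
  squares above G^-10, misses at most G^54. The slack G^56 lets an honest list pass; slack and
  errors together stay below G^60, so that after acceptance the coefficients outside L are at most
  1/G \<le> \<epsilon>. The Hoeffding exponent is G^8/2, enough for a union bound over L. None of
  this involves n; only the search does, and its failure together with the case t > 2^n is the o(1)
  of completeness.\<close>

definition runs :: "access \<Rightarrow> prog \<Rightarrow> store \<Rightarrow> (store \<times> nat \<times> nat) pmf \<Rightarrow> bool" where
  "runs acc p s D \<longleftrightarrow> (\<forall>cs k q. exec acc (Config (p @ cs) s k q) =
     bind_spmf (spmf_of_pmf D) (\<lambda>(s', k', q'). exec acc (Config cs s' (k + k') (q + q'))))"

text \<open>A coupling: the run of \<open>p\<close> is the projection of a joint distribution of an abstract result, distributed
  as \<open>A\<close>, and a final store related to it by \<open>R\<close>.\<close>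

definition triple :: "access \<Rightarrow> prog \<Rightarrow> store \<Rightarrow> 'a pmf \<Rightarrow> ('a \<Rightarrow> store \<Rightarrow> bool) \<Rightarrow> nat \<Rightarrow> nat \<Rightarrow> bool" where
  "triple acc p s A R K Q \<longleftrightarrow> (\<exists>D. map_pmf fst D = A \<and>
     (\<forall>(a, s', k, q) \<in> set_pmf D. R a s' \<and> k \<le> K \<and> q \<le> Q) \<and> runs acc p s (map_pmf snd D))"

lemma exec_Nil [simp]: "exec acc (Config [] s k q) = return_spmf (Config [] s k q)"
  by (subst exec.simps) simp

lemma exec_Cons: "exec acc (Config (i # p) s k q) =
    bind_spmf (spmf_of_pmf (step acc (Config (i # p) s k q))) (exec acc)"
  by (subst exec.simps) simp

lemma triple_Nil: "R a s \<Longrightarrow> triple acc [] s (return_pmf a) R 0 0"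
  unfolding triple_def runs_def
  by (rule exI[of _ "return_pmf (a, s, 0, 0)"]) (simp add: case_prod_unfold)

lemma triple_weaken:
  assumes "triple acc p s A R K Q" "\<And>a s'. a \<in> set_pmf A \<Longrightarrow> R a s' \<Longrightarrow> R' a s'" "K \<le> K'" "Q \<le> Q'"
  shows "triple acc p s A R' K' Q'"
  using assms unfolding triple_def by fastforce

lemma tripleE:
  assumes "triple acc p s A R K Q"
  obtains D where "map_pmf fst D = A"
    "\<And>a s' k q. (a, s', k, q) \<in> set_pmf D \<Longrightarrow> R a s' \<and> k \<le> K \<and> q \<le> Q"
    "runs acc p s (map_pmf snd D)"
  using assms unfolding triple_def by fast

text \<open>For each joint sample of a first result and its store some coupling of the second stage
  exists; a choice function glues them together. \<open>B\<close> sees only the abstract result, so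
  the glued coupling projects to \<open>bind_pmf A B\<close> although the stores are correlated with
  that result. The two runs concatenate because \<open>runs\<close> quantifies over the continuation
  and over the counters.\<close>

lemma triple_append:
  assumes 1: "triple acc p s A R K Q"
    and 2: "\<And>a s'. a \<in> set_pmf A \<Longrightarrow> R a s' \<Longrightarrow> triple acc p' s' (B a) R' K' Q'"
  shows "triple acc (p @ p') s (bind_pmf A B) R' (K + K') (Q + Q')"
proof -
  obtain D where D: "map_pmf fst D = A"
    "\<And>a s' k q. (a, s', k, q) \<in> set_pmf D \<Longrightarrow> R a s' \<and> k \<le> K \<and> q \<le> Q"
    "runs acc p s (map_pmf snd D)"
    by (rule tripleE[OF 1]) (rule that)
  define E where "E x = (SOME E. map_pmf fst E = B (fst x) \<and>
     (\<forall>(a, s', k, q) \<in> set_pmf E. R' a s' \<and> k \<le> K' \<and> q \<le> Q') \<and>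
     runs acc p' (fst (snd x)) (map_pmf snd E))" for x :: "'a \<times> store \<times> nat \<times> nat"
  have E: "map_pmf fst (E x) = B (fst x) \<and>
     (\<forall>(a, s', k, q) \<in> set_pmf (E x). R' a s' \<and> k \<le> K' \<and> q \<le> Q') \<and>
     runs acc p' (fst (snd x)) (map_pmf snd (E x))" if "x \<in> set_pmf D" for x
  proof -
    obtain a s' k q where x: "x = (a, s', k, q)" by (cases x)
    have "a \<in> set_pmf A" using D(1) that x by (force simp flip: D(1))
    moreover have "R a s'" using D(2) that x by blast
    ultimately have "triple acc p' s' (B a) R' K' Q'" by (rule 2)
    then show ?thesis unfolding triple_def E_def x fst_conv snd_conv by (rule someI_ex)
  qed
  define F where "F = bind_pmf D (\<lambda>(a, s', k, q).
     map_pmf (\<lambda>(b, s'', k', q'). (b, s'', k + k', q + q')) (E (a, s', k, q)))"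
  have "map_pmf fst F = bind_pmf D (\<lambda>x. map_pmf fst (E x))"
    unfolding F_def by (auto simp: map_bind_pmf pmf.map_comp case_prod_unfold o_def intro!: bind_pmf_cong)
  also have "\<dots> = bind_pmf D (\<lambda>x. B (fst x))"
    using E by (auto intro!: bind_pmf_cong)
  also have "\<dots> = bind_pmf A B"
    by (simp flip: D(1) add: bind_map_pmf)
  finally have F1: "map_pmf fst F = bind_pmf A B" .
  have F2: "\<forall>(a, s', k, q) \<in> set_pmf F. R' a s' \<and> k \<le> K + K' \<and> q \<le> Q + Q'"
    unfolding F_def using E D(2) by (fastforce intro: add_mono)
  have F3: "runs acc (p @ p') s (map_pmf snd F)"
    unfolding runs_def
  proof (intro allI)
    fix cs k q
    have "exec acc (Config ((p @ p') @ cs) s k q) =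
       bind_spmf (spmf_of_pmf D) (\<lambda>x. exec acc (Config (p' @ cs) (fst (snd x)) (k + fst (snd (snd x))) (q + snd (snd (snd x)))))"
      using D(3) unfolding runs_def
      by (simp add: case_prod_unfold bind_map_spmf o_def flip: map_spmf_of_pmf)
    also have "\<dots> = bind_spmf (spmf_of_pmf D) (\<lambda>x. bind_spmf (spmf_of_pmf (map_pmf snd (E x)))
       (\<lambda>(s', k', q'). exec acc (Config cs s' (k + fst (snd (snd x)) + k') (q + snd (snd (snd x)) + q'))))"
      using E unfolding runs_def by (intro bind_spmf_cong) auto
    also have "\<dots> = bind_spmf (spmf_of_pmf (map_pmf snd F)) (\<lambda>(s', k', q'). exec acc (Config cs s' (k + k') (q + q')))"
      unfolding F_def
      by (simp add: case_prod_unfold bind_map_pmf bind_assoc_pmf o_def map_bind_pmf pmf.map_comp add.assoc)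
    finally show "exec acc (Config ((p @ p') @ cs) s k q) =
       bind_spmf (spmf_of_pmf (map_pmf snd F)) (\<lambda>(s', k', q'). exec acc (Config cs s' (k + k') (q + q')))" .
  qed
  show ?thesis unfolding triple_def using F1 F2 F3 by blast
qed

text \<open>The common scheme behind all instruction rules: one step draws \<open>a\<close> from
  \<open>A\<close>, prepends the code \<open>c a\<close>, moves to the store \<open>g a\<close> and
  adds \<open>d\<close> to the ask counter. Instructions without randomness use the one-point
  distribution.\<close>

lemma triple_step:
  assumes step: "\<And>cs k q. step acc (Config (i # cs) s k q) =
       map_pmf (\<lambda>a. Config (c a @ cs) (g a) (Suc k) (q + d)) A"
    and "\<And>a. a \<in> set_pmf A \<Longrightarrow> triple acc (c a @ p) (g a) (B a) R K Q"
  shows "triple acc (i # p) s (bind_pmf A B) R (Suc K) (Q + d)"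
proof -
  define E where "E a = (SOME E. map_pmf fst E = B a \<and>
     (\<forall>(a, s', k, q) \<in> set_pmf E. R a s' \<and> k \<le> K \<and> q \<le> Q) \<and>
     runs acc (c a @ p) (g a) (map_pmf snd E))" for a
  have E: "map_pmf fst (E a) = B a \<and>
     (\<forall>(a, s', k, q) \<in> set_pmf (E a). R a s' \<and> k \<le> K \<and> q \<le> Q) \<and>
     runs acc (c a @ p) (g a) (map_pmf snd (E a))" if "a \<in> set_pmf A" for a
    using assms(2)[OF that] unfolding triple_def E_def by (rule someI_ex)
  define F where "F = bind_pmf A (\<lambda>a. map_pmf (\<lambda>(b, s'', k', q'). (b, s'', Suc k', q' + d)) (E a))"
  have F1: "map_pmf fst F = bind_pmf A B"
    unfolding F_def using E
    by (auto simp: map_bind_pmf pmf.map_comp case_prod_unfold o_def intro!: bind_pmf_cong)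
  have F2: "\<forall>(a, s', k, q) \<in> set_pmf F. R a s' \<and> k \<le> Suc K \<and> q \<le> Q + d"
    unfolding F_def using E by (fastforce intro: add_mono)
  have F3: "runs acc (i # p) s (map_pmf snd F)"
    unfolding runs_def
  proof (intro allI)
    fix cs k q
    have "exec acc (Config ((i # p) @ cs) s k q) =
       bind_spmf (spmf_of_pmf A) (\<lambda>a. exec acc (Config ((c a @ p) @ cs) (g a) (Suc k) (q + d)))"
      by (simp add: exec_Cons step bind_map_spmf o_def flip: map_spmf_of_pmf)
    also have "\<dots> = bind_spmf (spmf_of_pmf A) (\<lambda>a. bind_spmf (spmf_of_pmf (map_pmf snd (E a)))
       (\<lambda>(s', k', q'). exec acc (Config cs s' (Suc k + k') (q + d + q'))))"
      using E unfolding runs_def by (intro bind_spmf_cong refl) (auto simp del: append_assoc)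
    also have "\<dots> = bind_spmf (spmf_of_pmf (map_pmf snd F)) (\<lambda>(s', k', q'). exec acc (Config cs s' (k + k') (q + q')))"
      unfolding F_def
      by (simp add: case_prod_unfold bind_map_pmf bind_assoc_pmf o_def map_bind_pmf pmf.map_comp ac_simps)
    finally show "exec acc (Config ((i # p) @ cs) s k q) =
       bind_spmf (spmf_of_pmf (map_pmf snd F)) (\<lambda>(s', k', q'). exec acc (Config cs s' (k + k') (q + q')))" .
  qed
  show ?thesis unfolding triple_def using F1 F2 F3 by blast
qed

lemma triple_Assign:
  assumes "triple acc p (s(x := eval_expr s e)) A R K Q"
  shows "triple acc (Assign x e # p) s A R (Suc K) Q"
  using triple_step[where A = "return_pmf ()" and c = "\<lambda>_. []" and g = "\<lambda>_. s(x := eval_expr s e)"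
      and d = 0 and B = "\<lambda>_. A" and i = "Assign x e", of acc s p R K Q] assms
  by (simp add: bind_return_pmf)

lemma triple_Flip:
  assumes "\<And>b. triple acc p (s(x := enc_bit b)) (A b) R K Q"
  shows "triple acc (Flip x # p) s (bind_pmf (pmf_of_set {0, 1}) A) R (Suc K) Q"
  using triple_step[where A = "pmf_of_set {0, 1}" and c = "\<lambda>_. []" and g = "\<lambda>b. s(x := enc_bit b)"
      and d = 0 and B = A and i = "Flip x", of acc s p R K Q] assms
  by simp

lemma triple_Ask:
  assumes "acc (eval_expr s e) = map_pmf h D"
    and "\<And>a. a \<in> set_pmf D \<Longrightarrow> triple acc p (s(x := h a)) (A a) R K Q"
  shows "triple acc (Ask x e # p) s (bind_pmf D A) R (Suc K) (Suc Q)"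
  using triple_step[where A = D and c = "\<lambda>_. []" and g = "\<lambda>b. s(x := h b)"
      and d = 1 and B = A and i = "Ask x e", of acc s p R K Q] assms
  by (simp add: pmf.map_comp o_def)

lemma triple_Cond:
  assumes "triple acc ((if eval_expr s e \<noteq> Nul then as else bs) @ p) s A R K Q"
  shows "triple acc (Cond e as bs # p) s A R (Suc K) Q"
  using triple_step[where A = "return_pmf ()" and c = "\<lambda>_. if eval_expr s e \<noteq> Nul then as else bs" and g = "\<lambda>_. s"
      and d = 0 and B = "\<lambda>_. A" and i = "Cond e as bs", of acc s p R K Q] assms
  by (simp add: bind_return_pmf)

lemma triple_While_False:
  assumes "eval_expr s e = Nul" "triple acc p s A R K Q"
  shows "triple acc (While e as # p) s A R (Suc K) Q"
  using triple_step[where A = "return_pmf ()" and c = "\<lambda>_. []" and g = "\<lambda>_. s"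
      and d = 0 and B = "\<lambda>_. A" and i = "While e as", of acc s p R K Q] assms
  by (simp add: bind_return_pmf)

lemma triple_While_True:
  assumes "eval_expr s e \<noteq> Nul" "triple acc (as @ While e as # p) s A R K Q"
  shows "triple acc (While e as # p) s A R (Suc K) Q"
  using triple_step[where A = "return_pmf ()" and c = "\<lambda>_. as @ [While e as]" and g = "\<lambda>_. s"
      and d = 0 and B = "\<lambda>_. A" and i = "While e as", of acc s p R K Q] assms
  by (simp add: bind_return_pmf)

section \<open>Loops as monadic folds\<close>

primrec foldM :: "('e \<Rightarrow> 'a \<Rightarrow> 'a pmf) \<Rightarrow> 'e list \<Rightarrow> 'a \<Rightarrow> 'a pmf" where
  "foldM f [] a = return_pmf a"
| "foldM f (e # es) a = bind_pmf (f e a) (foldM f es)"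

text \<open>The ghost list \<open>es\<close> of the rounds still to come is at once the loop variant
  and the list consumed by the abstract fold; the guard has to agree with its emptiness. A round
  costs its body plus one test of the guard, and one last test leaves the loop.\<close>

lemma triple_foldM:
  assumes "I es a s"
    and body: "\<And>e es a s. I (e # es) a s \<Longrightarrow> eval_expr s g \<noteq> Nul \<and> triple acc body s (B e a) (I es) K Q"
    and exit: "\<And>a s. I [] a s \<Longrightarrow> eval_expr s g = Nul"
  shows "triple acc [While g body] s (foldM B es a) (I []) (length es * Suc K + 1) (length es * Q)"
  using assms(1)
proof (induction es arbitrary: a s)
  case Nil
  show ?case using exit[OF Nil] Nil by (auto intro!: triple_While_False triple_Nil)
next
  case (Cons e es)
  note b = body[OF Cons.prems]
  have "triple acc (body @ [While g body]) s (bind_pmf (B e a) (foldM B es)) (I [])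
     (K + (length es * Suc K + 1)) (Q + length es * Q)"
    by (rule triple_append[OF conjunct2[OF b]]) (rule Cons.IH)
  then have "triple acc [While g body] s (bind_pmf (B e a) (foldM B es)) (I [])
     (Suc (K + (length es * Suc K + 1))) (Q + length es * Q)"
    using b by (intro triple_While_True) auto
  then show ?case by (simp add: algebra_simps)
qed

text \<open>Pushing fresh samples builds the list in reverse order of drawing. Independent draws
  commute, so the law is still that of \<open>replicate_pmf\<close>.\<close>

lemma foldM_replicate:
  "foldM (\<lambda>_ xs. map_pmf (\<lambda>x. x # xs) p) (replicate k ()) ys = map_pmf (\<lambda>xs. xs @ ys) (replicate_pmf k p)"
proof (induction k arbitrary: ys)
  case (Suc k)
  have "foldM (\<lambda>_ xs. map_pmf (\<lambda>x. x # xs) p) (replicate (Suc k) ()) ys =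
    bind_pmf p (\<lambda>x. map_pmf (\<lambda>xs. xs @ x # ys) (replicate_pmf k p))"
    by (simp add: Suc bind_map_pmf)
  also have "\<dots> = map_pmf (\<lambda>xs. xs @ ys) (replicate_pmf (k + 1) p)"
    unfolding replicate_pmf_distrib replicate_pmf_1
    by (simp add: map_pmf_def bind_assoc_pmf bind_return_pmf) (rule bind_commute_pmf)
  finally show ?case by simp
qed simp

lemma triple_replicate:
  assumes "I m [] s"
    and body: "\<And>j xs s. I (Suc j) xs s \<Longrightarrow> eval_expr s g \<noteq> Nul \<and>
       triple acc body s (map_pmf (\<lambda>x. x # xs) p) (I j) K Q"
    and exit: "\<And>xs s. I 0 xs s \<Longrightarrow> eval_expr s g = Nul"
  shows "triple acc [While g body] s (replicate_pmf m p) (I 0) (m * Suc K + 1) (m * Q)"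
  using triple_foldM[where I = "\<lambda>es. I (length es)" and es = "replicate m ()" and a = "[]" and s = s
    and g = g and acc = acc and body = body and B = "\<lambda>_ xs. map_pmf (\<lambda>x. x # xs) p" and K = K and Q = Q] assms
  by (simp add: foldM_replicate)

section \<open>Deterministic code\<close>

definition det :: "access \<Rightarrow> prog \<Rightarrow> store \<Rightarrow> (store \<Rightarrow> bool) \<Rightarrow> nat \<Rightarrow> bool" where
  "det acc p s R K \<longleftrightarrow> triple acc p s (return_pmf ()) (\<lambda>_. R) K 0"

lemma triple_det:
  assumes "det acc p s R K" "\<And>s'. R s' \<Longrightarrow> triple acc p' s' A R' K' Q'"
  shows "triple acc (p @ p') s A R' (K + K') Q'"
  using triple_append[OF assms(1)[unfolded det_def], of p' "\<lambda>_. A" R' K' Q'] assms(2)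
  by (simp add: bind_return_pmf)

lemma det_det:
  assumes "det acc p s R K" "\<And>s'. R s' \<Longrightarrow> det acc p' s' R' K'"
  shows "det acc (p @ p') s R' (K + K')"
  using triple_det[OF assms(1), of p'] assms(2) unfolding det_def by auto

lemma det_weaken:
  assumes "det acc p s R K" "\<And>s'. R s' \<Longrightarrow> R' s'" "K \<le> K'"
  shows "det acc p s R' K'"
  using assms unfolding det_def by (auto intro: triple_weaken)

lemma det_Nil: "R s \<Longrightarrow> det acc [] s R 0"
  unfolding det_def by (rule triple_Nil)

lemma det_triple: "det acc p s (R a) K \<Longrightarrow> triple acc p s (return_pmf a) R K 0"
  using triple_det[of acc p s "R a" K "[]" "return_pmf a" R 0 0] by (simp add: triple_Nil)

lemma det_Assign: "det acc p (s(x := eval_expr s e)) R K \<Longrightarrow> det acc (Assign x e # p) s R (Suc K)"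
  unfolding det_def by (rule triple_Assign)

lemma det_Cond: "det acc ((if eval_expr s e \<noteq> Nul then as else bs) @ p) s R K \<Longrightarrow> det acc (Cond e as bs # p) s R (Suc K)"
  unfolding det_def by (rule triple_Cond)

lemma foldM_return: "foldM (\<lambda>e a. return_pmf (f e a)) es a = return_pmf (fold f es a)"
  by (induction es arbitrary: a) (simp_all add: bind_return_pmf)

lemma det_While:
  assumes "I es s"
    and body: "\<And>e es s. I (e # es) s \<Longrightarrow> eval_expr s g \<noteq> Nul \<and> det acc body s (I es) K"
    and exit: "\<And>s. I [] s \<Longrightarrow> eval_expr s g = Nul"
  shows "det acc [While g body] s (I []) (length es * Suc K + 1)"
proof -
  have "triple acc [While g body] s (foldM (\<lambda>_ _. return_pmf ()) es ()) (\<lambda>_. I []) (length es * Suc K + 1) (length es * 0)"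
    using body exit by (intro triple_foldM[where I = "\<lambda>es _. I es"]) (auto simp: assms(1) det_def)
  then show ?thesis by (simp add: det_def foldM_return)
qed

text \<open>The accumulator is no result of the program, so the invariant carries it existentially:
  whichever value is current, folding the remaining list from it gives the final value.\<close>

lemma det_fold:
  assumes "I es a s"
    and body: "\<And>e es a s. I (e # es) a s \<Longrightarrow> eval_expr s g \<noteq> Nul \<and> det acc body s (I es (f e a)) K"
    and exit: "\<And>a s. I [] a s \<Longrightarrow> eval_expr s g = Nul"
  shows "det acc [While g body] s (I [] (fold f es a)) (length es * Suc K + 1)"
proof -
  have "det acc [While g body] s (\<lambda>s. I [] (fold f [] (fold f es a)) s) (length es * Suc K + 1)"
    using body exit assms(1) by (intro det_While[where I = "\<lambda>es' s. \<exists>a'. fold f es' a' = fold f es a \<and> I es' a' s", THEN det_weaken])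
       (fastforce intro: det_weaken)+
  then show ?thesis by simp
qed

text \<open>For the empty continuation \<open>runs\<close> presents the execution as the image of a
  \<open>pmf\<close>. This is how termination with probability one is obtained: an activation
  described by a triple loses no probability mass.\<close>

lemma rel_spmf_activate:
  assumes "triple acc p ((store C)(0 := enc_bits m)) A R K Q"
  shows "rel_spmf (\<lambda>a C'. R a (store C') \<and> steps C' \<le> steps C + K \<and> asks C' \<le> asks C + Q)
    (spmf_of_pmf A) (activate acc p C m)"
proof -
  obtain D where D: "map_pmf fst D = A"
    "\<And>a s' k q. (a, s', k, q) \<in> set_pmf D \<Longrightarrow> R a s' \<and> k \<le> K \<and> q \<le> Q"
    "runs acc p ((store C)(0 := enc_bits m)) (map_pmf snd D)"
    by (rule tripleE[OF assms]) (rule that)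
  have "activate acc p C m = map_spmf (\<lambda>(a, s', k', q'). Config [] s' (steps C + k') (asks C + q')) (spmf_of_pmf D)"
    using D(3)[unfolded runs_def, rule_format, of "[]" "steps C" "asks C"] unfolding activate_def
    by (simp add: map_spmf_conv_bind_spmf case_prod_unfold bind_map_pmf)
  moreover have "spmf_of_pmf A = map_spmf fst (spmf_of_pmf D)"
    using D(1) by simp
  ultimately show ?thesis
    using D(2) by (auto simp: pmf.rel_map intro!: rel_pmf_reflI)
qed

section \<open>Fourier analysis and concentration\<close>

declare add_bit_eq_xor [simp del] mult_bit_eq_and [simp del]

section \<open>The cube, its uniform distribution and its characters\<close>

lemma finite_cube [simp]: "finite (cube n)"
proof -
  have "cube n = {xs. set xs \<subseteq> {0, 1} \<and> length xs = n}"
    unfolding cube_def by auto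
  then show ?thesis using finite_lists_length_eq[of "{0, 1 :: bit}" n] by simp
qed

lemma cube_0 [simp]: "cube 0 = {[]}"
  by (auto simp: cube_def)

lemma cubeD: "x \<in> cube n \<Longrightarrow> length x = n"
  by (simp add: cube_def)

lemma cube_Suc: "cube (Suc n) = (\<lambda>x. 0 # x) ` cube n \<union> (\<lambda>x. 1 # x) ` cube n"
proof -
  have "x \<in> cube (Suc n) \<Longrightarrow> x \<in> (\<lambda>x. 0 # x) ` cube n \<union> (\<lambda>x. 1 # x) ` cube n" for x
    by (cases x; cases "hd x") (auto simp: cube_def)
  then show ?thesis by (auto simp: cube_def)
qed

lemma sum_cube_Suc: "sum g (cube (Suc n)) = (\<Sum>x\<in>cube n. g (0 # x)) + (\<Sum>x\<in>cube n. g (1 # x))"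
  unfolding cube_Suc by (subst sum.union_disjoint) (auto simp: sum.reindex inj_on_def)

lemma card_cube [simp]: "card (cube n) = 2 ^ n"
proof (induction n)
  case (Suc n)
  then show ?case using sum_cube_Suc[of "\<lambda>_. 1 :: nat" n] by simp
qed simp

lemma cube_ne [simp]: "cube n \<noteq> {}"
  using card_cube[of n] by (metis card.empty power_not_zero zero_neq_numeral)

abbreviation unif :: "nat \<Rightarrow> bit list pmf" where "unif n \<equiv> pmf_of_set (cube n)"

lemma set_unif [simp]: "set_pmf (unif n) = cube n"
  by simp

abbreviation expect :: "'a pmf \<Rightarrow> ('a \<Rightarrow> real) \<Rightarrow> real" where
  "expect p g \<equiv> measure_pmf.expectation p g"

lemma expect_unif: "expect (unif n) g = (\<Sum>x\<in>cube n. g x) / 2 ^ n"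
  by (simp add: integral_pmf_of_set)

lemma expect_bind:
  assumes "finite (set_pmf p)" "\<And>x. x \<in> set_pmf p \<Longrightarrow> finite (set_pmf (f x))"
  shows "expect (bind_pmf p f) g = expect p (\<lambda>x. expect (f x) g)"
  using assms by (subst pmf_expectation_bind[of "set_pmf p"]) (auto simp: integral_measure_pmf)

text \<open>The nontrivial character of the two-element group. Programs add bits where the analysis
  multiplies signs, and \<open>sgb\<close> translates between the two.\<close>

definition sgb :: "bit \<Rightarrow> real" where "sgb b = (if b = 0 then 1 else -1)"

lemma sgb_0 [simp]: "sgb 0 = 1" and sgb_1 [simp]: "sgb 1 = -1"
  by (simp_all add: sgb_def)

lemma sgb_add: "sgb (a + b) = sgb a * sgb b"
  by (cases a; cases b) auto

lemma abs_sgb [simp]: "\<bar>sgb a\<bar> = 1"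
  by (simp add: sgb_def)

lemma sgb_square [simp]: "sgb a * sgb a = 1" "sgb a * (sgb a * x) = x"
  by (simp_all add: sgb_def)

lemma sgb_sum_list: "sgb (\<Sum>x\<leftarrow>xs. h x) = (\<Prod>x\<leftarrow>xs. sgb (h x))"
  by (induction xs) (simp_all add: sgb_add)

lemma chi_sgb: "chi \<gamma> x = sgb (inner_prod \<gamma> x)"
  by (simp add: chi_def sgb_def)

lemma inner_prod_Nil [simp]: "inner_prod [] x = 0"
  by (simp add: inner_prod_def)

lemma inner_prod_Cons [simp]: "inner_prod (a # \<gamma>) (b # x) = a * b + inner_prod \<gamma> x"
  by (simp add: inner_prod_def sum.lessThan_Suc_shift del: sum.lessThan_Suc)

lemma inner_prod_append:
  "length \<delta> = length z \<Longrightarrow> inner_prod (\<delta> @ \<gamma>) (z @ x) = inner_prod \<delta> z + inner_prod \<gamma> x"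
  by (induction \<delta> z rule: list_induct2) (auto simp: add.assoc)

definition vadd :: "bit list \<Rightarrow> bit list \<Rightarrow> bit list" where "vadd x y = map2 (+) x y"

lemma vadd_simps [simp]: "vadd [] y = []" "vadd (a # x) (b # y) = (a + b) # vadd x y"
  by (simp_all add: vadd_def)

lemma length_vadd [simp]: "length (vadd x y) = min (length x) (length y)"
  by (simp add: vadd_def)

lemma vadd_cube [simp]: "x \<in> cube n \<Longrightarrow> y \<in> cube n \<Longrightarrow> vadd x y \<in> cube n"
  by (simp add: cube_def)

lemma bit_double [simp]: "a + a = (0::bit)" "a + (a + b) = (b::bit)" for a b :: bit
  by (cases a; simp)+

lemma chi_Nil [simp]: "chi [] x = 1"
  by (simp add: chi_def)

lemma chi_vadd:
  assumes "length x = length y" "length y = length \<gamma>"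
  shows "chi \<gamma> (vadd x y) = chi \<gamma> x * chi \<gamma> y"
proof -
  have "inner_prod \<gamma> (vadd x y) = inner_prod \<gamma> x + inner_prod \<gamma> y"
    using assms
  proof (induction x y \<gamma> rule: list_induct3)
    case (Cons x xs y ys z zs)
    then show ?case by (simp add: distrib_left ac_simps)
  qed simp
  then show ?thesis by (simp add: chi_sgb sgb_add)
qed

text \<open>Orthogonality by induction on the dimension: the sum factors coordinatewise, and the
  factor \<open>1 + sgb a * sgb b\<close> is 2 for equal letters and 0 otherwise.\<close>

lemma sum_chi:
  assumes "length x = n" "length y = n"
  shows "(\<Sum>\<gamma>\<in>cube n. chi \<gamma> x * chi \<gamma> y) = (if x = y then 2 ^ n else 0)"
  using assms
proof (induction n arbitrary: x y)
  case (Suc n)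
  obtain a x' b y' where xy: "x = a # x'" "y = b # y'" and l: "length x' = n" "length y' = n"
    using Suc.prems by (auto simp: length_Suc_conv)
  have "(\<Sum>\<gamma>\<in>cube (Suc n). chi \<gamma> x * chi \<gamma> y) = (\<Sum>\<gamma>\<in>cube n. chi \<gamma> x' * chi \<gamma> y') * (1 + sgb a * sgb b)"
    unfolding sum_cube_Suc xy
    by (simp add: chi_sgb sgb_add sum_distrib_left distrib_left mult_ac sum_distrib_right sum.distrib)
  then show ?case using Suc.IH[OF l] by (auto simp: xy sgb_def split: if_splits)
qed auto

section \<open>Inversion, Parseval and the fourth moment\<close>

lemma fourier_inversion:
  assumes "x \<in> cube n"
  shows "f x = (\<Sum>\<gamma>\<in>cube n. fourier n f \<gamma> * chi \<gamma> x)"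
proof -
  have "(\<Sum>\<gamma>\<in>cube n. fourier n f \<gamma> * chi \<gamma> x) =
     (\<Sum>\<gamma>\<in>cube n. \<Sum>y\<in>cube n. f y * (chi \<gamma> y * chi \<gamma> x) / 2 ^ n)"
    by (simp add: fourier_def expect_unif sum_distrib_right sum_divide_distrib mult.assoc)
  also have "\<dots> = (\<Sum>y\<in>cube n. f y * (\<Sum>\<gamma>\<in>cube n. chi \<gamma> y * chi \<gamma> x) / 2 ^ n)"
    by (subst sum.swap) (simp add: sum_distrib_left sum_divide_distrib)
  also have "\<dots> = (\<Sum>y\<in>cube n. if y = x then f y else 0)"
    by (intro sum.cong refl) (simp add: sum_chi[OF cubeD cubeD[OF assms]])
  also have "\<dots> = f x" using assms by simp
  finally show ?thesis by simp
qed

lemma expect_unif_sum: "expect (unif n) (\<lambda>x. \<Sum>\<gamma>\<in>G. h \<gamma> x) = (\<Sum>\<gamma>\<in>G. expect (unif n) (h \<gamma>))"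
  unfolding expect_unif by (subst sum.swap) (simp add: sum_divide_distrib)

lemma expect_unif_cong:
  "(\<And>x. x \<in> cube n \<Longrightarrow> g x = h x) \<Longrightarrow> expect (unif n) g = expect (unif n) h"
  by (simp add: expect_unif cong: sum.cong)

text \<open>Only one of the two factors \<open>f x\<close> is expanded; averaging the other one
  against each character gives back its coefficient.\<close>

lemma parseval: "expect (unif n) (\<lambda>x. (f x)\<^sup>2) = (\<Sum>\<gamma>\<in>cube n. (fourier n f \<gamma>)\<^sup>2)"
proof -
  have "expect (unif n) (\<lambda>x. (f x)\<^sup>2) = expect (unif n) (\<lambda>x. \<Sum>\<gamma>\<in>cube n. fourier n f \<gamma> * (f x * chi \<gamma> x))"
    unfolding power2_eq_square
    by (intro expect_unif_cong, subst (2) fourier_inversion) (simp_all add: sum_distrib_left mult_ac)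
  also have "\<dots> = (\<Sum>\<gamma>\<in>cube n. (fourier n f \<gamma>)\<^sup>2)"
    by (simp add: expect_unif_sum power2_eq_square) (simp add: fourier_def)
  finally show ?thesis .
qed

text \<open>Only the factor at the sum of the three points is expanded. Its characters split into
  characters of x, y and z, and averaging over each of these independent points yields one more copy
  of the same coefficient.\<close>

lemma fourth_moment:
  "expect (unif n) (\<lambda>x. expect (unif n) (\<lambda>y. expect (unif n) (\<lambda>z.
     f x * f y * f z * f (vadd x (vadd y z))))) = (\<Sum>\<gamma>\<in>cube n. fourier n f \<gamma> ^ 4)"
proof -
  have "expect (unif n) (\<lambda>x. expect (unif n) (\<lambda>y. expect (unif n) (\<lambda>z.
     f x * f y * f z * f (vadd x (vadd y z))))) =
     expect (unif n) (\<lambda>x. expect (unif n) (\<lambda>y. expect (unif n) (\<lambda>z. \<Sum>\<gamma>\<in>cube n.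
     (f z * chi \<gamma> z) * (fourier n f \<gamma> * (f x * chi \<gamma> x) * (f y * chi \<gamma> y)))))"
  proof (intro expect_unif_cong)
    fix x y z assume c: "x \<in> cube n" "y \<in> cube n" "z \<in> cube n"
    have "f (vadd x (vadd y z)) = (\<Sum>\<gamma>\<in>cube n. fourier n f \<gamma> * chi \<gamma> (vadd x (vadd y z)))"
      using c by (intro fourier_inversion) simp
    also have "\<dots> = (\<Sum>\<gamma>\<in>cube n. fourier n f \<gamma> * (chi \<gamma> x * chi \<gamma> y * chi \<gamma> z))"
      using c by (intro sum.cong) (auto simp: chi_vadd cube_def)
    finally show "f x * f y * f z * f (vadd x (vadd y z)) = (\<Sum>\<gamma>\<in>cube n.
     (f z * chi \<gamma> z) * (fourier n f \<gamma> * (f x * chi \<gamma> x) * (f y * chi \<gamma> y)))"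
      by (simp add: sum_distrib_left mult_ac)
  qed
  also have "\<dots> = (\<Sum>\<gamma>\<in>cube n. fourier n f \<gamma> * fourier n f \<gamma> * (fourier n f \<gamma> * fourier n f \<gamma>))"
    by (simp add: expect_unif_sum flip: fourier_def) (simp add: mult_ac)
  finally show ?thesis by (simp add: power4_eq_xxxx mult.assoc)
qed

section \<open>Fourier weight of the vectors with a given suffix\<close>

lemma sum_cube_append:
  "sum g (cube (r + k)) = (\<Sum>z\<in>cube r. \<Sum>x\<in>cube k. g (z @ x))"
  by (induction r arbitrary: g) (simp_all add: sum_cube_Suc)

definition weight :: "nat \<Rightarrow> (bit list \<Rightarrow> real) \<Rightarrow> bit list \<Rightarrow> real" where
  "weight r f \<alpha> = (\<Sum>\<delta>\<in>cube r. (fourier (r + length \<alpha>) f (\<delta> @ \<alpha>))\<^sup>2)"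

text \<open>For a fixed prefix z the average over x and y is the square of \<open>g z\<close>, the
  coefficient at \<alpha> of the restriction of f to this prefix. As a function of z,
  \<open>g\<close> has at \<delta> the coefficient of f at \<open>\<delta> @ \<alpha>\<close>, so
  Parseval for \<open>g\<close> gives the weight. Thus two queries with a common random prefix
  estimate it.\<close>

lemma weight_expect:
  assumes "length \<alpha> = k"
  shows "expect (unif r) (\<lambda>z. expect (unif k) (\<lambda>x. expect (unif k) (\<lambda>y.
    f (z @ x) * f (z @ y) * chi \<alpha> x * chi \<alpha> y))) = weight r f \<alpha>"
proof -
  define g where "g z = expect (unif k) (\<lambda>x. f (z @ x) * chi \<alpha> x)" for z
  have "expect (unif r) (\<lambda>z. expect (unif k) (\<lambda>x. expect (unif k) (\<lambda>y.
    f (z @ x) * f (z @ y) * chi \<alpha> x * chi \<alpha> y))) =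
    expect (unif r) (\<lambda>z. expect (unif k) (\<lambda>x. expect (unif k) (\<lambda>y.
    (f (z @ y) * chi \<alpha> y) * (f (z @ x) * chi \<alpha> x))))"
    by (simp add: mult_ac)
  also have "\<dots> = expect (unif r) (\<lambda>z. (g z)\<^sup>2)"
    by (simp add: g_def power2_eq_square)
  also have "\<dots> = (\<Sum>\<delta>\<in>cube r. (fourier r g \<delta>)\<^sup>2)"
    by (rule parseval)
  also have "\<dots> = weight r f \<alpha>"
    unfolding weight_def assms
  proof (intro sum.cong refl arg_cong[where f = "\<lambda>x. x\<^sup>2"])
    fix \<delta> assume "\<delta> \<in> cube r"
    then have "fourier (r + k) f (\<delta> @ \<alpha>) =
        (\<Sum>z\<in>cube r. \<Sum>x\<in>cube k. f (z @ x) * (chi \<delta> z * chi \<alpha> x)) / 2 ^ (r + k)"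
      unfolding fourier_def expect_unif sum_cube_append
      by (intro arg_cong2[where f = "(/)"] sum.cong refl) (auto simp: chi_sgb inner_prod_append sgb_add cube_def)
    also have "\<dots> = fourier r g \<delta>"
      unfolding fourier_def expect_unif g_def
      by (simp add: sum_distrib_left sum_distrib_right sum_divide_distrib power_add mult_ac)
    finally show "fourier r g \<delta> = fourier (r + k) f (\<delta> @ \<alpha>)" by simp
  qed
  finally show ?thesis .
qed

lemma weight_0: "weight 0 f \<alpha> = (fourier (length \<alpha>) f \<alpha>)\<^sup>2"
  by (simp add: weight_def)

lemma weight_nonneg: "0 \<le> weight r f \<alpha>"
  unfolding weight_def by (intro sum_nonneg) auto

text \<open>A suffix class splits by the letter in front of the suffix. Both parts are nonnegative,
  so an extension is never heavier than its suffix; hence pruning light suffixes loses no heavy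
  vector.\<close>

lemma weight_Cons: "weight (Suc r) f \<alpha> = weight r f (0 # \<alpha>) + weight r f (1 # \<alpha>)"
proof -
  have "weight (Suc r) f \<alpha> = (\<Sum>\<delta>\<in>cube (r + 1). (fourier (Suc r + length \<alpha>) f (\<delta> @ \<alpha>))\<^sup>2)"
    by (simp add: weight_def)
  also have "\<dots> = (\<Sum>\<delta>\<in>cube r. \<Sum>x\<in>cube 1. (fourier (Suc r + length \<alpha>) f ((\<delta> @ x) @ \<alpha>))\<^sup>2)"
    by (rule sum_cube_append)
  also have "\<dots> = weight r f (0 # \<alpha>) + weight r f (1 # \<alpha>)"
    by (simp add: weight_def sum_cube_Suc sum.distrib)
  finally show ?thesis .
qed

lemma sum_weight:
  "(\<Sum>\<alpha>\<in>cube k. weight r f \<alpha>) = (\<Sum>\<gamma>\<in>cube (r + k). (fourier (r + k) f \<gamma>)\<^sup>2)"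
proof -
  have "(\<Sum>\<alpha>\<in>cube k. weight r f \<alpha>) = (\<Sum>\<alpha>\<in>cube k. \<Sum>\<delta>\<in>cube r. (fourier (r + k) f (\<delta> @ \<alpha>))\<^sup>2)"
    by (intro sum.cong) (auto simp: weight_def cube_def)
  then show ?thesis by (subst (asm) sum.swap) (simp add: sum_cube_append)
qed

section \<open>Independent samples and concentration\<close>

lemma replicate_coin: "replicate_pmf k (pmf_of_set {0, 1}) = unif k"
proof (induction k)
  case (Suc k)
  have "bij_betw (\<lambda>(b, x). b # x) ({0, 1} \<times> cube k) (cube (Suc k))"
    by (auto simp: bij_betw_def inj_on_def cube_Suc)
  then have "unif (Suc k) = map_pmf (\<lambda>(b, x). b # x) (pmf_of_set ({0, 1} \<times> cube k))"
    by (intro map_pmf_of_set_bij_betw[symmetric]) auto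
  also have "pmf_of_set ({0, 1} \<times> cube k) = pair_pmf (pmf_of_set {0, 1}) (unif k)"
    by (rule pmf_eqI) (auto simp: pmf_pair indicator_def)
  finally show ?case using Suc by (simp add: pair_pmf_def map_bind_pmf)
qed (simp add: pmf_of_set_singleton)

text \<open>By independence the mean of a product is the product of the means. This serves twice:
  for the moment generating function in Hoeffding's bound, and for products of four examples, whose
  mean is a fourth power.\<close>

lemma expect_exp_replicate:
  assumes "finite (set_pmf p)"
  shows "expect (replicate_pmf m p) (\<lambda>xs. \<Prod>x\<leftarrow>xs. g x) = expect p g ^ m"
proof (induction m)
  case (Suc m)
  have fin: "finite (set_pmf (replicate_pmf m p))" for m
    using finite_lists_length_eq[OF assms] by (auto simp: set_replicate_pmf lists_eq_set Collect_conj_eq Int_commute)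
  have "replicate_pmf (Suc m) p = bind_pmf p (\<lambda>x. map_pmf (\<lambda>xs. x # xs) (replicate_pmf m p))"
    by (simp add: map_pmf_def)
  then have "expect (replicate_pmf (Suc m) p) (\<lambda>xs. \<Prod>x\<leftarrow>xs. g x) =
     expect p (\<lambda>x. g x * expect (replicate_pmf m p) (\<lambda>xs. \<Prod>x\<leftarrow>xs. g x))"
    using assms fin by (simp add: expect_bind del: replicate_pmf.simps)
  then show ?case using Suc by simp
qed simp

text \<open>Markov's inequality for the exponential of the sum, with Hoeffding's lemma for the
  interval from -1 to 1. For \<open>e = 0\<close> the bound equals 1.\<close>

lemma hoeffding:
  assumes fin: "finite (set_pmf p)" and b: "\<And>x. x \<in> set_pmf p \<Longrightarrow> \<bar>g x\<bar> \<le> 1" and "e \<ge> 0"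
  shows "measure (replicate_pmf m p) {xs. (\<Sum>x\<leftarrow>xs. g x) \<ge> real m * (expect p g + e)} \<le> exp (- (real m * e\<^sup>2 / 2))"
proof (cases "e = 0")
  case False
  then have "e > 0" using assms by simp
  interpret interval_bounded_random_variable "measure_pmf p" g "-1" 1
  proof unfold_locales
    show "AE x in measure_pmf p. g x \<in> {-1..1}"
      using b by (auto simp: AE_measure_pmf_iff abs_le_iff)
  qed simp
  define \<mu> where "\<mu> = expect p g"
  have finr: "finite (set_pmf (replicate_pmf m p))"
    using finite_lists_length_eq[OF fin] by (auto simp: set_replicate_pmf lists_eq_set Collect_conj_eq Int_commute)
  have "(\<integral>\<^sup>+x. ennreal (exp (e * (g x - \<mu>))) \<partial>p) \<le> ennreal (exp (e\<^sup>2 * 4 / 8))"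
    using Hoeffdings_lemma_nn_integral[OF \<open>e > 0\<close>] by (simp add: \<mu>_def)
  then have "expect p (\<lambda>x. exp (e * (g x - \<mu>))) \<le> exp (e\<^sup>2 / 2)"
    by (subst (asm) nn_integral_eq_integral) (auto intro: integrable_measure_pmf_finite fin)
  \<comment> \<open>The exponential parameter is the deviation \<open>e\<close> itself: an interval
    of length 2 gives the exponent \<lambda>^2 / 2 - \<lambda> * e per sample, which is smallest at
    \<lambda> = e.\<close>
  then have mgf: "expect p (\<lambda>x. exp (e * (g x - \<mu>))) ^ m \<le> exp (real m * (e\<^sup>2 / 2))"
    unfolding exp_of_nat_mult by (intro power_mono) auto
  have prod: "(\<Prod>x\<leftarrow>xs. exp (e * (g x - \<mu>))) = exp (e * ((\<Sum>x\<leftarrow>xs. g x) - real (length xs) * \<mu>))" for xs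
    by (induction xs) (auto simp: exp_add[symmetric] algebra_simps)
  have "measure (replicate_pmf m p) {xs. (\<Sum>x\<leftarrow>xs. g x) \<ge> real m * (\<mu> + e)} \<le>
     measure (replicate_pmf m p) {xs. (\<Prod>x\<leftarrow>xs. exp (e * (g x - \<mu>))) \<ge> exp (real m * e\<^sup>2)}"
  proof (rule measure_pmf.finite_measure_mono_AE)
    have "exp (real m * e\<^sup>2) \<le> (\<Prod>x\<leftarrow>xs. exp (e * (g x - \<mu>)))"
      if "length xs = m" "real m * (\<mu> + e) \<le> (\<Sum>x\<leftarrow>xs. g x)" for xs
    proof -
      have "e * (real m * e) \<le> e * ((\<Sum>x\<leftarrow>xs. g x) - real m * \<mu>)"
        using that \<open>e > 0\<close> by (intro mult_left_mono) (auto simp: algebra_simps)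
      then show ?thesis unfolding prod using that by (simp add: power2_eq_square mult_ac)
    qed
    then show "AE xs in replicate_pmf m p. xs \<in> {xs. (\<Sum>x\<leftarrow>xs. g x) \<ge> real m * (\<mu> + e)} \<longrightarrow>
      xs \<in> {xs. (\<Prod>x\<leftarrow>xs. exp (e * (g x - \<mu>))) \<ge> exp (real m * e\<^sup>2)}"
      by (auto simp: AE_measure_pmf_iff set_replicate_pmf)
  qed simp
  also have "\<dots> \<le> expect (replicate_pmf m p) (\<lambda>xs. \<Prod>x\<leftarrow>xs. exp (e * (g x - \<mu>))) / exp (real m * e\<^sup>2)"
    using integral_Markov_inequality_measure[of "measure_pmf (replicate_pmf m p)"
        "\<lambda>xs. \<Prod>x\<leftarrow>xs. exp (e * (g x - \<mu>))" "{}" "exp (real m * e\<^sup>2)"]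
    by (simp add: integrable_measure_pmf_finite[OF finr] prod)
  also have "\<dots> \<le> exp (real m * (e\<^sup>2 / 2)) / exp (real m * e\<^sup>2)"
    using mgf by (simp add: expect_exp_replicate[OF fin] divide_right_mono)
  also have "\<dots> = exp (- (real m * e\<^sup>2 / 2))"
    by (simp flip: exp_diff)
  finally show ?thesis unfolding \<mu>_def .
qed auto

lemma hoeffding_abs:
  assumes fin: "finite (set_pmf p)" and b: "\<And>x. x \<in> set_pmf p \<Longrightarrow> \<bar>g x\<bar> \<le> 1" and "e \<ge> 0"
  shows "measure (replicate_pmf m p) {xs. \<not> \<bar>(\<Sum>x\<leftarrow>xs. g x) - real m * expect p g\<bar> \<le> real m * e} \<le> 2 * exp (- (real m * e\<^sup>2 / 2))"
proof -
  have neg: "(\<Sum>x\<leftarrow>xs. - g x) = - (\<Sum>x\<leftarrow>xs. g x)" for xs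
    by (induction xs) auto
  have "measure (replicate_pmf m p) {xs. \<not> \<bar>(\<Sum>x\<leftarrow>xs. g x) - real m * expect p g\<bar> \<le> real m * e} \<le>
    measure (replicate_pmf m p) ({xs. (\<Sum>x\<leftarrow>xs. g x) \<ge> real m * (expect p g + e)} \<union>
      {xs. (\<Sum>x\<leftarrow>xs. - g x) \<ge> real m * (expect p (\<lambda>x. - g x) + e)})"
    by (intro measure_pmf.finite_measure_mono) (auto simp: neg algebra_simps abs_le_iff)
  also have "\<dots> \<le> measure (replicate_pmf m p) {xs. (\<Sum>x\<leftarrow>xs. g x) \<ge> real m * (expect p g + e)} +
      measure (replicate_pmf m p) {xs. (\<Sum>x\<leftarrow>xs. - g x) \<ge> real m * (expect p (\<lambda>x. - g x) + e)}"
    by (rule measure_subadditive) auto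
  also have "\<dots> \<le> exp (- (real m * e\<^sup>2 / 2)) + exp (- (real m * e\<^sup>2 / 2))"
    using assms by (intro add_mono hoeffding) auto
  finally show ?thesis by simp
qed

section \<open>The protocol\<close>

definition lab :: "(bit list \<Rightarrow> real) \<Rightarrow> bit list \<Rightarrow> bit" where
  "lab f x = (if f x = 1 then 0 else 1)"

text \<open>A missing bit counts as 0. A dishonest prover may send too little; this default agrees
  with \<open>Hd\<close> and \<open>Tl\<close> of \<open>Nul\<close>, so messages of every length
  are treated alike.\<close>

definition bhd :: "bit list \<Rightarrow> bit" where
  "bhd m = (case m of [] \<Rightarrow> 0 | b # _ \<Rightarrow> b)"

primrec pop :: "nat \<Rightarrow> bit list \<Rightarrow> bit list \<Rightarrow> bit list" where
  "pop 0 m v = v"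
| "pop (Suc i) m v = pop i (tl m) (bhd m # v)"

text \<open>Exactly \<open>k\<close> blocks of length \<open>n\<close> are read, with zeros for
  missing bits, and repetitions are dropped. Started with the empty list, every message whatsoever
  stands for at most \<open>k\<close> distinct points of the cube.\<close>

primrec parse :: "nat \<Rightarrow> nat \<Rightarrow> bit list \<Rightarrow> bit list list \<Rightarrow> bit list list" where
  "parse 0 n m L = L"
| "parse (Suc k) n m L = parse k n (drop n m) (List.insert (pop n m []) L)"

type_synonym challenge = "bit list \<times> bit list \<times> bit list \<times> bit"

definition challenge_pmf :: "nat \<Rightarrow> challenge pmf" where
  "challenge_pmf n = do {x \<leftarrow> unif n; y \<leftarrow> unif n; z \<leftarrow> unif n; b \<leftarrow> pmf_of_set {0, 1}; return_pmf (x, y, z, b)}"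

definition shown :: "challenge \<Rightarrow> bit list \<times> bit list" where
  "shown = (\<lambda>(x, y, z, b). if b = 1 then (z, vadd x (vadd y z)) else (vadd x (vadd y z), z))"

text \<open>The two points are interleaved letter by letter, so that the verifier can emit them in
  one pass over x, y and z without storing their sum.\<close>

definition push_pair :: "bit list \<times> bit list \<Rightarrow> bit list \<Rightarrow> bit list" where
  "push_pair p m = fold (\<lambda>(a, c) m. a # c # m) (zip (fst p) (snd p)) m"

definition message :: "(bit list \<times> bit list) list \<Rightarrow> bit list" where
  "message ps = foldr push_pair ps []"

definition reply_z :: "bit \<Rightarrow> bit list \<Rightarrow> bit" where
  "reply_z b m = (if b = 1 then bhd m else bhd (tl m))"

definition reply_w :: "bit \<Rightarrow> bit list \<Rightarrow> bit" where
  "reply_w b m = (if b = 1 then bhd (tl m) else bhd m)"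

primrec consistent :: "(bit list \<Rightarrow> real) \<Rightarrow> challenge list \<Rightarrow> bit list \<Rightarrow> bool" where
  "consistent f [] m = True"
| "consistent f (r # rs) m = ((case r of (x, y, z, b) \<Rightarrow> reply_z b m = lab f z) \<and> consistent f rs (drop 2 m))"

text \<open>The sign of an entry is \<open>f x * f y * f z\<close> times the value claimed for the
  fourth point. If the claim is true, it is an unbiased sample of the total of the fourth
  powers.\<close>

primrec outcomes :: "(bit list \<Rightarrow> real) \<Rightarrow> challenge list \<Rightarrow> bit list \<Rightarrow> bit list" where
  "outcomes f [] m = []"
| "outcomes f (r # rs) m = (case r of (x, y, z, b) \<Rightarrow> reply_w b m + lab f x + lab f y + lab f z) # outcomes f rs (drop 2 m)"

definition zeros :: "bit list \<Rightarrow> nat" where "zeros bs = length (filter (\<lambda>b. b = 0) bs)"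
definition ones :: "bit list \<Rightarrow> nat" where "ones bs = length (filter (\<lambda>b. b = 1) bs)"

text \<open>The sign of this bit is a product of four independent copies of
  \<open>f x * chi \<gamma> x\<close>, hence an unbiased estimate of the fourth power of one
  coefficient.\<close>

definition parity_pmf :: "nat \<Rightarrow> (bit list \<Rightarrow> real) \<Rightarrow> bit list \<Rightarrow> bit pmf" where
  "parity_pmf n f \<gamma> = map_pmf (\<lambda>xs. \<Sum>x\<leftarrow>xs. lab f x + inner_prod \<gamma> x) (replicate_pmf 4 (unif n))"

text \<open>The score counts the even parities among \<open>R\<close> trials, so
  \<open>2 * c - R\<close> estimates \<open>R\<close> times the fourth power. Each candidate gets
  fresh examples.\<close>

definition score_all :: "nat \<Rightarrow> (bit list \<Rightarrow> real) \<Rightarrow> nat \<Rightarrow> bit list list \<Rightarrow> (nat \<times> bit list) list pmf" where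
  "score_all n f R L = foldM (\<lambda>\<gamma> cs. map_pmf (\<lambda>bs. (zeros bs, \<gamma>) # cs) (replicate_pmf R (parity_pmf n f \<gamma>))) L []"

definition max_step :: "nat \<times> 'a \<Rightarrow> (nat \<times> 'a) \<times> (nat \<times> 'a) list \<Rightarrow> (nat \<times> 'a) \<times> (nat \<times> 'a) list" where
  "max_step i = (\<lambda>(b, rest). if fst i \<le> fst b then (b, i # rest) else (i, b # rest))"

fun select :: "nat \<Rightarrow> (nat \<times> 'a) list \<Rightarrow> 'a list \<Rightarrow> 'a list option" where
  "select 0 cs out = Some out"
| "select (Suc t) [] out = None"
| "select (Suc t) (c # cs) out = (case fold max_step cs (c, []) of (b, rest) \<Rightarrow> select t rest (snd b # out))"

text \<open>The inequality says that the sum of the outcome signs exceeds the sum of the terms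
  \<open>2 * c - R\<close> by at most the slack \<open>Q\<close>. Each count stands on the side
  where it is added, because the machine counts in unary and cannot go below zero.\<close>

definition verdict :: "nat \<Rightarrow> (bit list \<Rightarrow> real) \<Rightarrow> nat \<Rightarrow> nat \<Rightarrow> challenge list \<Rightarrow> bit list \<Rightarrow>
    (nat \<times> bit list) list \<Rightarrow> bit list list option" where
  "verdict t f R Q rs m cs =
    (if consistent f rs m \<and> zeros (outcomes f rs m) + (\<Sum>(c, \<gamma>)\<leftarrow>cs. R - c) \<le> Q + ones (outcomes f rs m) + (\<Sum>(c, \<gamma>)\<leftarrow>cs. c)
     then select t cs [] else None)"

section \<open>Straight-line code and arithmetic\<close>

fun straight :: "prog \<Rightarrow> bool" where
  "straight [] = True"
| "straight (Assign x e # p) = straight p"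
| "straight (Cond e as bs # p) = (straight as \<and> straight bs \<and> straight p)"
| "straight (_ # p) = False"

fun cost :: "prog \<Rightarrow> nat" where
  "cost [] = 0"
| "cost (Assign x e # p) = Suc (cost p)"
| "cost (Cond e as bs # p) = Suc (max (cost as) (cost bs) + cost p)"
| "cost (_ # p) = 0"

text \<open>Running straight code as a function lets the simplifier compute the final store.
  Branches are unfolded in front of the remaining code, hence the termination measure by total size;
  the equations for the other instructions only supply dummy values.\<close>

function after :: "prog \<Rightarrow> store \<Rightarrow> store" where
  "after [] s = s"
| "after (Assign x e # p) s = after p (s(x := eval_expr s e))"
| "after (Cond e as bs # p) s = (if eval_expr s e \<noteq> Nul then after (as @ p) s else after (bs @ p) s)"
| "after (Flip x # p) s = s"
| "after (Ask x e # p) s = s"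
| "after (While e as # p) s = s"
  by pat_completeness auto
termination by (relation "Wellfounded.measure (\<lambda>(p, s). size_list size p)") (auto simp: size_list_append)

lemma straight_append [simp]: "straight (p @ p') \<longleftrightarrow> straight p \<and> straight p'"
  by (induction p rule: straight.induct) auto

lemma cost_append: "straight p \<Longrightarrow> cost (p @ p') = cost p + cost p'"
  by (induction p rule: cost.induct) auto

lemma det_straight_eq: "straight p \<Longrightarrow> det acc p s (\<lambda>s'. s' = after p s) (cost p)"
proof (induction p s rule: after.induct)
  case (3 e as bs p s)
  show ?case
  proof (cases "eval_expr s e \<noteq> Nul")
    case True
    then have "det acc (as @ p) s (\<lambda>s'. s' = after (as @ p) s) (cost (as @ p))"
      using 3 by simp
    then have "det acc (Cond e as bs # p) s (\<lambda>s'. s' = after (as @ p) s) (Suc (cost (as @ p)))"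
      using True by (intro det_Cond) simp
    then show ?thesis by (rule det_weaken) (use True 3(3) in \<open>auto simp: cost_append\<close>)
  next
    case False
    then have "det acc (bs @ p) s (\<lambda>s'. s' = after (bs @ p) s) (cost (bs @ p))"
      using 3 by simp
    then have "det acc (Cond e as bs # p) s (\<lambda>s'. s' = after (bs @ p) s) (Suc (cost (bs @ p)))"
      using False by (intro det_Cond) simp
    then show ?thesis by (rule det_weaken) (use False 3(3) in \<open>auto simp: cost_append\<close>)
  qed
qed (auto intro: det_Nil det_Assign)

lemma det_straight: "straight p \<Longrightarrow> cost p \<le> K \<Longrightarrow> R (after p s) \<Longrightarrow> det acc p s R K"
  by (rule det_weaken[OF det_straight_eq]) auto

section \<open>Unary arithmetic and the parameters\<close>

abbreviation same :: "nat set \<Rightarrow> store \<Rightarrow> store \<Rightarrow> bool" where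
  "same W s s' \<equiv> \<forall>r. r \<notin> W \<longrightarrow> s' r = s r"

abbreviation one :: expr where "one \<equiv> Mk Null Null"

lemma unary_simps [simp]: "unary 0 = Nul" "unary (Suc k) = Cell Nul (unary k)"
  by (simp_all add: unary_def)

lemma unary_Nul_iff [simp]: "unary k = Nul \<longleftrightarrow> k = 0"
  by (cases k) auto

lemma enc_bits_simps [simp]: "enc_bits [] = Nul" "enc_bits (b # bs) = Cell (enc_bit b) (enc_bits bs)"
  by (simp_all add: enc_bits_def)

lemma enc_bits_Nul_iff [simp]: "enc_bits m = Nul \<longleftrightarrow> m = []"
  by (cases m) auto

lemma enc_bit_simps [simp]: "enc_bit 0 = Nul" "enc_bit 1 = Cell Nul Nul"
  by (simp_all add: enc_bit_def)

lemma enc_bit_Nul_iff [simp]: "enc_bit b = Nul \<longleftrightarrow> b = 0"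
  by (cases b) auto

lemma hd_enc_bits [simp]: "sexp_hd (enc_bits m) = enc_bit (bhd m)"
  by (cases m) (auto simp: bhd_def)

lemma tl_enc_bits [simp]: "sexp_tl (enc_bits m) = enc_bits (tl m)"
  by (cases m) auto

lemma hd_unary [simp]: "sexp_hd (unary m) = Nul"
  by (cases m) auto

lemma tl_unary [simp]: "sexp_tl (unary m) = unary (m - 1)"
  by (cases m) auto

definition enc_vecs :: "bit list list \<Rightarrow> sexp" where "enc_vecs L = enc_list (map enc_bits L)"

lemma enc_vecs_simps [simp]: "enc_vecs [] = Nul" "enc_vecs (v # L) = Cell (enc_bits v) (enc_vecs L)"
  by (simp_all add: enc_vecs_def)


lemma det_count:
  assumes "I m s"
    and body: "\<And>j s. I (Suc j) s \<Longrightarrow> eval_expr s g \<noteq> Nul \<and> det acc body s (I j) K"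
    and exit: "\<And>s. I 0 s \<Longrightarrow> eval_expr s g = Nul"
  shows "det acc [While g body] s (I 0) (m * Suc K + 1)"
  using det_While[where I = "\<lambda>es. I (length es)" and es = "replicate m ()" and body = body and K = K] assms
  by simp

definition addto :: "nat \<Rightarrow> nat \<Rightarrow> nat \<Rightarrow> prog" where
  "addto z y v = [Assign v (Var y)] @ [While (Var v) [Assign z (Mk Null (Var z)), Assign v (Tl (Var v))]]"

lemma addto:
  assumes "distinct [z, y, v]" "s y = unary a" "s z = unary b"
  shows "det acc (addto z y v) s (\<lambda>s'. s' z = unary (a + b) \<and> same {z, v} s s') (3 * a + 2)"
proof -
  define I where "I j s' \<longleftrightarrow> j \<le> a \<and> s' z = unary (a + b - j) \<and> s' v = unary j \<and> same {z, v} s s'" for j s'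
  have "det acc (addto z y v) s (I 0) (1 + (a * Suc 2 + 1))"
    unfolding addto_def
  proof (rule det_det[where R = "I a"], goal_cases)
    case (2 s')
    then show ?case
    proof (rule det_count, goal_cases)
      case (1 j s')
      then have "a + b - j = Suc (a + b - Suc j)" unfolding I_def by linarith
      with 1 show ?case using assms by (auto simp: I_def intro!: det_straight)
    qed (simp add: I_def)
  qed (use assms in \<open>auto simp: I_def intro!: det_straight\<close>)
  then show ?thesis by (rule det_weaken) (auto simp: I_def)
qed

text \<open>Registers 98 and 99 are scratch space for arithmetic, so that both factors keep their
  values.\<close>

definition mult :: "nat \<Rightarrow> nat \<Rightarrow> nat \<Rightarrow> prog" where
  "mult z x y = [Assign z Null, Assign 98 (Var x)] @ [While (Var 98) (addto z y 99 @ [Assign 98 (Tl (Var 98))])]"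

definition mcost :: "nat \<Rightarrow> nat \<Rightarrow> nat" where "mcost a b = 3 + a * (3 * b + 4)"

lemma mult:
  assumes "z \<noteq> x" "z \<noteq> y" "{x, y, z} \<inter> {98, 99} = {}" "s x = unary a" "s y = unary b"
  shows "det acc (mult z x y) s (\<lambda>s'. s' z = unary (a * b) \<and> same {z, 98, 99} s s') (mcost a b)"
proof -
  define I where "I j s' \<longleftrightarrow> j \<le> a \<and> s' z = unary ((a - j) * b) \<and> s' 98 = unary j \<and> same {z, 98, 99} s s'" for j s'
  have "det acc (mult z x y) s (I 0) (2 + (a * Suc (3 * b + 2 + 1) + 1))"
    unfolding mult_def
  proof (rule det_det[where R = "I a"], goal_cases)
    case (2 s')
    then show ?case
    proof (rule det_count, goal_cases)
      case (1 j s')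
      then have eq: "a - j = Suc (a - Suc j)" unfolding I_def by linarith
      have "det acc (addto z y 99 @ [Assign 98 (Tl (Var 98))]) s' (I j) (3 * b + 2 + 1)"
      proof (rule det_det, rule addto[where a = b and b = "(a - Suc j) * b"])
        fix s'' assume "s'' z = unary (b + (a - Suc j) * b) \<and> same {z, 99} s' s''"
        then show "det acc [Assign 98 (Tl (Var 98))] s'' (I j) 1"
          using 1 assms by (intro det_straight) (auto simp: I_def eq)
      qed (use 1 assms in \<open>auto simp: I_def\<close>)
      moreover have "eval_expr s' (Var 98) \<noteq> Nul" using 1 by (simp add: I_def)
      ultimately show ?case by blast
    qed (simp add: I_def)
  qed (use assms in \<open>auto simp: I_def intro!: det_straight\<close>)
  then show ?thesis by (rule det_weaken) (auto simp: I_def mcost_def algebra_simps)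
qed

fun mults :: "(nat \<times> nat \<times> nat) list \<Rightarrow> prog" where
  "mults [] = []"
| "mults ((z, x, y) # ops) = mult z x y @ mults ops"

fun mults_value :: "(nat \<times> nat \<times> nat) list \<Rightarrow> (nat \<Rightarrow> nat) \<Rightarrow> nat \<Rightarrow> nat" where
  "mults_value [] v = v"
| "mults_value ((z, x, y) # ops) v = mults_value ops (v(z := v x * v y))"

fun mults_cost :: "(nat \<times> nat \<times> nat) list \<Rightarrow> (nat \<Rightarrow> nat) \<Rightarrow> nat" where
  "mults_cost [] v = 0"
| "mults_cost ((z, x, y) # ops) v = mcost (v x) (v y) + mults_cost ops (v(z := v x * v y))"

fun mults_ok :: "(nat \<times> nat \<times> nat) list \<Rightarrow> nat set \<Rightarrow> bool" where
  "mults_ok [] A = True"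
| "mults_ok ((z, x, y) # ops) A = (x \<in> A \<and> y \<in> A \<and> z \<notin> {x, y} \<and> {x, y, z} \<inter> {98, 99} = {} \<and> mults_ok ops (insert z A))"

lemma mults:
  assumes "\<forall>r\<in>A. s r = unary (v r)" "mults_ok ops A" "A \<inter> {98, 99} = {}"
  shows "det acc (mults ops) s
    (\<lambda>s'. (\<forall>r\<in>A \<union> fst ` set ops. s' r = unary (mults_value ops v r)) \<and> same (fst ` set ops \<union> {98, 99}) s s')
    (mults_cost ops v)"
  using assms
proof (induction ops v arbitrary: s A rule: mults_value.induct)
  case (2 z x y ops v)
  show ?case
  proof (simp only: mults.simps mults_cost.simps, rule det_det, rule mult[where a = "v x" and b = "v y"])
    fix s' assume s': "s' z = unary (v x * v y) \<and> same {z, 98, 99} s s'"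
    have "det acc (mults ops) s'
      (\<lambda>s''. (\<forall>r\<in>insert z A \<union> fst ` set ops. s'' r = unary (mults_value ops (v(z := v x * v y)) r)) \<and>
        same (fst ` set ops \<union> {98, 99}) s' s'') (mults_cost ops (v(z := v x * v y)))"
      by (rule "2.IH") (use s' 2 in auto)
    then show "det acc (mults ops) s'
      (\<lambda>s''. (\<forall>r\<in>A \<union> fst ` set ((z, x, y) # ops). s'' r = unary (mults_value ((z, x, y) # ops) v r)) \<and>
        same (fst ` set ((z, x, y) # ops) \<union> {98, 99}) s s'') (mults_cost ops (v(z := v x * v y)))"
      by (rule det_weaken) (use s' in auto)
  qed (use 2 in auto)
qed (auto intro: det_Nil)

text \<open>With G in register 5 and n + G in register 14, registers 6 to 11 receive the repeated
  squares G^2 to G^64, 12 and 13 receive G^48 and G^56, 15 receives G^16 * (n + G), 16 and 17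
  receive G^24 and G^28, and 18 receives G^28 * (n + G). Later stages read 9 (bound for the list),
  11 (number of trials), 13 (slack), and 15 and 18 (threshold and number of trials in the
  search).\<close>

definition param_ops :: "(nat \<times> nat \<times> nat) list" where
  "param_ops = [(6, 5, 5), (7, 6, 6), (8, 7, 7), (9, 8, 8), (10, 9, 9), (11, 10, 10),
    (12, 10, 9), (13, 12, 8), (15, 9, 14), (16, 9, 8), (17, 16, 7), (18, 17, 14)]"

definition params :: prog where
  "params = [Assign 5 (Mk Null (Mk Null (Mk Null (Mk Null (Mk Null (Mk Null (Mk Null (Mk Null (Mk Null (Mk Null Null))))))))))]
    @ addto 5 2 99 @ addto 5 3 99 @ addto 5 4 99
    @ [Assign 14 (Var 5)] @ addto 14 1 99 @ mults param_ops"

text \<open>Each summand has its use: t \<le> G leaves room for \<open>t\<close> padding entries in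
  the list, \<open>N\<close> gives 1 / G \<le> \<epsilon>, \<open>D\<close> gives 2 / 2^G \<le>
  \<delta>, and G \<ge> 10 makes the comparisons between powers of G hold.\<close>

definition big_g :: "nat \<Rightarrow> nat \<Rightarrow> nat \<Rightarrow> nat" where "big_g t N D = t + N + D + 10"

definition params_cost :: "nat \<Rightarrow> nat \<Rightarrow> nat" where
  "params_cost n G = 10 + 3 * G + 3 * n + (mcost G G + mcost (G^2) (G^2) + mcost (G^4) (G^4) + mcost (G^8) (G^8)
     + mcost (G^16) (G^16) + mcost (G^32) (G^32) + mcost (G^32) (G^16) + mcost (G^48) (G^8)
     + mcost (G^16) (n + G) + mcost (G^16) (G^8) + mcost (G^24) (G^4) + mcost (G^28) (n + G))"

lemma params:
  assumes s: "s 1 = unary n" "s 2 = unary t" "s 3 = unary N" "s 4 = unary D" and G: "G = big_g t N D"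
  shows "det acc params s (\<lambda>s'. s' 9 = unary (G ^ 16) \<and> s' 11 = unary (G ^ 64) \<and> s' 13 = unary (G ^ 56) \<and>
    s' 15 = unary (G ^ 16 * (n + G)) \<and> s' 18 = unary (G ^ 28 * (n + G)) \<and> same ({5..18} \<union> {98, 99}) s s') (params_cost n G)"
proof -
  define W :: "nat set" where "W = {5, 14, 99}"
  define v where "v = (\<lambda>r. if r = 5 then G else if r = (14::nat) then n + G else 0)"
  have s1: "det acc [Assign 5 (Mk Null (Mk Null (Mk Null (Mk Null (Mk Null (Mk Null (Mk Null (Mk Null (Mk Null (Mk Null Null))))))))))] s
     (\<lambda>s'. s' 5 = unary 10 \<and> same W s s') 1"
    by (rule det_straight) (auto simp: W_def eval_nat_numeral)
  have s2: "det acc (addto 5 2 99) s' (\<lambda>s''. s'' 5 = unary (t + 10) \<and> same W s s'') (3 * t + 2)"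
    if "s' 5 = unary 10 \<and> same W s s'" for s'
    by (rule det_weaken, rule addto[of _ _ _ _ t 10]) (use that s in \<open>auto simp: W_def\<close>)
  have s3: "det acc (addto 5 3 99) s' (\<lambda>s''. s'' 5 = unary (N + (t + 10)) \<and> same W s s'') (3 * N + 2)"
    if "s' 5 = unary (t + 10) \<and> same W s s'" for s'
    by (rule det_weaken, rule addto[of _ _ _ _ N "t + 10"]) (use that s in \<open>auto simp: W_def\<close>)
  have s4: "det acc (addto 5 4 99) s' (\<lambda>s''. s'' 5 = unary G \<and> same W s s'') (3 * D + 2)"
    if "s' 5 = unary (N + (t + 10)) \<and> same W s s'" for s'
    by (rule det_weaken, rule addto[of _ _ _ _ D "N + (t + 10)"]) (use that s in \<open>auto simp: W_def G big_g_def add_ac\<close>)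
  have s5: "det acc [Assign 14 (Var 5)] s' (\<lambda>s''. s'' 5 = unary G \<and> s'' 14 = unary G \<and> same W s s'') 1"
    if "s' 5 = unary G \<and> same W s s'" for s'
    by (rule det_straight) (use that in \<open>auto simp: W_def\<close>)
  have s6: "det acc (addto 14 1 99) s' (\<lambda>s''. s'' 5 = unary G \<and> s'' 14 = unary (n + G) \<and> same W s s'') (3 * n + 2)"
    if "s' 5 = unary G \<and> s' 14 = unary G \<and> same W s s'" for s'
    by (rule det_weaken, rule addto[of _ _ _ _ n G]) (use that s in \<open>auto simp: W_def\<close>)
  have c: "mults_cost param_ops v = mcost G G + mcost (G^2) (G^2) + mcost (G^4) (G^4) + mcost (G^8) (G^8)
     + mcost (G^16) (G^16) + mcost (G^32) (G^32) + mcost (G^32) (G^16) + mcost (G^48) (G^8)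
     + mcost (G^16) (n + G) + mcost (G^16) (G^8) + mcost (G^24) (G^4) + mcost (G^28) (n + G)"
    by (simp add: param_ops_def v_def power2_eq_square[symmetric] power_add[symmetric])
  have v: "mults_value param_ops v 9 = G ^ 16" "mults_value param_ops v 11 = G ^ 64" "mults_value param_ops v 13 = G ^ 56"
    "mults_value param_ops v 15 = G ^ 16 * (n + G)" "mults_value param_ops v 18 = G ^ 28 * (n + G)"
    by (simp_all add: param_ops_def v_def power2_eq_square[symmetric] power_add[symmetric])
  have s7: "det acc (mults param_ops) s' (\<lambda>s''. s'' 9 = unary (G ^ 16) \<and> s'' 11 = unary (G ^ 64) \<and> s'' 13 = unary (G ^ 56) \<and>
    s'' 15 = unary (G ^ 16 * (n + G)) \<and> s'' 18 = unary (G ^ 28 * (n + G)) \<and> same ({5..18} \<union> {98, 99}) s s'') (mults_cost param_ops v)"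
    if "s' 5 = unary G \<and> s' 14 = unary (n + G) \<and> same W s s'" for s'
  proof (rule det_weaken[OF _ _ order_refl], rule mults[where A = "{5, 14}" and v = v])
    fix s'' assume "(\<forall>r\<in>{5, 14} \<union> fst ` set param_ops. s'' r = unary (mults_value param_ops v r)) \<and>
      same (fst ` set param_ops \<union> {98, 99}) s' s''"
    then have 1: "\<forall>r\<in>{5, 14} \<union> fst ` set param_ops. s'' r = unary (mults_value param_ops v r)"
      and 2: "same (fst ` set param_ops \<union> {98, 99}) s' s''" by auto
    have "s'' 9 = unary (mults_value param_ops v 9)" "s'' 11 = unary (mults_value param_ops v 11)"
      "s'' 13 = unary (mults_value param_ops v 13)" "s'' 15 = unary (mults_value param_ops v 15)"
      "s'' 18 = unary (mults_value param_ops v 18)"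
      by (intro bspec[OF 1]; simp add: param_ops_def)+
    then have "s'' 9 = unary (G ^ 16)" "s'' 11 = unary (G ^ 64)" "s'' 13 = unary (G ^ 56)"
      "s'' 15 = unary (G ^ 16 * (n + G))" "s'' 18 = unary (G ^ 28 * (n + G))"
      unfolding v by auto
    moreover have "same ({5..18} \<union> {98, 99}) s s''"
      using 2 that by (auto simp: param_ops_def W_def)
    ultimately show "s'' 9 = unary (G ^ 16) \<and> s'' 11 = unary (G ^ 64) \<and> s'' 13 = unary (G ^ 56) \<and>
      s'' 15 = unary (G ^ 16 * (n + G)) \<and> s'' 18 = unary (G ^ 28 * (n + G)) \<and> same ({5..18} \<union> {98, 99}) s s''" by blast
  qed (use that in \<open>auto simp: param_ops_def v_def\<close>)
  have arith: "1 + (3 * t + 2 + (3 * N + 2 + (3 * D + 2 + (1 + (3 * n + 2 + X))))) \<le> 10 + 3 * G + 3 * n + X" for X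
    using G unfolding big_g_def by linarith
  show ?thesis
    unfolding params_def
    apply (rule det_weaken)
      apply (rule det_det[OF s1], rule det_det[OF s2], assumption, rule det_det[OF s3], assumption,
        rule det_det[OF s4], assumption, rule det_det[OF s5], assumption, rule det_det[OF s6], assumption, rule s7, assumption)
     apply assumption
    apply (unfold params_cost_def c[symmetric])
    apply (rule arith)
    done
qed

section \<open>The verifier's program\<close>

lemma det_seq:
  assumes "det acc p s R K1" "\<And>s'. R s' \<Longrightarrow> det acc p' s' R' K2" "K1 + K2 \<le> K"
  shows "det acc (p @ p') s R' K"
  by (rule det_weaken[OF det_det[OF assms(1,2)]]) (use assms in auto)

lemma triple_det_seq:
  assumes "det acc p s R K1" "\<And>s'. R s' \<Longrightarrow> triple acc p' s' A R' K2 Q" "K1 + K2 \<le> K"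
  shows "triple acc (p @ p') s A R' K Q"
  by (rule triple_weaken[OF triple_det[OF assms(1,2)]]) (use assms in auto)

lemma det_loop:
  assumes "I m s" "\<And>j s. I (Suc j) s \<Longrightarrow> eval_expr s g \<noteq> Nul"
    and "\<And>j s. I (Suc j) s \<Longrightarrow> det acc body s (I j) K"
    and "\<And>s. I 0 s \<Longrightarrow> eval_expr s g = Nul"
    and "\<And>s. I 0 s \<Longrightarrow> R s" "m * Suc K + 1 \<le> K'"
  shows "det acc [While g body] s R K'"
  by (rule det_weaken[OF det_count[where I = I and m = m and K = K]]) (use assms in auto)

text \<open>The ghost value \<open>g\<close> is the abstract state of the loop, advanced by
  \<open>h\<close>; hiding it existentially in the invariant reduces the claim to a counting
  loop.\<close>

lemma det_gloop:
  assumes "I m g s" "\<And>j g s. I (Suc j) g s \<Longrightarrow> eval_expr s e \<noteq> Nul"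
    and "\<And>j g s. I (Suc j) g s \<Longrightarrow> det acc body s (I j (h j g)) K"
    and "\<And>g s. I 0 g s \<Longrightarrow> eval_expr s e = Nul"
    and "\<And>g s. I 0 g s \<Longrightarrow> R s" "m * Suc K + 1 \<le> K'"
  shows "det acc [While e body] s R K'"
  by (rule det_loop[where I = "\<lambda>j s. \<exists>g. I j g s" and m = m and K = K])
     (use assms in \<open>auto intro: det_weaken[OF assms(3)]\<close>)

lemma enc_list_Nul_iff [simp]: "enc_list l = Nul \<longleftrightarrow> l = []" "Nul = enc_list l \<longleftrightarrow> l = []"
  by (cases l; simp)+

lemma enc_vecs_Nul_iff [simp]: "enc_vecs L = Nul \<longleftrightarrow> L = []" "Nul = enc_vecs L \<longleftrightarrow> L = []"
  by (cases L; simp)+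

lemma Nul_eq_enc_bits_iff [simp]: "Nul = enc_bits m \<longleftrightarrow> m = []"
  by (cases m) auto

lemma Nul_eq_unary_iff [simp]: "Nul = unary k \<longleftrightarrow> k = 0"
  by (cases k) auto

definition xorc :: "expr \<Rightarrow> nat \<Rightarrow> prog" where
  "xorc e x = [Cond e [Cond (Var x) [Assign x Null] [Assign x one]] []]"

lemma straight_xorc [simp]: "straight (xorc e x)" and cost_xorc [simp]: "cost (xorc e x) = 3"
  by (simp_all add: xorc_def)

lemma after_xorc:
  assumes "eval_expr s e = enc_bit a" "s x = enc_bit b"
  shows "after (xorc e x @ p) s = after p (s(x := enc_bit (b + a)))"
proof -
  have "s(x := enc_bit b) = s" using assms(2) by auto
  then show ?thesis using assms by (cases a; cases b) (auto simp: xorc_def)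
qed

section \<open>Reading the list of candidates\<close>

definition pop_prog :: prog where
  "pop_prog = [Assign 22 Null, Assign 23 (Var 1)] @
     [While (Var 23) [Assign 22 (Mk (Hd (Var 0)) (Var 22)), Assign 0 (Tl (Var 0)), Assign 23 (Tl (Var 23))]]"

lemma pop_prog:
  assumes "s 0 = enc_bits m" "s 1 = unary n"
  shows "det acc pop_prog s (\<lambda>s'. s' 0 = enc_bits (drop n m) \<and> s' 22 = enc_bits (pop n m []) \<and>
    same {0, 22, 23} s s') (4 * n + 3)"
proof -
  define I where "I j g s' \<longleftrightarrow> s' 0 = enc_bits (fst g) \<and> s' 22 = enc_bits (snd g) \<and> s' 23 = unary j \<and>
     pop j (fst g) (snd g) = pop n m [] \<and> drop j (fst g) = drop n m \<and> same {0, 22, 23} s s'" for j g s'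
  have 1: "det acc [Assign 22 Null, Assign 23 (Var 1)] s (I n (m, [])) 2"
    by (rule det_straight) (use assms in \<open>auto simp: I_def\<close>)
  have 2: "det acc [While (Var 23) [Assign 22 (Mk (Hd (Var 0)) (Var 22)), Assign 0 (Tl (Var 0)), Assign 23 (Tl (Var 23))]] s1
     (\<lambda>s'. s' 0 = enc_bits (drop n m) \<and> s' 22 = enc_bits (pop n m []) \<and> same {0, 22, 23} s s') (4 * n + 1)"
    if "I n (m, []) s1" for s1
  proof (rule det_gloop[where I = I and m = n, OF that])
    fix j g s' assume *: "I (Suc j) g s'"
    show "det acc [Assign 22 (Mk (Hd (Var 0)) (Var 22)), Assign 0 (Tl (Var 0)), Assign 23 (Tl (Var 23))] s'
      (I j (tl (fst g), bhd (fst g) # snd g)) 3"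
      by (rule det_straight) (use * in \<open>auto simp: I_def drop_Suc\<close>)
  qed (auto simp: I_def)
  show ?thesis unfolding pop_prog_def by (rule det_seq[OF 1 2]) auto
qed

definition eq_prog :: prog where
  "eq_prog = [Assign 26 (Hd (Var 25)), Assign 27 (Var 22), Assign 28 one] @
     [While (Var 26) [Cond (Hd (Var 26)) [Cond (Hd (Var 27)) [] [Assign 28 Null]] [Cond (Hd (Var 27)) [Assign 28 Null] []],
        Assign 26 (Tl (Var 26)), Assign 27 (Tl (Var 27))]]"

lemma eq_prog:
  assumes "sexp_hd (s 25) = enc_bits u" "s 22 = enc_bits v" "length u = length v"
  shows "det acc eq_prog s (\<lambda>s'. (s' 28 \<noteq> Nul \<longleftrightarrow> u = v) \<and> same {26, 27, 28} s s') (6 * length v + 4)"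
proof -
  define I where "I j g s' \<longleftrightarrow> length (fst g) = j \<and> length (snd g) = j \<and> s' 26 = enc_bits (fst g) \<and> s' 27 = enc_bits (snd g) \<and>
     (s' 28 \<noteq> Nul \<and> fst g = snd g \<longleftrightarrow> u = v) \<and> same {26, 27, 28} s s'" for j g s'
  let ?body = "[Cond (Hd (Var 26)) [Cond (Hd (Var 27)) [] [Assign 28 Null]] [Cond (Hd (Var 27)) [Assign 28 Null] []],
        Assign 26 (Tl (Var 26)), Assign 27 (Tl (Var 27))]"
  have 1: "det acc [Assign 26 (Hd (Var 25)), Assign 27 (Var 22), Assign 28 one] s (I (length v) (u, v)) 3"
    by (rule det_straight) (use assms in \<open>auto simp: I_def\<close>)
  have 2: "det acc [While (Var 26) ?body] s1 (\<lambda>s'. (s' 28 \<noteq> Nul \<longleftrightarrow> u = v) \<and> same {26, 27, 28} s s') (6 * length v + 1)"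
    if "I (length v) (u, v) s1" for s1
  proof (rule det_gloop[where I = I and m = "length v", OF that])
    fix j g s' assume *: "I (Suc j) g s'"
    obtain a b u' v' where g: "g = (a # u', b # v')"
      using * unfolding I_def by (cases g; cases "fst g"; cases "snd g") auto
    have "I j (u', v') (after ?body s')"
      using * unfolding g by (cases a; cases b) (auto simp: I_def)
    then show "det acc ?body s' (I j (tl (fst g), tl (snd g))) 5"
      by (intro det_straight) (auto simp: g)
  qed (auto simp: I_def)
  show ?thesis unfolding eq_prog_def by (rule det_seq[OF 1 2]) auto
qed

definition insert_prog :: prog where
  "insert_prog = [Assign 24 one, Assign 25 (Var 20)] @
     [While (Var 25) (eq_prog @ [Cond (Var 28) [Assign 24 Null] [], Assign 25 (Tl (Var 25))])] @
     [Cond (Var 24) [Assign 20 (Mk (Var 22) (Var 20))] []]"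

lemma insert_prog:
  assumes "s 20 = enc_vecs L" "s 22 = enc_bits v" "\<forall>u\<in>set L. length u = length v"
  shows "det acc insert_prog s (\<lambda>s'. s' 20 = enc_vecs (List.insert v L) \<and> same {20, 24, 25, 26, 27, 28} s s')
     (length L * (6 * length v + 8) + 5)"
proof -
  let ?W = "{24, 25, 26, 27, 28}"
  \<comment> \<open>Register 24 stays set until an equal vector is met; together with the part of
    the list not yet visited it decides membership.\<close>
  define I where "I j L' s' \<longleftrightarrow> length L' = j \<and> set L' \<subseteq> set L \<and> s' 25 = enc_vecs L' \<and>
     (s' 24 \<noteq> Nul \<and> v \<notin> set L' \<longleftrightarrow> v \<notin> set L) \<and> same ?W s s'" for j L' s'
  have 1: "det acc [Assign 24 one, Assign 25 (Var 20)] s (I (length L) L) 2"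
    by (rule det_straight) (use assms in \<open>auto simp: I_def\<close>)
  have 2: "det acc [While (Var 25) (eq_prog @ [Cond (Var 28) [Assign 24 Null] [], Assign 25 (Tl (Var 25))])] s1 (I 0 [])
     (length L * (6 * length v + 8) + 1)" if "I (length L) L s1" for s1
  proof (rule det_gloop[where I = I and m = "length L", OF that])
    fix j g s' assume *: "I (Suc j) g s'"
    obtain u L' where g: "g = u # L'" using * unfolding I_def by (cases g) auto
    show "det acc (eq_prog @ [Cond (Var 28) [Assign 24 Null] [], Assign 25 (Tl (Var 25))]) s' (I j (tl g)) (6 * length v + 7)"
    proof (rule det_seq, rule eq_prog[where u = u and v = v])
      fix s'' assume s'': "(s'' 28 \<noteq> Nul \<longleftrightarrow> u = v) \<and> same {26, 27, 28} s' s''"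
      have "I j L' (after [Cond (Var 28) [Assign 24 Null] [], Assign 25 (Tl (Var 25))] s'')"
        using * s'' unfolding g by (cases "u = v") (auto simp: I_def)
      then show "det acc [Cond (Var 28) [Assign 24 Null] [], Assign 25 (Tl (Var 25))] s'' (I j (tl g)) 3"
        by (intro det_straight) (auto simp: g)
    qed (use * assms in \<open>auto simp: g I_def\<close>)
  qed (auto simp: I_def)
  have "List.insert v L = (if v \<in> set L then L else v # L)" by (simp add: List.insert_def)
  then have 3: "det acc [Cond (Var 24) [Assign 20 (Mk (Var 22) (Var 20))] []] s'
     (\<lambda>s'. s' 20 = enc_vecs (List.insert v L) \<and> same {20, 24, 25, 26, 27, 28} s s') 2" if "I 0 [] s'" for s'
    by (intro det_straight) (use that assms in \<open>auto simp: I_def\<close>)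
  show ?thesis
    unfolding insert_prog_def by (rule det_seq[OF 1 det_det[OF 2 3]]) auto
qed

lemma length_pop [simp]: "length (pop i m v) = i + length v"
  by (induction i arbitrary: m v) auto

lemma parse_length:
  "\<forall>v\<in>set L. length v = n \<Longrightarrow> \<forall>v\<in>set (parse k n m L). length v = n"
  proof (induction k arbitrary: m L)
  case (Suc k)
  show ?case unfolding parse.simps by (rule Suc.IH) (use Suc.prems in \<open>auto simp: List.insert_def\<close>)
qed simp

lemma length_insert_le: "length (List.insert v L) \<le> Suc (length L)"
  by (simp add: List.insert_def)

lemma length_parse: "length (parse k n m L) \<le> k + length L"
proof (induction k arbitrary: m L)
  case (Suc k)
  show ?case using Suc[of "drop n m" "List.insert (pop n m []) L"] length_insert_le[of "pop n m []" L] by simp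
qed simp

definition parse_prog :: prog where
  "parse_prog = [Assign 20 Null, Assign 21 (Var 9)] @
     [While (Var 21) (pop_prog @ insert_prog @ [Assign 21 (Tl (Var 21))])]"

definition parse_cost :: "nat \<Rightarrow> nat \<Rightarrow> nat" where
  "parse_cost n k = 3 + k * (4 * n + k * (6 * n + 8) + 10)"

lemma parse_prog:
  assumes "s 0 = enc_bits m" "s 1 = unary n" "s 9 = unary k"
  shows "det acc parse_prog s (\<lambda>s'. s' 20 = enc_vecs (parse k n m []) \<and> same {0, 20, 21, 22, 23, 24, 25, 26, 27, 28} s s')
     (parse_cost n k)"
proof -
  let ?W = "{0, 20, 21, 22, 23, 24, 25, 26, 27, 28}"
  define I where "I j g s' \<longleftrightarrow> s' 0 = enc_bits (fst g) \<and> s' 20 = enc_vecs (snd g) \<and> s' 21 = unary j \<and>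
     length (snd g) + j \<le> k \<and> (\<forall>v\<in>set (snd g). length v = n) \<and> parse j n (fst g) (snd g) = parse k n m [] \<and> same ?W s s'"
    for j g s'
  have 1: "det acc [Assign 20 Null, Assign 21 (Var 9)] s (I k (m, [])) 2"
    by (rule det_straight) (use assms in \<open>auto simp: I_def\<close>)
  have 2: "det acc [While (Var 21) (pop_prog @ insert_prog @ [Assign 21 (Tl (Var 21))])] s1
     (\<lambda>s'. s' 20 = enc_vecs (parse k n m []) \<and> same ?W s s') (k * (4 * n + k * (6 * n + 8) + 10) + 1)" if "I k (m, []) s1" for s1
  proof (rule det_gloop[where I = I and m = k, OF that])
    fix j g s' assume *: "I (Suc j) g s'"
    obtain m' L' where g: "g = (m', L')" by (cases g)
    define v where "v = pop n m' []"
    have b: "length L' * (6 * n + 8) \<le> k * (6 * n + 8)" using * by (intro mult_right_mono) (auto simp: I_def g)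
    show "det acc (pop_prog @ insert_prog @ [Assign 21 (Tl (Var 21))]) s'
      (I j (drop n (fst g), List.insert (pop n (fst g) []) (snd g))) (4 * n + k * (6 * n + 8) + 9)"
    proof (rule det_seq, rule pop_prog[where m = m' and n = n])
      fix s2 assume s2: "s2 0 = enc_bits (drop n m') \<and> s2 22 = enc_bits (pop n m' []) \<and> same {0, 22, 23} s' s2"
      show "det acc (insert_prog @ [Assign 21 (Tl (Var 21))]) s2
        (I j (drop n (fst g), List.insert (pop n (fst g) []) (snd g))) (k * (6 * n + 8) + 6)"
      proof (rule det_seq, rule insert_prog[where v = v and L = L'])
        fix s3 assume s3: "s3 20 = enc_vecs (List.insert v L') \<and> same {20, 24, 25, 26, 27, 28} s2 s3"
        show "det acc [Assign 21 (Tl (Var 21))] s3 (I j (drop n (fst g), List.insert (pop n (fst g) []) (snd g))) 1"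
          using length_insert_le[of v L']
          by (intro det_straight) (use * s2 s3 in \<open>auto simp: I_def v_def g\<close>)
      qed (use * s2 b in \<open>auto simp: v_def I_def g\<close>)
    qed (use * assms in \<open>auto simp: I_def g\<close>)
  qed (auto simp: I_def)
  show ?thesis
    unfolding parse_prog_def by (rule det_seq[OF 1 2]) (auto simp: parse_cost_def)
qed

section \<open>Issuing the challenges\<close>

lemma triple_example:
  assumes "\<And>x. x \<in> cube n \<Longrightarrow> triple (examples n f) p (s(r := Cell (enc_bits x) (enc_bit (lab f x)))) (A x) R K Q"
  shows "triple (examples n f) (Ask r e # p) s (bind_pmf (unif n) A) R (Suc K) (Suc Q)"
proof (rule triple_Ask)
  show "examples n f (eval_expr s e) = map_pmf (\<lambda>x. Cell (enc_bits x) (enc_bit (lab f x))) (unif n)"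
    by (simp add: examples_def enc_label_def lab_def)
qed (use assms in auto)

lemma triple_loop:
  assumes "I m [] s" "\<And>j xs s. I (Suc j) xs s \<Longrightarrow> eval_expr s g \<noteq> Nul"
    and "\<And>j xs s. I (Suc j) xs s \<Longrightarrow> triple acc body s (map_pmf (\<lambda>x. x # xs) p) (I j) K Q"
    and "\<And>xs s. I 0 xs s \<Longrightarrow> eval_expr s g = Nul"
    and "\<And>xs s. I 0 xs s \<Longrightarrow> R xs s" "m * Suc K + 1 \<le> K'" "m * Q \<le> Q'"
  shows "triple acc [While g body] s (replicate_pmf m p) R K' Q'"
  by (rule triple_weaken[OF triple_replicate[where I = I and m = m and K = K and Q = Q]]) (use assms in auto)

definition pair_prog :: prog where
  "pair_prog = [Assign 37 (Hd (Var 33)), Assign 38 (Hd (Var 34)), Assign 39 (Hd (Var 35))] @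
     [While (Var 37) ([Assign 40 (Hd (Var 37))] @ xorc (Hd (Var 38)) 40 @ xorc (Hd (Var 39)) 40 @
       [Cond (Var 36) [Assign 31 (Mk (Hd (Var 39)) (Mk (Var 40) (Var 31)))] [Assign 31 (Mk (Var 40) (Mk (Hd (Var 39)) (Var 31)))],
        Assign 37 (Tl (Var 37)), Assign 38 (Tl (Var 38)), Assign 39 (Tl (Var 39))])]"

lemma push_pair_Nil [simp]: "push_pair ([], y) m = m"
  by (simp add: push_pair_def)

lemma push_pair_Cons [simp]: "push_pair (a # x, b # y) m = push_pair (x, y) (a # b # m)"
  by (simp add: push_pair_def)

lemma pair_prog:
  assumes "sexp_hd (s 33) = enc_bits x" "sexp_hd (s 34) = enc_bits y" "sexp_hd (s 35) = enc_bits z"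
    "s 36 = enc_bit b" "s 31 = enc_bits m" "length x = n" "length y = n" "length z = n"
  shows "det acc pair_prog s (\<lambda>s'. s' 31 = enc_bits (push_pair (shown (x, y, z, b)) m) \<and> same {31, 37, 38, 39, 40} s s') (13 * n + 4)"
proof -
  let ?W = "{31, 37, 38, 39, 40}"
  let ?body = "[Assign 40 (Hd (Var 37))] @ xorc (Hd (Var 38)) 40 @ xorc (Hd (Var 39)) 40 @
       [Cond (Var 36) [Assign 31 (Mk (Hd (Var 39)) (Mk (Var 40) (Var 31)))] [Assign 31 (Mk (Var 40) (Mk (Hd (Var 39)) (Var 31)))],
        Assign 37 (Tl (Var 37)), Assign 38 (Tl (Var 38)), Assign 39 (Tl (Var 39))]"
  define I where "I j g s' \<longleftrightarrow> (case g of (x', y', z', m') \<Rightarrow> length x' = j \<and> length y' = j \<and> length z' = j \<and>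
     s' 37 = enc_bits x' \<and> s' 38 = enc_bits y' \<and> s' 39 = enc_bits z' \<and> s' 31 = enc_bits m' \<and> s' 36 = enc_bit b \<and>
     push_pair (shown (x', y', z', b)) m' = push_pair (shown (x, y, z, b)) m \<and> same ?W s s')" for j g s'
  have 1: "det acc [Assign 37 (Hd (Var 33)), Assign 38 (Hd (Var 34)), Assign 39 (Hd (Var 35))] s (I n (x, y, z, m)) 3"
    by (rule det_straight) (use assms in \<open>auto simp: I_def\<close>)
  define h where "h g = (case g of (x', y', z', m') \<Rightarrow> (tl x', tl y', tl z', if b = 1 then hd z' # (hd x' + hd y' + hd z') # m'
     else (hd x' + hd y' + hd z') # hd z' # m'))" for g :: "bit list \<times> bit list \<times> bit list \<times> bit list"
  have 2: "det acc [While (Var 37) ?body] s1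
     (\<lambda>s'. s' 31 = enc_bits (push_pair (shown (x, y, z, b)) m) \<and> same ?W s s') (13 * n + 1)" if "I n (x, y, z, m) s1" for s1
  proof (rule det_gloop[where I = I and m = n, OF that])
    fix j g s' assume *: "I (Suc j) g s'"
    obtain a c d x' y' z' m' where g: "g = (a # x', c # y', d # z', m')"
      using * unfolding I_def by (auto simp: length_Suc_conv)
    have eq: "a + (c + d) = a + c + d" by (simp add: add.assoc)
    have "I j (x', y', z', if b = 1 then d # (a + c + d) # m' else (a + c + d) # d # m') (after ?body s')"
      using * unfolding g by (cases b) (auto simp: I_def after_xorc[where a = c and b = a] after_xorc[where a = d and b = "a + c"] shown_def bhd_def eq)
    then show "det acc ?body s' (I j (h g)) 12"
      by (intro det_straight) (auto simp: g h_def cost_append)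
  qed (auto simp: I_def shown_def)
  show ?thesis unfolding pair_prog_def by (rule det_seq[OF 1 2]) auto
qed

text \<open>Once the message has been built, only the hidden bit and the three labels matter, so the
  points are not stored.\<close>

definition enc_chall :: "(bit list \<Rightarrow> real) \<Rightarrow> challenge \<Rightarrow> sexp" where
  "enc_chall f = (\<lambda>(x, y, z, b). Cell (enc_bit b) (Cell (enc_bit (lab f x)) (Cell (enc_bit (lab f y)) (enc_bit (lab f z)))))"

definition chall_prog :: prog where
  "chall_prog = [Assign 30 Null, Assign 31 Null, Assign 32 (Var 11)] @
     [While (Var 32) (Ask 33 Null # Ask 34 Null # Ask 35 Null # Flip 36 # pair_prog @
       [Assign 30 (Mk (Mk (Var 36) (Mk (Tl (Var 33)) (Mk (Tl (Var 34)) (Tl (Var 35))))) (Var 30)), Assign 32 (Tl (Var 32))])]"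

definition chall_cost :: "nat \<Rightarrow> nat \<Rightarrow> nat" where
  "chall_cost n R = 4 + R * (13 * n + 11)"

lemma message_Cons [simp]: "message (p # ps) = push_pair p (message ps)" and message_Nil [simp]: "message [] = []"
  by (simp_all add: message_def)

text \<open>The abstract result is the full list of challenges, including the points that the store
  forgets. The probabilistic arguments can therefore speak about what the message shows and what it
  hides.\<close>

lemma chall_prog:
  assumes "s 11 = unary R"
  shows "triple (examples n f) chall_prog s (replicate_pmf R (challenge_pmf n))
     (\<lambda>rs s'. s' 30 = enc_list (map (enc_chall f) rs) \<and> s' 31 = enc_bits (message (map shown rs)) \<and>
        same {30..40} s s') (chall_cost n R) (3 * R)"
proof -
  let ?W = "{30..40::nat}"
  let ?R = "\<lambda>rs s'. s' 30 = enc_list (map (enc_chall f) rs) \<and> s' 31 = enc_bits (message (map shown rs)) \<and> same ?W s s'"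
  let ?rest = "[Assign 30 (Mk (Mk (Var 36) (Mk (Tl (Var 33)) (Mk (Tl (Var 34)) (Tl (Var 35))))) (Var 30)), Assign 32 (Tl (Var 32))]"
  define I where "I j rs s' \<longleftrightarrow> s' 32 = unary j \<and> ?R rs s'" for j rs s'
  have 1: "det (examples n f) [Assign 30 Null, Assign 31 Null, Assign 32 (Var 11)] s (I R []) 3"
    by (rule det_straight) (use assms in \<open>auto simp: I_def\<close>)
  have 2: "triple (examples n f) [While (Var 32) (Ask 33 Null # Ask 34 Null # Ask 35 Null # Flip 36 # pair_prog @ ?rest)] s1
     (replicate_pmf R (challenge_pmf n)) ?R (R * (13 * n + 11) + 1) (3 * R)" if "I R [] s1" for s1
  proof (rule triple_loop[where I = I and m = R, OF that])
    fix j rs s' assume *: "I (Suc j) rs s'"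
    have eq: "map_pmf (\<lambda>x. x # rs) (challenge_pmf n) = bind_pmf (unif n) (\<lambda>x. bind_pmf (unif n) (\<lambda>y.
       bind_pmf (unif n) (\<lambda>z. bind_pmf (pmf_of_set {0, 1}) (\<lambda>b. return_pmf ((x, y, z, b) # rs)))))"
      by (simp add: challenge_pmf_def map_bind_pmf)
    show "triple (examples n f) (Ask 33 Null # Ask 34 Null # Ask 35 Null # Flip 36 # pair_prog @ ?rest) s'
      (map_pmf (\<lambda>x. x # rs) (challenge_pmf n)) (I j) (Suc (Suc (Suc (Suc (13 * n + 4 + 2))))) (Suc (Suc (Suc 0)))"
      unfolding eq
    proof (intro triple_example triple_Flip)
      fix x y z b assume xyz: "x \<in> cube n" "y \<in> cube n" "z \<in> cube n"
      let ?ex = "\<lambda>x. Cell (enc_bits x) (enc_bit (lab f x))"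
      let ?s = "s'(33 := ?ex x, 34 := ?ex y, 35 := ?ex z, 36 := enc_bit b)"
      have "det (examples n f) (pair_prog @ ?rest) ?s (I j ((x, y, z, b) # rs)) (13 * n + 4 + 2)"
      proof (rule det_det, rule pair_prog[where x = x and y = y and z = z and b = b and n = n and m = "message (map shown rs)"])
        fix s'' assume "s'' 31 = enc_bits (push_pair (shown (x, y, z, b)) (message (map shown rs))) \<and> same {31, 37, 38, 39, 40} ?s s''"
        then show "det (examples n f) ?rest s'' (I j ((x, y, z, b) # rs)) 2"
          using * by (intro det_straight) (auto simp: I_def enc_chall_def)
      qed (use * xyz in \<open>auto simp: cube_def I_def\<close>)
      then show "triple (examples n f) (pair_prog @ ?rest) ?s (return_pmf ((x, y, z, b) # rs)) (I j) (13 * n + 4 + 2) 0"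
        by (rule det_triple)
    qed
  qed (auto simp: I_def)
  show ?thesis
    unfolding chall_prog_def by (rule triple_det_seq[OF 1 2]) (auto simp: chall_cost_def)
qed

text \<open>The program is restarted for every message; register 50, initially \<open>Nul\<close>,
  records that the first activation is over.\<close>

definition stage1 :: prog where
  "stage1 = params @ parse_prog @ chall_prog @ [Assign 0 (Var 31), Assign 50 one]"

definition stage1_cost :: "nat \<Rightarrow> nat \<Rightarrow> nat" where
  "stage1_cost n G = params_cost n G + (parse_cost n (G ^ 16) + (chall_cost n (G ^ 64) + 2))"

lemma stage1:
  assumes "s 0 = enc_bits m" "s 1 = unary n" "s 2 = unary t" "s 3 = unary N" "s 4 = unary D" and G: "G = big_g t N D"
  shows "triple (examples n f) stage1 s (replicate_pmf (G ^ 64) (challenge_pmf n))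
    (\<lambda>rs s'. s' 0 = enc_bits (message (map shown rs)) \<and> s' 2 = unary t \<and> s' 11 = unary (G ^ 64) \<and> s' 13 = unary (G ^ 56) \<and>
      s' 20 = enc_vecs (parse (G ^ 16) n m []) \<and> s' 30 = enc_list (map (enc_chall f) rs) \<and> s' 50 \<noteq> Nul)
    (stage1_cost n G) (3 * G ^ 64)"
  unfolding stage1_def
proof (rule triple_det_seq, rule params[OF assms(2-6)])
  let ?R = "\<lambda>rs s'. s' 0 = enc_bits (message (map shown rs)) \<and> s' 2 = unary t \<and> s' 11 = unary (G ^ 64) \<and> s' 13 = unary (G ^ 56) \<and>
      s' 20 = enc_vecs (parse (G ^ 16) n m []) \<and> s' 30 = enc_list (map (enc_chall f) rs) \<and> s' 50 \<noteq> Nul"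
  fix s1 assume s1: "s1 9 = unary (G ^ 16) \<and> s1 11 = unary (G ^ 64) \<and> s1 13 = unary (G ^ 56) \<and>
    s1 15 = unary (G ^ 16 * (n + G)) \<and> s1 18 = unary (G ^ 28 * (n + G)) \<and> same ({5..18} \<union> {98, 99}) s s1"
  show "triple (examples n f) (parse_prog @ chall_prog @ [Assign 0 (Var 31), Assign 50 one]) s1
    (replicate_pmf (G ^ 64) (challenge_pmf n)) ?R (parse_cost n (G ^ 16) + (chall_cost n (G ^ 64) + 2)) (3 * G ^ 64)"
  proof (rule triple_det_seq, rule parse_prog[where m = m and n = n and k = "G ^ 16"])
    fix s2 assume s2: "s2 20 = enc_vecs (parse (G ^ 16) n m []) \<and> same {0, 20, 21, 22, 23, 24, 25, 26, 27, 28} s1 s2"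
    have "triple (examples n f) (chall_prog @ [Assign 0 (Var 31), Assign 50 one]) s2
      (bind_pmf (replicate_pmf (G ^ 64) (challenge_pmf n)) return_pmf) ?R (chall_cost n (G ^ 64) + 2) (3 * G ^ 64 + 0)"
    proof (rule triple_append, rule chall_prog)
      fix rs s3 assume "s3 30 = enc_list (map (enc_chall f) rs) \<and> s3 31 = enc_bits (message (map shown rs)) \<and> same {30..40} s2 s3"
      then show "triple (examples n f) [Assign 0 (Var 31), Assign 50 one] s3 (return_pmf rs) ?R 2 0"
        using s1 s2 assms by (intro det_triple det_straight) auto
    qed (use s1 s2 in auto)
    then show "triple (examples n f) (chall_prog @ [Assign 0 (Var 31), Assign 50 one]) s2
      (replicate_pmf (G ^ 64) (challenge_pmf n)) ?R (chall_cost n (G ^ 64) + 2) (3 * G ^ 64)"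
      by (simp add: bind_return_pmf')
  qed (use s1 assms in auto)
qed (simp add: stage1_cost_def)

section \<open>Inner products and comparisons\<close>

definition ip_prog :: "nat \<Rightarrow> nat \<Rightarrow> nat \<Rightarrow> prog" where
  "ip_prog x y p = [While (Var y) [Cond (Hd (Var x)) (xorc (Hd (Var y)) p) [], Assign x (Tl (Var x)), Assign y (Tl (Var y))]]"

lemma ip_prog:
  assumes "distinct [x, y, p]" "s x = enc_bits v" "s y = enc_bits \<gamma>" "s p = enc_bit b" "length v = length \<gamma>"
  shows "det acc (ip_prog x y p) s (\<lambda>s'. s' p = enc_bit (b + inner_prod \<gamma> v) \<and> same {x, y, p} s s') (7 * length \<gamma> + 1)"
proof -
  let ?body = "[Cond (Hd (Var x)) (xorc (Hd (Var y)) p) [], Assign x (Tl (Var x)), Assign y (Tl (Var y))]"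
  define I where "I j g s' \<longleftrightarrow> (case g of (v', \<gamma>', b') \<Rightarrow> length v' = j \<and> length \<gamma>' = j \<and> s' x = enc_bits v' \<and> s' y = enc_bits \<gamma>' \<and>
     s' p = enc_bit b' \<and> b' + inner_prod \<gamma>' v' = b + inner_prod \<gamma> v \<and> same {x, y, p} s s')" for j g s'
  define h :: "bit list \<times> bit list \<times> bit \<Rightarrow> bit list \<times> bit list \<times> bit"
    where "h g = (case g of (v', \<gamma>', b') \<Rightarrow> (tl v', tl \<gamma>', b' + hd \<gamma>' * hd v'))" for g
  show ?thesis
    unfolding ip_prog_def
  proof (rule det_gloop[where I = I and m = "length \<gamma>" and g = "(v, \<gamma>, b)"])
    fix j g s' assume *: "I (Suc j) g s'"
    obtain a c v' \<gamma>' b' where g: "g = (a # v', c # \<gamma>', b')"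
      using * unfolding I_def by (auto simp: length_Suc_conv)
    have "I j (v', \<gamma>', b' + c * a) (after ?body s')"
      using * assms(1) unfolding g
      by (cases a) (auto simp: I_def after_xorc[where a = c and b = b'] bhd_def add.assoc)
    then show "det acc ?body s' (I j (h g)) 6"
      by (intro det_straight) (auto simp: g h_def)
  next
    show "I (length \<gamma>) (v, \<gamma>, b) s" using assms by (simp add: I_def)
  next
    fix j g s' assume "I (Suc j) g s'" then show "eval_expr s' (Var y) \<noteq> Nul"
      by (auto simp: I_def split: prod.splits)
  next
    fix g s' assume "I 0 g s'" then show "eval_expr s' (Var y) = Nul"
      by (auto simp: I_def split: prod.splits)
  next
    fix g s' assume "I 0 g s'" then show "s' p = enc_bit (b + inner_prod \<gamma> v) \<and> same {x, y, p} s s'"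
      by (auto simp: I_def split: prod.splits)
  qed simp
qed

text \<open>Register \<open>r\<close> is only ever cleared, so a rejection recorded earlier survives
  the comparison.\<close>

definition leq_prog :: "nat \<Rightarrow> nat \<Rightarrow> nat \<Rightarrow> prog" where
  "leq_prog a b r = [While (Var a) [Cond (Var b) [Assign b (Tl (Var b))] [Assign r Null], Assign a (Tl (Var a))]]"

lemma leq_prog:
  assumes "distinct [a, b, r]" "s a = unary i" "s b = unary j"
  shows "det acc (leq_prog a b r) s (\<lambda>s'. (s' r \<noteq> Nul \<longleftrightarrow> s r \<noteq> Nul \<and> i \<le> j) \<and> same {a, b, r} s s') (4 * i + 1)"
proof -
  let ?body = "[Cond (Var b) [Assign b (Tl (Var b))] [Assign r Null], Assign a (Tl (Var a))]"
  define I where "I k j' s' \<longleftrightarrow> s' a = unary k \<and> s' b = unary j' \<and>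
     (s' r \<noteq> Nul \<and> k \<le> j' \<longleftrightarrow> s r \<noteq> Nul \<and> i \<le> j) \<and> same {a, b, r} s s'" for k j' s'
  show ?thesis
    unfolding leq_prog_def
  proof (rule det_gloop[where I = I and m = i and g = j])
    fix k j' s' assume *: "I (Suc k) j' s'"
    have "I k (j' - 1) (after ?body s')"
      using * assms(1) by (cases j') (auto simp: I_def)
    then show "det acc ?body s' (I k (j' - 1)) 3"
      by (intro det_straight) auto
  next
    show "I i j s" using assms by (simp add: I_def)
  qed (auto simp: I_def)
qed

section \<open>Checking the replies\<close>

definition check_body :: prog where
  "check_body = [Cond (Hd (Hd (Var 30))) [Assign 63 (Hd (Var 0)), Assign 64 (Hd (Tl (Var 0)))] [Assign 64 (Hd (Var 0)), Assign 63 (Hd (Tl (Var 0)))],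
       Assign 0 (Tl (Tl (Var 0))), Assign 65 (Tl (Tl (Tl (Hd (Var 30)))))] @
       xorc (Var 63) 65 @ xorc (Hd (Tl (Hd (Var 30)))) 64 @ xorc (Hd (Tl (Tl (Hd (Var 30))))) 64 @ xorc (Tl (Tl (Tl (Hd (Var 30))))) 64 @
       [Cond (Var 65) [Assign 60 Null] [], Cond (Var 64) [Assign 62 (Mk Null (Var 62))] [Assign 61 (Mk Null (Var 61))],
        Assign 30 (Tl (Var 30))]"

text \<open>Registers 61 and 62 hold the two sides of the final comparison, and the slack in
  register 13 is the initial value of 62. Register 60 is the flag for acceptance.\<close>

definition check_prog :: prog where
  "check_prog = [Assign 60 one, Assign 61 Null, Assign 62 (Var 13)] @ [While (Var 30) check_body]"

lemma check_body:
  assumes "s 30 = enc_list (map (enc_chall f) (r # rs))" "s 0 = enc_bits m" "s 61 = unary a" "s 62 = unary b"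
    and r: "r = (x, y, z, c)" and w: "w = reply_w c m + lab f x + lab f y + lab f z"
  shows "after check_body s 30 = enc_list (map (enc_chall f) rs)" "after check_body s 0 = enc_bits (drop 2 m)"
    "after check_body s 60 = (if reply_z c m = lab f z then s 60 else Nul)"
    "after check_body s 61 = unary (a + (if w = 0 then 1 else 0))"
    "after check_body s 62 = unary (b + (if w = 1 then 1 else 0))"
    "same {0, 30, 60, 61, 62, 63, 64, 65} s (after check_body s)"
proof -
  have d: "drop 2 m = tl (tl m)" by (cases m; cases "tl m") auto
  have e: "lab f z + reply_z c m = 0 \<longleftrightarrow> reply_z c m = lab f z" "lab f z + reply_z c m = 1 \<longleftrightarrow> reply_z c m \<noteq> lab f z"
    by (cases "lab f z"; cases "reply_z c m"; simp)+
  have "after check_body s 30 = enc_list (map (enc_chall f) rs) \<and> after check_body s 0 = enc_bits (drop 2 m) \<and>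
    after check_body s 60 = (if reply_z c m = lab f z then s 60 else Nul) \<and>
    after check_body s 61 = unary (a + (if w = 0 then 1 else 0)) \<and>
    after check_body s 62 = unary (b + (if w = 1 then 1 else 0)) \<and>
    same {0, 30, 60, 61, 62, 63, 64, 65} s (after check_body s)"
    using assms(1-4) d e unfolding check_body_def r w
    by (cases c) (auto simp: enc_chall_def reply_z_def reply_w_def
       after_xorc[where a = "bhd m" and b = "lab f z"] after_xorc[where a = "bhd (tl m)" and b = "lab f z"]
       after_xorc[where a = "lab f x" and b = "bhd m"] after_xorc[where a = "lab f x" and b = "bhd (tl m)"]
       after_xorc[where a = "lab f y" and b = "bhd m + lab f x"] after_xorc[where a = "lab f y" and b = "bhd (tl m) + lab f x"]
       after_xorc[where a = "lab f z" and b = "bhd m + lab f x + lab f y"] after_xorc[where a = "lab f z" and b = "bhd (tl m) + lab f x + lab f y"])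
  then show "after check_body s 30 = enc_list (map (enc_chall f) rs)" "after check_body s 0 = enc_bits (drop 2 m)"
    "after check_body s 60 = (if reply_z c m = lab f z then s 60 else Nul)"
    "after check_body s 61 = unary (a + (if w = 0 then 1 else 0))"
    "after check_body s 62 = unary (b + (if w = 1 then 1 else 0))"
    "same {0, 30, 60, 61, 62, 63, 64, 65} s (after check_body s)" by blast+
qed

lemma zeros_simps [simp]: "zeros [] = 0" "zeros (b # bs) = (if b = 0 then 1 else 0) + zeros bs"
  and ones_simps [simp]: "ones [] = 0" "ones (b # bs) = (if b = 1 then 1 else 0) + ones bs"
  by (auto simp: zeros_def ones_def)

lemma check_prog:
  assumes "s 30 = enc_list (map (enc_chall f) rs)" "s 0 = enc_bits m" "s 13 = unary Q"
  shows "det acc check_prog s (\<lambda>s'. (s' 60 \<noteq> Nul \<longleftrightarrow> consistent f rs m) \<and> s' 61 = unary (zeros (outcomes f rs m)) \<and>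
    s' 62 = unary (Q + ones (outcomes f rs m)) \<and> same {0, 30, 60, 61, 62, 63, 64, 65} s s') (24 * length rs + 4)"
proof -
  define I where "I j g s' \<longleftrightarrow> (case g of (rs', m', a', b') \<Rightarrow> length rs' = j \<and> s' 30 = enc_list (map (enc_chall f) rs') \<and>
    s' 0 = enc_bits m' \<and> s' 61 = unary a' \<and> s' 62 = unary b' \<and>
    (s' 60 \<noteq> Nul \<and> consistent f rs' m' \<longleftrightarrow> consistent f rs m) \<and>
    a' + zeros (outcomes f rs' m') = zeros (outcomes f rs m) \<and> b' + ones (outcomes f rs' m') = Q + ones (outcomes f rs m) \<and>
    same {0, 30, 60, 61, 62, 63, 64, 65} s s')" for j g s'
  define h where "h g = (case g of (rs', m', a', b') \<Rightarrow> (case hd rs' of (x, y, z, c) \<Rightarrow>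
     let w = reply_w c m' + lab f x + lab f y + lab f z in
       (tl rs', drop 2 m', a' + (if w = 0 then 1 else 0 :: nat), b' + (if w = 1 then 1 else 0 :: nat))))" for g
  have 1: "det acc [Assign 60 one, Assign 61 Null, Assign 62 (Var 13)] s (I (length rs) (rs, m, 0, Q)) 3"
    by (rule det_straight) (use assms in \<open>auto simp: I_def\<close>)
  have 2: "det acc [While (Var 30) check_body] s1 (\<lambda>s'. (s' 60 \<noteq> Nul \<longleftrightarrow> consistent f rs m) \<and> s' 61 = unary (zeros (outcomes f rs m)) \<and>
    s' 62 = unary (Q + ones (outcomes f rs m)) \<and> same {0, 30, 60, 61, 62, 63, 64, 65} s s') (24 * length rs + 1)"
    if "I (length rs) (rs, m, 0, Q) s1" for s1
  proof (rule det_gloop[where I = I and m = "length rs" and h = "\<lambda>_. h", OF that])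
    fix j g s' assume *: "I (Suc j) g s'"
    obtain r rs' m' a' b' where g: "g = (r # rs', m', a', b')"
      using * unfolding I_def by (auto simp: length_Suc_conv)
    obtain x y z c where r: "r = (x, y, z, c)" by (cases r)
    define w where "w = reply_w c m' + lab f x + lab f y + lab f z"
    have s': "s' 30 = enc_list (map (enc_chall f) (r # rs'))" "s' 0 = enc_bits m'" "s' 61 = unary a'" "s' 62 = unary b'"
      using * unfolding g I_def by auto
    note cb = check_body[OF s' r w_def]
    have hg: "h g = (rs', drop 2 m', a' + (if w = 0 then 1 else 0), b' + (if w = 1 then 1 else 0))"
      by (simp add: g h_def r w_def)
    have "I j (h g) (after check_body s')"
      using * cb(6) unfolding hg I_def prod.case cb(1-5)
      by (auto simp: g r w_def[symmetric] split: if_splits)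
    then show "det acc check_body s' (I j (h g)) 23"
      by (intro det_straight) (auto simp: check_body_def cost_append)
  qed (auto simp: I_def)
  show ?thesis unfolding check_prog_def by (rule det_seq[OF 1 2]) auto
qed

section \<open>Scores of the candidates\<close>

definition parity_body :: prog where
  "parity_body = Ask 75 Null # (xorc (Tl (Var 75)) 73 @ [Assign 76 (Hd (Var 75)), Assign 77 (Hd (Var 20))]) @ ip_prog 76 77 73 @ [Assign 74 (Tl (Var 74))]"

definition parity_prog :: prog where
  "parity_prog = [Assign 73 Null, Assign 74 (Mk Null (Mk Null (Mk Null (Mk Null Null))))] @ [While (Var 74) parity_body]"

lemma parity_prog:
  assumes "s 20 = enc_vecs (\<gamma> # L)" "length \<gamma> = n"
  shows "triple (examples n f) parity_prog s (parity_pmf n f \<gamma>) (\<lambda>b s'. s' 73 = enc_bit b \<and> same {73..77} s s') (28 * n + 39) 4"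
proof -
  define S where "S xs = (\<Sum>x\<leftarrow>xs. lab f x + inner_prod \<gamma> x)" for xs
  define I where "I j xs s' \<longleftrightarrow> s' 74 = unary j \<and> s' 73 = enc_bit (S xs) \<and> same {73..77} s s'" for j xs s'
  have 1: "det (examples n f) [Assign 73 Null, Assign 74 (Mk Null (Mk Null (Mk Null (Mk Null Null))))] s (I 4 []) 2"
    by (rule det_straight) (auto simp: I_def S_def eval_nat_numeral)
  have 2: "triple (examples n f) [While (Var 74) parity_body] s1 (replicate_pmf 4 (unif n))
    (\<lambda>xs s'. s' 73 = enc_bit (S xs) \<and> same {73..77} s s') (28 * n + 37) 4" if "I 4 [] s1" for s1
  proof (rule triple_loop[where I = I and m = 4, OF that])
    fix j xs s' assume *: "I (Suc j) xs s'"
    show "triple (examples n f) parity_body s' (map_pmf (\<lambda>x. x # xs) (unif n)) (I j) (Suc (5 + (7 * n + 1) + 1)) (Suc 0)"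
      unfolding map_pmf_def parity_body_def
    proof (rule triple_example, rule det_triple)
      fix x assume x: "x \<in> cube n"
      let ?s = "s'(75 := Cell (enc_bits x) (enc_bit (lab f x)))"
      let ?R = "\<lambda>s''. s'' 73 = enc_bit (S xs + lab f x) \<and> s'' 76 = enc_bits x \<and> s'' 77 = enc_bits \<gamma> \<and> s'' 74 = unary (Suc j) \<and> same {73..77} s s''"
      have 1: "det (examples n f) (xorc (Tl (Var 75)) 73 @ [Assign 76 (Hd (Var 75)), Assign 77 (Hd (Var 20))]) ?s ?R 5"
        by (rule det_straight) (use * assms in \<open>auto simp: I_def cost_append after_xorc[where a = "lab f x" and b = "S xs"]\<close>)
      have 2: "det (examples n f) (ip_prog 76 77 73 @ [Assign 74 (Tl (Var 74))]) s2 (I j (x # xs)) (7 * n + 1 + 1)" if s2: "?R s2" for s2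
      proof (rule det_det, rule det_weaken, rule ip_prog[where v = x and \<gamma> = \<gamma> and b = "S xs + lab f x"])
        fix s3 assume "s3 73 = enc_bit (S xs + lab f x + inner_prod \<gamma> x) \<and> same {76, 77, 73} s2 s3"
        then show "s3 73 = enc_bit (S (x # xs)) \<and> s3 74 = unary (Suc j) \<and> same {73..77} s s3"
          using s2 by (auto simp: S_def add_ac)
      next
        fix s3 assume "s3 73 = enc_bit (S (x # xs)) \<and> s3 74 = unary (Suc j) \<and> same {73..77} s s3"
        then show "det (examples n f) [Assign 74 (Tl (Var 74))] s3 (I j (x # xs)) 1"
          by (intro det_straight) (auto simp: I_def)
      qed (use s2 x assms in \<open>auto simp: cube_def\<close>)
      show "det (examples n f) ((xorc (Tl (Var 75)) 73 @ [Assign 76 (Hd (Var 75)), Assign 77 (Hd (Var 20))]) @ ip_prog 76 77 73 @ [Assign 74 (Tl (Var 74))])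
         ?s (I j (x # xs)) (5 + (7 * n + 1) + 1)"
        by (rule det_seq[OF 1 2]) auto
    qed
  qed (auto simp: I_def)
  have "triple (examples n f) [While (Var 74) parity_body] s1 (parity_pmf n f \<gamma>)
    (\<lambda>b s'. s' 73 = enc_bit b \<and> same {73..77} s s') (28 * n + 37) 4" if "I 4 [] s1" for s1
  proof -
    have "triple (examples n f) ([While (Var 74) parity_body] @ []) s1 (bind_pmf (replicate_pmf 4 (unif n)) (\<lambda>xs. return_pmf (S xs)))
      (\<lambda>b s'. s' 73 = enc_bit b \<and> same {73..77} s s') (28 * n + 37 + 0) (4 + 0)"
      by (rule triple_append[OF 2[OF that]]) (rule triple_Nil)
    then show ?thesis unfolding parity_pmf_def map_pmf_def S_def by simp
  qed
  then show ?thesis unfolding parity_prog_def by (intro triple_det_seq[OF 1]) auto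
qed

text \<open>Odd parities are added to register 61 and even ones to 62, opposite to the outcomes,
  since the scores are subtracted from the total. Register 71 keeps the score of the current
  candidate.\<close>

definition score_body :: prog where
  "score_body = [Assign 71 Null, Assign 72 (Var 11)] @
     [While (Var 72) (parity_prog @ [Cond (Var 73) [Assign 61 (Mk Null (Var 61))] [Assign 62 (Mk Null (Var 62)), Assign 71 (Mk Null (Var 71))],
        Assign 72 (Tl (Var 72))])] @
     [Assign 70 (Mk (Mk (Var 71) (Hd (Var 20))) (Var 70)), Assign 20 (Tl (Var 20))]"

lemma zeros_ones: "zeros bs + ones bs = length bs"
  by (induction bs) (auto simp: )

abbreviation "score_regs \<equiv> {20, 61, 62} \<union> {70..77::nat}"

definition enc_score :: "nat \<times> bit list \<Rightarrow> sexp" where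
  "enc_score = (\<lambda>(c, \<gamma>). Cell (unary c) (enc_bits \<gamma>))"

lemma score_body:
  assumes "s 20 = enc_vecs (\<gamma> # L)" "length \<gamma> = n" "s 11 = unary R" "s 61 = unary a" "s 62 = unary b" "s 70 = enc_list (map enc_score cs)"
  shows "triple (examples n f) score_body s (map_pmf (\<lambda>bs. (zeros bs, \<gamma>) # cs) (replicate_pmf R (parity_pmf n f \<gamma>)))
    (\<lambda>cs' s'. \<exists>c \<le> R. cs' = (c, \<gamma>) # cs \<and> s' 20 = enc_vecs L \<and> s' 61 = unary (a + (R - c)) \<and> s' 62 = unary (b + c) \<and>
       s' 70 = enc_list (map enc_score cs') \<and> same score_regs s s')
    (5 + R * (28 * n + 44)) (R * 4)"
proof -
  define I where "I j bs s' \<longleftrightarrow> length bs + j = R \<and> s' 72 = unary j \<and> s' 71 = unary (zeros bs) \<and> s' 61 = unary (a + ones bs) \<and> s' 62 = unary (b + zeros bs) \<and>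
    same ({61, 62} \<union> {71..77}) s s'" for j bs s'
  let ?rest = "[Cond (Var 73) [Assign 61 (Mk Null (Var 61))] [Assign 62 (Mk Null (Var 62)), Assign 71 (Mk Null (Var 71))],
        Assign 72 (Tl (Var 72))]"
  have 1: "det (examples n f) [Assign 71 Null, Assign 72 (Var 11)] s (I R []) 2"
    by (rule det_straight) (use assms in \<open>auto simp: I_def\<close>)
  have 2: "triple (examples n f) [While (Var 72) (parity_prog @ ?rest)] s1 (replicate_pmf R (parity_pmf n f \<gamma>)) (I 0)
    (R * (28 * n + 44) + 1) (R * 4)" if "I R [] s1" for s1
  proof (rule triple_loop[where I = I and m = R, OF that])
    fix j bs s' assume *: "I (Suc j) bs s'"
    show "triple (examples n f) (parity_prog @ ?rest) s' (map_pmf (\<lambda>x. x # bs) (parity_pmf n f \<gamma>)) (I j) (28 * n + 39 + 4) (4 + 0)"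
      unfolding map_pmf_def
    proof (rule triple_append, rule parity_prog)
      fix c s'' assume s'': "s'' 73 = enc_bit c \<and> same {73..77} s' s''"
      have "I j (c # bs) (after ?rest s'')" using * s'' by (cases c) (auto simp: I_def)
      then show "triple (examples n f) ?rest s'' (return_pmf (c # bs)) (I j) 4 0"
        by (intro det_triple det_straight) auto
    qed (use * assms in \<open>auto simp: I_def\<close>)
  qed (auto simp: I_def)
  let ?fin = "[Assign 70 (Mk (Mk (Var 71) (Hd (Var 20))) (Var 70)), Assign 20 (Tl (Var 20))]"
  let ?R = "\<lambda>cs' s'. \<exists>c \<le> R. cs' = (c, \<gamma>) # cs \<and> s' 20 = enc_vecs L \<and> s' 61 = unary (a + (R - c)) \<and> s' 62 = unary (b + c) \<and>
       s' 70 = enc_list (map enc_score cs') \<and> same score_regs s s'"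
  have 3: "triple (examples n f) ([While (Var 72) (parity_prog @ ?rest)] @ ?fin) s1
     (map_pmf (\<lambda>bs. (zeros bs, \<gamma>) # cs) (replicate_pmf R (parity_pmf n f \<gamma>))) ?R (R * (28 * n + 44) + 1 + 2) (R * 4 + 0)" if "I R [] s1" for s1
    unfolding map_pmf_def
  proof (rule triple_append, rule 2[OF that])
    fix bs s2 assume "I 0 bs s2"
    moreover have "R - zeros bs = ones bs" "zeros bs \<le> R" if "length bs = R" using zeros_ones[of bs] that by auto
    ultimately have "?R ((zeros bs, \<gamma>) # cs) (after ?fin s2)"
      using assms by (auto simp: I_def enc_score_def)
    then show "triple (examples n f) ?fin s2 (return_pmf ((zeros bs, \<gamma>) # cs)) ?R 2 0"
      by (intro det_triple det_straight) auto
  qed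
  show ?thesis unfolding score_body_def by (rule triple_det_seq[OF 1 triple_weaken[OF 3]]) auto
qed

definition score_prog :: prog where
  "score_prog = [Assign 70 Null] @ [While (Var 20) score_body]"

definition score_cost :: "nat \<Rightarrow> nat \<Rightarrow> nat \<Rightarrow> nat" where
  "score_cost n k R = 2 + k * (6 + R * (28 * n + 44))"

lemma score_prog:
  assumes "s 20 = enc_vecs L" "\<forall>\<gamma>\<in>set L. length \<gamma> = n" "s 11 = unary R" "s 61 = unary a" "s 62 = unary b" "length L \<le> k"
  shows "triple (examples n f) score_prog s (score_all n f R L)
    (\<lambda>cs s'. map snd cs = rev L \<and> (\<forall>(c, \<gamma>)\<in>set cs. c \<le> R) \<and> s' 61 = unary (a + (\<Sum>(c, \<gamma>)\<leftarrow>cs. R - c)) \<and> s' 62 = unary (b + (\<Sum>(c, \<gamma>)\<leftarrow>cs. c)) \<and>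
       s' 70 = enc_list (map enc_score cs) \<and> same score_regs s s')
    (score_cost n k R) (k * (R * 4))"
proof -
  define I where "I es cs s' \<longleftrightarrow> rev (map snd cs) @ es = L \<and> (\<forall>(c, \<gamma>)\<in>set cs. c \<le> R) \<and> s' 20 = enc_vecs es \<and>
       s' 61 = unary (a + (\<Sum>(c, \<gamma>)\<leftarrow>cs. R - c)) \<and> s' 62 = unary (b + (\<Sum>(c, \<gamma>)\<leftarrow>cs. c)) \<and>
       s' 70 = enc_list (map enc_score cs) \<and> same score_regs s s'" for es cs s'
  have 1: "det (examples n f) [Assign 70 Null] s (I L []) 1"
    by (rule det_straight) (use assms in \<open>auto simp: I_def\<close>)
  have 2: "triple (examples n f) [While (Var 20) score_body] s1 (score_all n f R L) (I [])
     (length L * Suc (5 + R * (28 * n + 44)) + 1) (length L * (R * 4))" if "I L [] s1" for s1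
    unfolding score_all_def
  proof (rule triple_foldM[where I = I, OF that])
    fix \<gamma> es cs s' assume *: "I (\<gamma> # es) cs s'"
    then have \<gamma>: "length \<gamma> = n" using assms(2) unfolding I_def by (metis in_set_conv_decomp)
    have "triple (examples n f) score_body s' (map_pmf (\<lambda>bs. (zeros bs, \<gamma>) # cs) (replicate_pmf R (parity_pmf n f \<gamma>))) (I es)
        (5 + R * (28 * n + 44)) (R * 4)"
      by (rule triple_weaken, rule score_body[where L = es and R = R and a = "a + (\<Sum>(c, \<gamma>)\<leftarrow>cs. R - c)" and b = "b + (\<Sum>(c, \<gamma>)\<leftarrow>cs. c)"])
         (use * \<gamma> assms in \<open>auto simp: I_def add_ac\<close>)
    then show "eval_expr s' (Var 20) \<noteq> Nul \<and> triple (examples n f) score_body s' (map_pmf (\<lambda>bs. (zeros bs, \<gamma>) # cs) (replicate_pmf R (parity_pmf n f \<gamma>))) (I es)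
        (5 + R * (28 * n + 44)) (R * 4)" using * by (simp add: I_def)
  qed (auto simp: I_def)
  have le: "length L * c \<le> k * c" for c using assms(6) by (intro mult_right_mono) auto
  have "triple (examples n f) score_prog s (score_all n f R L) (I []) (1 + (length L * Suc (5 + R * (28 * n + 44)) + 1)) (length L * (R * 4))"
    unfolding score_prog_def by (rule triple_det_seq[OF 1 2]) auto
  then show ?thesis
    by (rule triple_weaken) (use le in \<open>auto simp: I_def score_cost_def rev_swap\<close>)
qed

section \<open>Selecting the candidates with the largest scores\<close>

definition max_body :: prog where
  "max_body = [Assign 84 (Hd (Hd (Var 83))), Assign 85 (Hd (Var 82)), Assign 86 one] @ leq_prog 84 85 86 @
     [Cond (Var 86) [Assign 70 (Mk (Hd (Var 83)) (Var 70))] [Assign 70 (Mk (Var 82) (Var 70)), Assign 82 (Hd (Var 83))],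
      Assign 83 (Tl (Var 83))]"

definition round_prog :: prog where
  "round_prog = [Assign 82 (Hd (Var 70)), Assign 83 (Tl (Var 70)), Assign 70 Null] @ [While (Var 83) max_body] @
     [Assign 80 (Mk (Tl (Var 82)) (Var 80))]"

lemma max_step_set: "fold max_step cs (b, rest) = (b', rest') \<Longrightarrow> insert b' (set rest') = insert b (set rest \<union> set cs) \<and> length rest' = length rest + length cs"
proof (induction cs arbitrary: b rest)
  case (Cons c cs)
  then show ?case by (auto simp: max_step_def split: if_splits)
qed auto

lemma round_prog:
  assumes "s 70 = enc_list (map enc_score (c # cs))" "s 80 = enc_vecs out" "fold max_step cs (c, []) = (b, rest)"
    "\<forall>c'\<in>set (c # cs). fst c' \<le> R"
  shows "det acc round_prog s (\<lambda>s'. s' 70 = enc_list (map enc_score rest) \<and> s' 80 = enc_vecs (snd b # out) \<and>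
    same ({70, 80} \<union> {82..86}) s s') (5 + length cs * (4 * R + 9))"
proof -
  define I where "I es g s' \<longleftrightarrow> s' 83 = enc_list (map enc_score es) \<and> s' 82 = enc_score (fst g) \<and> s' 70 = enc_list (map enc_score (snd g)) \<and>
     fold max_step es g = (b, rest) \<and> set es \<subseteq> set cs \<and> same ({70} \<union> {82..86}) s s'" for es g s'
  have 1: "det acc [Assign 82 (Hd (Var 70)), Assign 83 (Tl (Var 70)), Assign 70 Null] s (I cs (c, [])) 3"
    by (rule det_straight) (use assms in \<open>auto simp: I_def\<close>)
  have 2: "det acc [While (Var 83) max_body] s1 (I [] (b, rest)) (length cs * Suc (4 * R + 8) + 1)" if "I cs (c, []) s1" for s1
    unfolding assms(3)[symmetric]
  proof (rule det_fold[where I = I, OF that])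
    fix e es g s' assume *: "I (e # es) g s'"
    obtain ce \<gamma>e where e: "e = (ce, \<gamma>e)" by (cases e)
    obtain cb \<gamma>b rs where g: "g = ((cb, \<gamma>b), rs)" by (cases g; cases "fst g") auto
    have le: "ce \<le> R" using * assms(4) by (auto simp: I_def e)
    let ?R = "\<lambda>s2. s2 84 = unary ce \<and> s2 85 = unary cb \<and> s2 86 \<noteq> Nul \<and> same {84, 85, 86} s' s2"
    have a: "det acc [Assign 84 (Hd (Hd (Var 83))), Assign 85 (Hd (Var 82)), Assign 86 one] s' ?R 3"
      by (rule det_straight) (use * in \<open>auto simp: I_def e g enc_score_def\<close>)
    have b: "det acc (leq_prog 84 85 86) s2 (\<lambda>s3. (s3 86 \<noteq> Nul \<longleftrightarrow> ce \<le> cb) \<and> same {84, 85, 86} s' s3) (4 * ce + 1)" if "?R s2" for s2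
      by (rule det_weaken, rule leq_prog[where i = ce and j = cb]) (use that in auto)
    have c: "det acc [Cond (Var 86) [Assign 70 (Mk (Hd (Var 83)) (Var 70))] [Assign 70 (Mk (Var 82) (Var 70)), Assign 82 (Hd (Var 83))],
      Assign 83 (Tl (Var 83))] s3 (I es (max_step e g)) 4"
      if s3: "(s3 86 \<noteq> Nul \<longleftrightarrow> ce \<le> cb) \<and> same {84, 85, 86} s' s3" for s3
    proof (rule det_straight)
      show "I es (max_step e g) (after [Cond (Var 86) [Assign 70 (Mk (Hd (Var 83)) (Var 70))] [Assign 70 (Mk (Var 82) (Var 70)), Assign 82 (Hd (Var 83))],
      Assign 83 (Tl (Var 83))] s3)"
        using * s3 by (cases "ce \<le> cb") (auto simp: I_def e g max_step_def)
    qed auto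
    have "det acc max_body s' (I es (max_step e g)) (4 * R + 8)"
      unfolding max_body_def by (rule det_seq[OF a det_det[OF b c]]) (use le in auto)
    then show "eval_expr s' (Var 83) \<noteq> Nul \<and> det acc max_body s' (I es (max_step e g)) (4 * R + 8)"
      using * by (simp add: I_def)
  qed (auto simp: I_def)
  have 3: "det acc [Assign 80 (Mk (Tl (Var 82)) (Var 80))] s2 (\<lambda>s'. s' 70 = enc_list (map enc_score rest) \<and> s' 80 = enc_vecs (snd b # out) \<and>
    same ({70, 80} \<union> {82..86}) s s') 1" if "I [] (b, rest) s2" for s2
    by (rule det_straight) (use that assms in \<open>auto simp: I_def enc_score_def case_prod_unfold\<close>)
  show ?thesis unfolding round_prog_def by (rule det_seq[OF 1 det_det[OF 2 3]]) auto
qed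

definition select_prog :: prog where
  "select_prog = [Assign 80 Null, Assign 81 (Var 2)] @ [While (Var 81) [Cond (Var 70) round_prog [Assign 60 Null], Assign 81 (Tl (Var 81))]]"

definition select_cost :: "nat \<Rightarrow> nat \<Rightarrow> nat \<Rightarrow> nat" where
  "select_cost t k R = 3 + t * (8 + k * (4 * R + 9))"

text \<open>The flag in register 60 and the output list are read as one optional value. Thus a
  rejection by an earlier check and a lack of candidates are treated alike.\<close>

lemma select_prog:
  assumes "s 2 = unary t" "s 70 = enc_list (map enc_score cs)" "\<forall>c\<in>set cs. fst c \<le> R" "length cs \<le> k"
  shows "det acc select_prog s (\<lambda>s'. (if s' 60 \<noteq> Nul then Some (s' 80) else None) =
      map_option enc_vecs (if s 60 \<noteq> Nul then select t cs [] else None)) (select_cost t k R)"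
proof -
  define I where "I j g s' \<longleftrightarrow> s' 81 = unary j \<and> s' 70 = enc_list (map enc_score (fst g)) \<and> s' 80 = enc_vecs (snd g) \<and>
     (\<forall>c\<in>set (fst g). fst c \<le> R) \<and> length (fst g) \<le> k \<and>
     (if s' 60 \<noteq> Nul then select j (fst g) (snd g) else None) = (if s 60 \<noteq> Nul then select t cs [] else None)" for j g and s' :: store
  define h where "h g = (case fst g of [] \<Rightarrow> g | c # cs' \<Rightarrow> (case fold max_step cs' (c, []) of (b, rest) \<Rightarrow> (rest, snd b # snd g)))"
    for g :: "(nat \<times> bit list) list \<times> bit list list"
  have 1: "det acc [Assign 80 Null, Assign 81 (Var 2)] s (I t (cs, [])) 2"
    by (rule det_straight) (use assms in \<open>auto simp: I_def\<close>)
  have 2: "det acc [While (Var 81) [Cond (Var 70) round_prog [Assign 60 Null], Assign 81 (Tl (Var 81))]] s1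
    (\<lambda>s'. (if s' 60 \<noteq> Nul then Some (s' 80) else None) =
      map_option enc_vecs (if s 60 \<noteq> Nul then select t cs [] else None)) (t * (8 + k * (4 * R + 9)) + 1)" if "I t (cs, []) s1" for s1
  proof (rule det_gloop[where I = I and m = t and h = "\<lambda>_. h", OF that])
    fix j g s' assume *: "I (Suc j) g s'"
    show "det acc [Cond (Var 70) round_prog [Assign 60 Null], Assign 81 (Tl (Var 81))] s' (I j (h g)) (7 + k * (4 * R + 9))"
    proof (cases "fst g")
      case Nil
      then have "I j (h g) (after [Cond (Var 70) [] [Assign 60 Null], Assign 81 (Tl (Var 81))] s')"
        using * by (auto simp: I_def h_def split: if_splits)
      then have "det acc [Assign 60 Null, Assign 81 (Tl (Var 81))] s' (I j (h g)) (6 + k * (4 * R + 9))"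
        using * Nil by (intro det_straight) (auto simp: I_def)
      then have "det acc ((if eval_expr s' (Var 70) \<noteq> Nul then round_prog else [Assign 60 Null]) @ [Assign 81 (Tl (Var 81))]) s' (I j (h g)) (6 + k * (4 * R + 9))"
        using * Nil by (simp add: I_def)
      from det_Cond[OF this] show ?thesis by simp
    next
      case (Cons c cs')
      obtain b rest where br: "fold max_step cs' (c, []) = (b, rest)" by fastforce
      have hg: "h g = (rest, snd b # snd g)" by (simp add: h_def Cons br)
      have st: "insert b (set rest) = set (fst g)" "length rest = length cs'"
        using max_step_set[OF br] Cons by auto
      have le: "length cs' * (4 * R + 9) \<le> k * (4 * R + 9)"
        using * Cons by (intro mult_right_mono) (auto simp: I_def)
      have "det acc (round_prog @ [Assign 81 (Tl (Var 81))]) s' (I j (h g)) (6 + k * (4 * R + 9))"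
      proof (rule det_seq, rule round_prog[where out = "snd g" and R = R, OF _ _ br])
        fix s2 assume s2: "s2 70 = enc_list (map enc_score rest) \<and> s2 80 = enc_vecs (snd b # snd g) \<and> same ({70, 80} \<union> {82..86}) s' s2"
        have sel: "select (Suc j) (fst g) (snd g) = select j rest (snd b # snd g)"
          by (simp add: Cons br)
        have fr: "\<forall>c\<in>set rest. fst c \<le> R" using * st unfolding I_def by blast
        have "I j (h g) (s2(81 := unary j))"
          using * s2 st Cons fr unfolding I_def hg sel by auto
        then show "det acc [Assign 81 (Tl (Var 81))] s2 (I j (h g)) 1"
          using * s2 by (intro det_straight) (auto simp: I_def)
      qed (use * Cons le in \<open>auto simp: I_def\<close>)
      then have "det acc ((if eval_expr s' (Var 70) \<noteq> Nul then round_prog else [Assign 60 Null]) @ [Assign 81 (Tl (Var 81))]) s' (I j (h g)) (6 + k * (4 * R + 9))"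
        using * Cons by (simp add: I_def)
      from det_Cond[OF this] show ?thesis by simp
    qed
  next
    fix g s' assume "I 0 g s'"
    then have a: "s' 80 = enc_vecs (snd g)" and b: "(if s' 60 \<noteq> Nul then Some (snd g) else None) = (if s 60 \<noteq> Nul then select t cs [] else None)"
      unfolding I_def select.simps by blast+
    show "(if s' 60 \<noteq> Nul then Some (s' 80) else None) =
      map_option enc_vecs (if s 60 \<noteq> Nul then select t cs [] else None)"
      unfolding b[symmetric] by (simp add: a)
  qed (auto simp: I_def)
  show ?thesis unfolding select_prog_def by (rule det_seq[OF 1 2]) (auto simp: select_cost_def)
qed

text \<open>Acceptance puts a \<open>Cell\<close> in front of the output list, which distinguishes
  the empty set, correct for t = 0, from rejection.\<close>

definition stage2 :: prog where
  "stage2 = check_prog @ score_prog @ leq_prog 61 62 60 @ select_prog @ [Cond (Var 60) [Assign 0 (Mk Null (Var 80))] [Assign 0 Null]]"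

definition stage2_cost :: "nat \<Rightarrow> nat \<Rightarrow> nat \<Rightarrow> nat \<Rightarrow> nat" where
  "stage2_cost n t k R = 24 * R + 4 + (score_cost n k R + (4 * (R + k * R) + 1 + (select_cost t k R + 2)))"

lemma dec_bit_enc_bit [simp]: "dec_bit (enc_bit b) = b"
  by (cases b) (auto simp: dec_bit_def)

lemma elems_enc_list [simp]: "elems (enc_list l) = l"
  by (induction l) auto

lemma dec_bits_enc_bits [simp]: "dec_bits (enc_bits m) = m"
  by (simp add: dec_bits_def enc_bits_def o_def)

lemma length_outcomes [simp]: "length (outcomes f rs m) = length rs"
  by (induction rs arbitrary: m) auto

lemma stage2:
  assumes "s 0 = enc_bits m" "s 2 = unary t" "s 11 = unary R" "s 13 = unary Q" "s 20 = enc_vecs L"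
    "s 30 = enc_list (map (enc_chall f) rs)" "\<forall>\<gamma>\<in>set L. length \<gamma> = n" "length L \<le> k" "length rs = R"
  shows "triple (examples n f) stage2 s (map_pmf (verdict t f R Q rs m) (score_all n f R L))
    (\<lambda>v s'. dec_output (s' 0) = map_option set v) (stage2_cost n t k R) (4 * k * R)"
proof -
  let ?v = "verdict t f R Q rs m"
  let ?o = "outcomes f rs m"
  have fin: "det acc [Cond (Var 60) [Assign 0 (Mk Null (Var 80))] [Assign 0 Null]] s' (\<lambda>s'. dec_output (s' 0) = map_option set v) 2"
    if "(if s' 60 \<noteq> Nul then Some (s' 80) else None) = map_option enc_vecs v" for s' v acc
    by (rule det_straight)
       (use that in \<open>cases v; auto simp: dec_output_def enc_vecs_def image_image split: if_splits\<close>)+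
  have 2: "triple (examples n f) (score_prog @ leq_prog 61 62 60 @ select_prog @ [Cond (Var 60) [Assign 0 (Mk Null (Var 80))] [Assign 0 Null]]) s1
    (map_pmf ?v (score_all n f R L)) (\<lambda>v s'. dec_output (s' 0) = map_option set v)
    (score_cost n k R + (4 * (R + k * R) + 1 + (select_cost t k R + 2))) (k * (R * 4) + 0)"
    if s1: "(s1 60 \<noteq> Nul \<longleftrightarrow> consistent f rs m) \<and> s1 61 = unary (zeros ?o) \<and> s1 62 = unary (Q + ones ?o) \<and>
      same {0, 30, 60, 61, 62, 63, 64, 65} s s1" for s1
    unfolding map_pmf_def
  proof (rule triple_append, rule score_prog[where a = "zeros ?o" and b = "Q + ones ?o" and L = L])
    fix cs s2 assume s2: "map snd cs = rev L \<and> (\<forall>(c, \<gamma>)\<in>set cs. c \<le> R) \<and> s2 61 = unary (zeros ?o + (\<Sum>(c, \<gamma>)\<leftarrow>cs. R - c)) \<and>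
       s2 62 = unary (Q + ones ?o + (\<Sum>(c, \<gamma>)\<leftarrow>cs. c)) \<and> s2 70 = enc_list (map enc_score cs) \<and> same score_regs s1 s2"
    then have "length (map snd cs) = length L" by simp
    then have lcs: "length cs \<le> k" using assms by simp
    have "(\<Sum>(c, \<gamma>)\<leftarrow>cs. R - c) \<le> length cs * R"
      by (induction cs) auto
    also have "\<dots> \<le> k * R" using lcs by (intro mult_right_mono) auto
    finally have le: "zeros ?o + (\<Sum>(c, \<gamma>)\<leftarrow>cs. R - c) \<le> R + k * R"
      using zeros_ones[of ?o] assms by simp
    let ?A = "zeros ?o + (\<Sum>(c, \<gamma>)\<leftarrow>cs. R - c)" and ?B = "Q + ones ?o + (\<Sum>(c, \<gamma>)\<leftarrow>cs. c)"
    have "det (examples n f) (leq_prog 61 62 60 @ select_prog @ [Cond (Var 60) [Assign 0 (Mk Null (Var 80))] [Assign 0 Null]]) s2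
       (\<lambda>s'. dec_output (s' 0) = map_option set (?v cs)) (4 * (R + k * R) + 1 + (select_cost t k R + 2))"
    proof (rule det_seq)
      show "det (examples n f) (leq_prog 61 62 60) s2 (\<lambda>s3. (s3 60 \<noteq> Nul \<longleftrightarrow> consistent f rs m \<and> ?A \<le> ?B) \<and>
         same {61, 62, 60} s2 s3) (4 * ?A + 1)"
        by (rule det_weaken, rule leq_prog[where i = ?A and j = ?B]) (use s1 s2 in auto)
    next
      fix s3 assume s3: "(s3 60 \<noteq> Nul \<longleftrightarrow> consistent f rs m \<and> ?A \<le> ?B) \<and> same {61, 62, 60} s2 s3"
      then have v: "?v cs = (if s3 60 \<noteq> Nul then select t cs [] else None)"
        by (simp add: verdict_def)
      show "det (examples n f) (select_prog @ [Cond (Var 60) [Assign 0 (Mk Null (Var 80))] [Assign 0 Null]]) s3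
        (\<lambda>s'. dec_output (s' 0) = map_option set (?v cs)) (select_cost t k R + 2)"
        unfolding v
        by (rule det_det, rule select_prog[where t = t and cs = cs and R = R and k = k]) (use s1 s2 s3 assms lcs fin in auto)
    qed (use le in auto)
    then show "triple (examples n f) (leq_prog 61 62 60 @ select_prog @ [Cond (Var 60) [Assign 0 (Mk Null (Var 80))] [Assign 0 Null]]) s2
       (return_pmf (?v cs)) (\<lambda>v s'. dec_output (s' 0) = map_option set v) (4 * (R + k * R) + 1 + (select_cost t k R + 2)) 0"
      by (rule det_triple)
  qed (use s1 assms in auto)
  have 1: "det (examples n f) check_prog s (\<lambda>s'. (s' 60 \<noteq> Nul \<longleftrightarrow> consistent f rs m) \<and> s' 61 = unary (zeros ?o) \<and>
    s' 62 = unary (Q + ones ?o) \<and> same {0, 30, 60, 61, 62, 63, 64, 65} s s') (24 * length rs + 4)"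
    by (rule check_prog) (use assms in auto)
  have "triple (examples n f) stage2 s (map_pmf ?v (score_all n f R L)) (\<lambda>v s'. dec_output (s' 0) = map_option set v)
    (24 * length rs + 4 + (score_cost n k R + (4 * (R + k * R) + 1 + (select_cost t k R + 2)))) (k * (R * 4) + 0)"
    unfolding stage2_def by (rule triple_det_seq[OF 1 2]) auto
  then show ?thesis
    by (rule triple_weaken) (use assms in \<open>auto simp: stage2_cost_def\<close>)
qed

definition verifier :: prog where
  "verifier = [Cond (Var 50) stage2 stage1]"

lemma verifier_stage1:
  assumes "s 0 = enc_bits m" "s 1 = unary n" "s 2 = unary t" "s 3 = unary N" "s 4 = unary D" "s 50 = Nul" and G: "G = big_g t N D"
  shows "triple (examples n f) verifier s (replicate_pmf (G ^ 64) (challenge_pmf n))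
    (\<lambda>rs s'. s' 0 = enc_bits (message (map shown rs)) \<and> s' 2 = unary t \<and> s' 11 = unary (G ^ 64) \<and> s' 13 = unary (G ^ 56) \<and>
      s' 20 = enc_vecs (parse (G ^ 16) n m []) \<and> s' 30 = enc_list (map (enc_chall f) rs) \<and> s' 50 \<noteq> Nul)
    (Suc (stage1_cost n G)) (3 * G ^ 64)"
  unfolding verifier_def by (rule triple_Cond) (use stage1[of s m n t N D G f] assms in simp)

lemma verifier_stage2:
  assumes "s 0 = enc_bits m" "s 2 = unary t" "s 11 = unary R" "s 13 = unary Q" "s 20 = enc_vecs L"
    "s 30 = enc_list (map (enc_chall f) rs)" "\<forall>\<gamma>\<in>set L. length \<gamma> = n" "length L \<le> k" "length rs = R" "s 50 \<noteq> Nul"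
  shows "triple (examples n f) verifier s (map_pmf (verdict t f R Q rs m) (score_all n f R L))
    (\<lambda>v s'. dec_output (s' 0) = map_option set v) (Suc (stage2_cost n t k R)) (4 * k * R)"
  unfolding verifier_def by (rule triple_Cond) (use stage2[OF assms(1-9)] assms in simp)

section \<open>The honest prover's program\<close>

abbreviation coin :: "bit pmf" where "coin \<equiv> pmf_of_set {0, 1}"

text \<open>The experiment of \<open>weight_expect\<close> written with coin tosses: x and y are
  independent suffixes and z is their common prefix, so the sign of the bit has the Fourier weight
  of \<alpha> as its mean.\<close>

definition stat_pmf :: "nat \<Rightarrow> (bit list \<Rightarrow> real) \<Rightarrow> bit list \<Rightarrow> bit pmf" where
  "stat_pmf r f \<alpha> = do {x \<leftarrow> replicate_pmf (length \<alpha>) coin; y \<leftarrow> replicate_pmf (length \<alpha>) coin; z \<leftarrow> replicate_pmf r coin;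
     return_pmf (inner_prod \<alpha> x + inner_prod \<alpha> y + lab f (z @ x) + lab f (z @ y))}"

text \<open>For positive \<open>M\<close> this compares the empirical mean of the signs with the
  threshold \<open>T / M\<close>.\<close>

definition test_pmf :: "nat \<Rightarrow> nat \<Rightarrow> nat \<Rightarrow> (bit list \<Rightarrow> real) \<Rightarrow> bit list \<Rightarrow> bool pmf" where
  "test_pmf M T r f \<alpha> = map_pmf (\<lambda>bs. T + ones bs \<le> zeros bs) (replicate_pmf M (stat_pmf r f \<alpha>))"

text \<open>Fewer than \<open>t\<close> entries are filled up whatever the test says: the verifier
  must be able to output \<open>t\<close> vectors even if hardly any coefficient is large.\<close>

definition extend :: "nat \<Rightarrow> nat \<Rightarrow> 'a \<Rightarrow> 'a list \<Rightarrow> bool \<Rightarrow> 'a list" where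
  "extend t k \<alpha> new b = (if length new < t \<or> (length new < k \<and> b) then \<alpha> # new else new)"

definition cand_pmf :: "nat \<Rightarrow> nat \<Rightarrow> nat \<Rightarrow> nat \<Rightarrow> nat \<Rightarrow> (bit list \<Rightarrow> real) \<Rightarrow> bit list \<Rightarrow> bit list list \<Rightarrow> bit list list pmf" where
  "cand_pmf t k M T r f \<alpha> new = map_pmf (extend t k \<alpha> new) (test_pmf M T r f \<alpha>)"

definition level_pmf :: "nat \<Rightarrow> nat \<Rightarrow> nat \<Rightarrow> nat \<Rightarrow> (bit list \<Rightarrow> real) \<Rightarrow> nat \<Rightarrow> bit list list \<Rightarrow> bit list list pmf" where
  "level_pmf t k M T f r cur = foldM (\<lambda>\<alpha>. foldM (\<lambda>b. cand_pmf t k M T r f (b # \<alpha>)) [0, 1]) cur []"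

text \<open>The level number is the number of letters still missing in front of the suffixes, from
  \<open>n - 1\<close> down to 0.\<close>

definition search_pmf :: "nat \<Rightarrow> nat \<Rightarrow> nat \<Rightarrow> nat \<Rightarrow> nat \<Rightarrow> (bit list \<Rightarrow> real) \<Rightarrow> bit list list pmf" where
  "search_pmf n t k M T f = foldM (level_pmf t k M T f) (rev [0..<n]) [[]]"

text \<open>Vectors are sent reversed because reading them with \<open>pop\<close> reverses them
  again.\<close>

definition list_message :: "bit list list \<Rightarrow> bit list" where
  "list_message cur = fold (\<lambda>\<alpha> m. rev \<alpha> @ m) cur []"

lemma triple_query:
  assumes "eval_expr s e = enc_bits v" "v \<in> cube n" "triple (queries n f) p (s(x := enc_bit (lab f v))) A R K Q"
  shows "triple (queries n f) (Ask x e # p) s A R (Suc K) (Suc Q)"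
proof -
  have "triple (queries n f) (Ask x e # p) s (bind_pmf (return_pmf ()) (\<lambda>_. A)) R (Suc K) (Suc Q)"
    by (rule triple_Ask[where h = "\<lambda>_. enc_bit (lab f v)"])
       (use assms in \<open>simp_all add: queries_def enc_label_def lab_def\<close>)
  then show ?thesis by (simp add: bind_return_pmf)
qed

lemma tl_enc_list [simp]: "sexp_tl (enc_list l) = enc_list (tl l)"
  by (cases l) auto

text \<open>With two registers in \<open>xs\<close> the same coin is pushed on both, which produces
  the common prefix of the two query points. Register 113 is consumed as a mere counter, so any list
  of the right length can drive the loop.\<close>

definition coins_prog :: "nat list \<Rightarrow> prog" where
  "coins_prog xs = [While (Var 113) (Flip 114 # map (\<lambda>x. Assign x (Mk (Var 114) (Var x))) xs @ [Assign 113 (Tl (Var 113))])]"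

lemma coins_prog:
  assumes "xs = [110] \<or> xs = [111] \<or> xs = [110, 111]"
    and "s 113 = enc_list l" "length l = k" "\<forall>x\<in>set xs. s x = enc_bits (v x)" "k \<le> n"
  shows "triple acc (coins_prog xs) s (replicate_pmf k coin)
    (\<lambda>bs s'. (\<forall>x\<in>set xs. s' x = enc_bits (bs @ v x)) \<and> same (set xs \<union> {113, 114}) s s') (5 * n + 1) 0"
proof -
  define I where "I j bs s' \<longleftrightarrow> (\<exists>l. length l = j \<and> s' 113 = enc_list l) \<and> (\<forall>x\<in>set xs. s' x = enc_bits (bs @ v x)) \<and>
     same (set xs \<union> {113, 114}) s s'" for j bs s'
  show ?thesis
    unfolding coins_prog_def
  proof (rule triple_loop[where I = I and m = k])
    show "I k [] s" using assms by (auto simp: I_def)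
  next
    fix j bs s' assume *: "I (Suc j) bs s'"
    then obtain a l' where l': "s' 113 = enc_list (a # l')" "length l' = j"
      unfolding I_def length_Suc_conv by auto
    have c: "\<forall>x\<in>set xs. s' x = enc_bits (bs @ v x)" and d: "same (set xs \<union> {113, 114}) s s'"
      using * unfolding I_def by blast+
    show "triple acc (Flip 114 # map (\<lambda>x. Assign x (Mk (Var 114) (Var x))) xs @ [Assign 113 (Tl (Var 113))]) s'
      (map_pmf (\<lambda>x. x # bs) coin) (I j) (Suc 3) 0"
      unfolding map_pmf_def
    proof (rule triple_Flip, rule det_triple, rule det_straight)
      fix b
      show "I j (b # bs) (after (map (\<lambda>x. Assign x (Mk (Var 114) (Var x))) xs @ [Assign 113 (Tl (Var 113))]) (s'(114 := enc_bit b)))"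
        using c d l' assms(1) by (auto simp: I_def intro!: exI[of _ l'])
    qed (use assms(1) in auto)
  next
    fix j bs s' assume "I (Suc j) bs s'" then show "eval_expr s' (Var 113) \<noteq> Nul" by (auto simp: I_def)
  qed (use assms(5) in \<open>auto simp: I_def\<close>)
qed

definition stat_prog :: prog where
  "stat_prog = [Assign 110 Null, Assign 113 (Var 105)] @ coins_prog [110] @ [Assign 111 Null, Assign 113 (Var 105)] @ coins_prog [111] @
     [Assign 112 Null, Assign 113 (Var 105), Assign 119 (Var 110)] @ ip_prog 119 113 112 @
     [Assign 113 (Var 105), Assign 119 (Var 111)] @ ip_prog 119 113 112 @ [Assign 113 (Var 101)] @ coins_prog [110, 111] @
     Ask 116 (Var 110) # Ask 117 (Var 111) # xorc (Var 116) 112 @ xorc (Var 117) 112"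

lemma triple_weaken':
  "triple acc p s A R K Q \<Longrightarrow> K \<le> K' \<Longrightarrow> Q \<le> Q' \<Longrightarrow> triple acc p s A R K' Q'"
  by (rule triple_weaken)

lemma stat_prog:
  assumes "s 105 = enc_bits \<alpha>" "s 101 = unary r" "r + length \<alpha> = n"
  shows "triple (queries n f) stat_prog s (stat_pmf r f \<alpha>) (\<lambda>b s'. s' 112 = enc_bit b \<and> same {110..119} s s') (29 * n + 30) 2"
proof -
  let ?k = "length \<alpha>"
  let ?W = "{110..119::nat}"
  have k: "?k \<le> n" "r \<le> n" using assms by auto
  have ul: "s 105 = enc_list (map enc_bit \<alpha>)" "s 101 = enc_list (replicate r Nul)"
    using assms by (simp_all add: enc_bits_def unary_def)
  let ?R1 = "\<lambda>s'. s' 110 = enc_bits [] \<and> s' 113 = enc_list (map enc_bit \<alpha>) \<and> same ?W s s'"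
  let ?R2 = "\<lambda>x s'. s' 110 = enc_bits x \<and> same ?W s s'"
  let ?R3 = "\<lambda>x s'. s' 110 = enc_bits x \<and> s' 111 = enc_bits [] \<and> s' 113 = enc_list (map enc_bit \<alpha>) \<and> same ?W s s'"
  let ?R4 = "\<lambda>x y s'. s' 110 = enc_bits x \<and> s' 111 = enc_bits y \<and> same ?W s s'"
  let ?R5 = "\<lambda>x y s'. ?R4 x y s' \<and> s' 112 = enc_bit 0 \<and> s' 113 = enc_bits \<alpha> \<and> s' 119 = enc_bits x"
  let ?R6 = "\<lambda>x y s'. ?R4 x y s' \<and> s' 112 = enc_bit (inner_prod \<alpha> x)"
  let ?R7 = "\<lambda>x y s'. ?R6 x y s' \<and> s' 113 = enc_bits \<alpha> \<and> s' 119 = enc_bits y"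
  let ?R8 = "\<lambda>x y s'. ?R4 x y s' \<and> s' 112 = enc_bit (inner_prod \<alpha> x + inner_prod \<alpha> y)"
  let ?R9 = "\<lambda>x y s'. ?R8 x y s' \<and> s' 113 = enc_list (replicate r Nul)"
  let ?R10 = "\<lambda>x y z s'. s' 110 = enc_bits (z @ x) \<and> s' 111 = enc_bits (z @ y) \<and> s' 112 = enc_bit (inner_prod \<alpha> x + inner_prod \<alpha> y) \<and> same ?W s s'"
  let ?fin = "\<lambda>b s'. s' 112 = enc_bit b \<and> same ?W s s'"
  let ?b = "\<lambda>x y z. inner_prod \<alpha> x + inner_prod \<alpha> y + lab f (z @ x) + lab f (z @ y)"
  note acc = queries_def
  have s1: "det (queries n f) [Assign 110 Null, Assign 113 (Var 105)] s ?R1 2"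
    by (rule det_straight) (use ul in auto)
  have s2: "triple (queries n f) (coins_prog [110]) s1 (replicate_pmf ?k coin) ?R2 (5 * n + 1) 0" if "?R1 s1" for s1
    by (rule triple_weaken, rule coins_prog[where l = "map enc_bit \<alpha>" and v = "\<lambda>_. []" and n = n]) (use that k in auto)
  have s3: "det (queries n f) [Assign 111 Null, Assign 113 (Var 105)] s1 (?R3 x) 2" if "?R2 x s1" for s1 x
    by (rule det_straight) (use that ul in auto)
  have s4: "triple (queries n f) (coins_prog [111]) s1 (replicate_pmf ?k coin) (?R4 x) (5 * n + 1) 0" if "?R3 x s1" for s1 x
    by (rule triple_weaken, rule coins_prog[where l = "map enc_bit \<alpha>" and v = "\<lambda>_. []" and n = n]) (use that k in auto)
  have s5: "det (queries n f) [Assign 112 Null, Assign 113 (Var 105), Assign 119 (Var 110)] s1 (?R5 x y) 3" if "?R4 x y s1" for s1 x y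
    by (rule det_straight) (use that assms in auto)
  have s6: "det (queries n f) (ip_prog 119 113 112) s1 (?R6 x y) (7 * n + 1)" if "?R5 x y s1" "length x = ?k" for s1 x y
    by (rule det_weaken, rule ip_prog[where v = x and \<gamma> = \<alpha> and b = 0]) (use that k in auto)
  have s7: "det (queries n f) [Assign 113 (Var 105), Assign 119 (Var 111)] s1 (?R7 x y) 2" if "?R6 x y s1" for s1 x y
    by (rule det_straight) (use that assms in auto)
  have s8: "det (queries n f) (ip_prog 119 113 112) s1 (?R8 x y) (7 * n + 1)" if "?R7 x y s1" "length y = ?k" for s1 x y
    by (rule det_weaken, rule ip_prog[where v = y and \<gamma> = \<alpha> and b = "inner_prod \<alpha> x"]) (use that k in auto)
  have s9: "det (queries n f) [Assign 113 (Var 101)] s1 (?R9 x y) 1" if "?R8 x y s1" for s1 x y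
    by (rule det_straight) (use that ul in auto)
  have s10: "triple (queries n f) (coins_prog [110, 111]) s1 (replicate_pmf r coin) (?R10 x y) (5 * n + 1) 0" if "?R9 x y s1" for s1 x y
    by (rule triple_weaken, rule coins_prog[where l = "replicate r Nul" and v = "\<lambda>i. if i = 110 then x else y" and n = n]) (use that k in auto)
  have s11: "triple (queries n f) (Ask 116 (Var 110) # Ask 117 (Var 111) # xorc (Var 116) 112 @ xorc (Var 117) 112) s1
     (return_pmf (?b x y z)) ?fin (Suc (Suc 6)) (Suc (Suc 0))"
    if "?R10 x y z s1" "length x = ?k" "length y = ?k" "length z = r" for s1 x y z
  proof -
    let ?s = "s1(116 := enc_bit (lab f (z @ x)), 117 := enc_bit (lab f (z @ y)))"
    have a: "after (xorc (Var 116) 112 @ xorc (Var 117) 112 @ []) ?s = ?s(112 := enc_bit (?b x y z))"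
      using that by (simp add: after_xorc[where a = "lab f (z @ x)" and b = "inner_prod \<alpha> x + inner_prod \<alpha> y"]
         after_xorc[where a = "lab f (z @ y)" and b = "inner_prod \<alpha> x + inner_prod \<alpha> y + lab f (z @ x)"] del: append_Nil2)
    have "triple (queries n f) (xorc (Var 116) 112 @ xorc (Var 117) 112) ?s (return_pmf (?b x y z)) ?fin 6 0"
      using a that by (intro det_triple det_straight) (auto simp: cost_append)
    then show ?thesis
      using that assms by (intro triple_query[where v = "z @ x"] triple_query[where v = "z @ y"]) (auto simp: cube_def)
  qed
  have len: "bs \<in> set_pmf (replicate_pmf m p) \<Longrightarrow> length bs = m" for bs m and p :: "bit pmf"
    by (simp add: set_replicate_pmf)
  have t10: "triple (queries n f) (coins_prog [110, 111] @ Ask 116 (Var 110) # Ask 117 (Var 111) # xorc (Var 116) 112 @ xorc (Var 117) 112) s1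
     (replicate_pmf r coin \<bind> (\<lambda>z. return_pmf (?b x y z))) ?fin (5 * n + 9) 2"
    if "?R9 x y s1" "length x = ?k" "length y = ?k" for s1 x y
    by (rule triple_weaken'[OF triple_append[OF s10[OF that(1)] s11]]) (use that len in auto)
  note [simp del] = append_assoc append_Cons append_Nil
  show ?thesis
    unfolding stat_prog_def stat_pmf_def
    apply (rule triple_weaken')
      apply (rule triple_det[OF s1], rule triple_append[OF s2], assumption)
      apply (drule len)
      apply (rule triple_det[OF s3], assumption, rule triple_append[OF s4], assumption)
      apply (drule len)
      apply (rule triple_det[OF s5], assumption, rule triple_det[OF s6], assumption, assumption, rule triple_det[OF s7], assumption,
        rule triple_det[OF s8], assumption, assumption, rule triple_det[OF s9], assumption, rule t10, assumption, assumption, assumption)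
     apply simp_all
    done
qed

definition test_prog :: prog where
  "test_prog = [Assign 107 Null, Assign 108 (Var 15), Assign 109 (Var 18)] @
    [While (Var 109) (stat_prog @ [Cond (Var 112) [Assign 108 (Mk Null (Var 108))] [Assign 107 (Mk Null (Var 107))], Assign 109 (Tl (Var 109))])] @
    [Assign 118 one] @ leq_prog 108 107 118"

definition test_cost :: "nat \<Rightarrow> nat \<Rightarrow> nat \<Rightarrow> nat" where
  "test_cost n M T = 6 + M * (29 * n + 34) + 4 * (T + M)"

lemma test_prog:
  assumes "s 105 = enc_bits \<alpha>" "s 101 = unary r" "r + length \<alpha> = n" "s 15 = unary T" "s 18 = unary M"
  shows "triple (queries n f) test_prog s (test_pmf M T r f \<alpha>) (\<lambda>b s'. (s' 118 \<noteq> Nul \<longleftrightarrow> b) \<and> same {107..119} s s')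
    (test_cost n M T) (2 * M)"
proof -
  define I where "I j bs s' \<longleftrightarrow> length bs + j = M \<and> s' 109 = unary j \<and> s' 107 = unary (zeros bs) \<and> s' 108 = unary (T + ones bs) \<and>
    same {107..119} s s'" for j bs s'
  let ?rest = "[Cond (Var 112) [Assign 108 (Mk Null (Var 108))] [Assign 107 (Mk Null (Var 107))], Assign 109 (Tl (Var 109))]"
  have 1: "det (queries n f) [Assign 107 Null, Assign 108 (Var 15), Assign 109 (Var 18)] s (I M []) 3"
    by (rule det_straight) (use assms in \<open>auto simp: I_def\<close>)
  have 2: "triple (queries n f) [While (Var 109) (stat_prog @ ?rest)] s1 (replicate_pmf M (stat_pmf r f \<alpha>)) (I 0)
    (M * (29 * n + 34) + 1) (2 * M)" if "I M [] s1" for s1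
  proof (rule triple_loop[where I = I and m = M, OF that])
    fix j bs s' assume *: "I (Suc j) bs s'"
    show "triple (queries n f) (stat_prog @ ?rest) s' (map_pmf (\<lambda>x. x # bs) (stat_pmf r f \<alpha>)) (I j) (29 * n + 30 + 3) (2 + 0)"
      unfolding map_pmf_def
    proof (rule triple_append, rule stat_prog)
      fix c s'' assume s'': "s'' 112 = enc_bit c \<and> same {110..119} s' s''"
      have "I j (c # bs) (after ?rest s'')" using * s'' by (cases c) (auto simp: I_def)
      then show "triple (queries n f) ?rest s'' (return_pmf (c # bs)) (I j) 3 0"
        by (intro det_triple det_straight) auto
    qed (use * assms in \<open>auto simp: I_def\<close>)
  qed (auto simp: I_def)
  let ?R = "\<lambda>b s'. (s' 118 \<noteq> Nul \<longleftrightarrow> b) \<and> same {107..119} s s'"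
  have 3: "triple (queries n f) ([Assign 118 one] @ leq_prog 108 107 118) s1 (return_pmf (T + ones bs \<le> zeros bs)) ?R (1 + (4 * (T + M) + 1)) 0"
    if "I 0 bs s1" for s1 bs
  proof (rule det_triple)
    have a: "det (queries n f) [Assign 118 one] s1 (\<lambda>s2. I 0 bs s2 \<and> s2 118 \<noteq> Nul) 1"
      by (rule det_straight) (use that in \<open>auto simp: I_def\<close>)
    have b: "det (queries n f) (leq_prog 108 107 118) s2 (?R (T + ones bs \<le> zeros bs)) (4 * (T + M) + 1)"
      if "I 0 bs s2 \<and> s2 118 \<noteq> Nul" for s2
      by (rule det_weaken, rule leq_prog[where i = "T + ones bs" and j = "zeros bs"])
         (use that zeros_ones[of bs] in \<open>auto simp: I_def\<close>)
    show "det (queries n f) ([Assign 118 one] @ leq_prog 108 107 118) s1 (?R (T + ones bs \<le> zeros bs)) (1 + (4 * (T + M) + 1))"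
      by (rule det_det[OF a b])
  qed
  have "triple (queries n f) test_prog s (test_pmf M T r f \<alpha>) ?R
    (3 + (M * (29 * n + 34) + 1 + (1 + (4 * (T + M) + 1)))) (2 * M + 0)"
    unfolding test_prog_def test_pmf_def map_pmf_def by (rule triple_det[OF 1], rule triple_append[OF 2], assumption, rule 3, assumption)
  then show ?thesis by (rule triple_weaken') (auto simp: test_cost_def)
qed

section \<open>The levels of the search\<close>

definition cand_prog :: prog where
  "cand_prog = [Assign 105 (Mk (Hd (Var 106)) (Hd (Var 100)))] @ test_prog @
    [Cond (Var 103) [Assign 118 one] [Cond (Var 104) [] [Assign 118 Null]],
     Cond (Var 118) [Assign 102 (Mk (Var 105) (Var 102)), Assign 103 (Tl (Var 103)), Assign 104 (Tl (Var 104))] []]"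

text \<open>Registers 103 and 104 count down the places left up to \<open>t\<close> and up to
  \<open>k\<close>, so that the length comparisons in \<open>extend\<close> become tests for
  \<open>Nul\<close>.\<close>

definition holds_new :: "nat \<Rightarrow> nat \<Rightarrow> bit list list \<Rightarrow> store \<Rightarrow> bool" where
  "holds_new t k new s \<longleftrightarrow> s 102 = enc_vecs new \<and> s 103 = unary (t - length new) \<and> s 104 = unary (k - length new)"

abbreviation "cand_regs \<equiv> {102..105} \<union> {107..119::nat}"

lemma cand_prog:
  assumes "sexp_hd (s 106) = enc_bit b" "sexp_hd (s 100) = enc_bits \<alpha>" "s 101 = unary r" "Suc (r + length \<alpha>) = n"
    "s 15 = unary T" "s 18 = unary M" "holds_new t k new s"
  shows "triple (queries n f) cand_prog s (cand_pmf t k M T r f (b # \<alpha>) new)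
    (\<lambda>new' s'. holds_new t k new' s' \<and> same cand_regs s s') (test_cost n M T + 8) (2 * M)"
proof -
  let ?rest = "[Cond (Var 103) [Assign 118 one] [Cond (Var 104) [] [Assign 118 Null]],
     Cond (Var 118) [Assign 102 (Mk (Var 105) (Var 102)), Assign 103 (Tl (Var 103)), Assign 104 (Tl (Var 104))] []]"
  have 1: "det (queries n f) [Assign 105 (Mk (Hd (Var 106)) (Hd (Var 100)))] s
    (\<lambda>s'. s' 105 = enc_bits (b # \<alpha>) \<and> same {105} s s') 1"
    by (rule det_straight) (use assms in auto)
  have 2: "triple (queries n f) test_prog s1 (test_pmf M T r f (b # \<alpha>))
     (\<lambda>c s'. (s' 118 \<noteq> Nul \<longleftrightarrow> c) \<and> s' 105 = enc_bits (b # \<alpha>) \<and> same ({105} \<union> {107..119}) s s') (test_cost n M T) (2 * M)"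
    if "s1 105 = enc_bits (b # \<alpha>) \<and> same {105} s s1" for s1
    by (rule triple_weaken, rule test_prog) (use that assms in auto)
  have 3: "triple (queries n f) ?rest s2 (return_pmf (extend t k (b # \<alpha>) new c))
     (\<lambda>new' s'. holds_new t k new' s' \<and> same cand_regs s s') 7 0"
    if s2: "(s2 118 \<noteq> Nul \<longleftrightarrow> c) \<and> s2 105 = enc_bits (b # \<alpha>) \<and> same ({105} \<union> {107..119}) s s2" for s2 c
  proof (intro det_triple det_straight)
    show "holds_new t k (extend t k (b # \<alpha>) new c) (after ?rest s2) \<and> same cand_regs s (after ?rest s2)"
      using s2 assms by (cases "length new < t"; cases "length new < k"; cases c) (auto simp: holds_new_def extend_def)
  qed auto
  have "triple (queries n f) cand_prog s (cand_pmf t k M T r f (b # \<alpha>) new)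
    (\<lambda>new' s'. holds_new t k new' s' \<and> same cand_regs s s') (1 + (test_cost n M T + 7)) (2 * M + 0)"
    unfolding cand_prog_def cand_pmf_def map_pmf_def by (rule triple_det[OF 1], rule triple_append[OF 2], assumption, rule 3, assumption)
  then show ?thesis by (rule triple_weaken') auto
qed

definition node_prog :: prog where
  "node_prog = [Assign 106 (Mk Null (Mk one Null))] @ [While (Var 106) (cand_prog @ [Assign 106 (Tl (Var 106))])] @ [Assign 100 (Tl (Var 100))]"

abbreviation "node_regs \<equiv> {100} \<union> {102..119::nat}"

lemma node_prog:
  assumes "s 100 = enc_vecs (\<alpha> # cur)" "s 101 = unary r" "Suc (r + length \<alpha>) = n"
    "s 15 = unary T" "s 18 = unary M" "holds_new t k new s"
  shows "triple (queries n f) node_prog s (foldM (\<lambda>b. cand_pmf t k M T r f (b # \<alpha>)) [0, 1] new)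
    (\<lambda>new' s'. holds_new t k new' s' \<and> s' 100 = enc_vecs cur \<and> same node_regs s s') (2 * test_cost n M T + 23) (4 * M)"
proof -
  define I where "I es new' s' \<longleftrightarrow> s' 106 = enc_bits es \<and> holds_new t k new' s' \<and> same ({102..119}) s s'" for es new' s'
  let ?A = "foldM (\<lambda>b. cand_pmf t k M T r f (b # \<alpha>)) [0, 1] new"
  have 1: "det (queries n f) [Assign 106 (Mk Null (Mk one Null))] s (I [0, 1] new) 1"
    by (rule det_straight) (use assms in \<open>auto simp: I_def holds_new_def\<close>)
  have 2: "triple (queries n f) [While (Var 106) (cand_prog @ [Assign 106 (Tl (Var 106))])] s1 ?A (I [])
     (length [0 :: bit, 1] * Suc (test_cost n M T + 8 + 1) + 1) (length [0 :: bit, 1] * (2 * M + 0))" if "I [0, 1] new s1" for s1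
  proof (rule triple_foldM[where I = I, OF that])
    fix e es new' s' assume *: "I (e # es) new' s'"
    have "triple (queries n f) (cand_prog @ [Assign 106 (Tl (Var 106))]) s'
       (bind_pmf (cand_pmf t k M T r f (e # \<alpha>) new') return_pmf) (I es) (test_cost n M T + 8 + 1) (2 * M + 0)"
    proof (rule triple_append, rule cand_prog)
      fix new'' s'' assume "holds_new t k new'' s'' \<and> same cand_regs s' s''"
      then show "triple (queries n f) [Assign 106 (Tl (Var 106))] s'' (return_pmf new'') (I es) 1 0"
        using * by (intro det_triple det_straight) (auto simp: I_def holds_new_def)
    qed (use * assms in \<open>auto simp: I_def\<close>)
    then show "eval_expr s' (Var 106) \<noteq> Nul \<and> triple (queries n f) (cand_prog @ [Assign 106 (Tl (Var 106))]) s'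
       (cand_pmf t k M T r f (e # \<alpha>) new') (I es) (test_cost n M T + 8 + 1) (2 * M + 0)"
      using * by (simp add: I_def bind_return_pmf')
  qed (auto simp: I_def)
  have 3: "triple (queries n f) [Assign 100 (Tl (Var 100))] s1 (return_pmf new')
     (\<lambda>new' s'. holds_new t k new' s' \<and> s' 100 = enc_vecs cur \<and> same node_regs s s') 1 0" if "I [] new' s1" for s1 new'
    by (intro det_triple det_straight) (use that assms in \<open>auto simp: I_def holds_new_def\<close>)
  have "triple (queries n f) node_prog s (bind_pmf ?A return_pmf)
    (\<lambda>new' s'. holds_new t k new' s' \<and> s' 100 = enc_vecs cur \<and> same node_regs s s')
    (1 + (length [0 :: bit, 1] * Suc (test_cost n M T + 8 + 1) + 1 + 1)) (length [0 :: bit, 1] * (2 * M + 0) + 0)"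
    unfolding node_prog_def by (rule triple_det[OF 1], rule triple_append[OF 2], assumption, rule 3, assumption)
  then show ?thesis unfolding bind_return_pmf' by (rule triple_weaken') auto
qed

definition level_prog :: prog where
  "level_prog = [Assign 101 (Tl (Var 101)), Assign 102 Null, Assign 103 (Var 2), Assign 104 (Var 9)] @
     [While (Var 100) node_prog] @ [Assign 100 (Var 102)]"

definition level_cost :: "nat \<Rightarrow> nat \<Rightarrow> nat \<Rightarrow> nat \<Rightarrow> nat" where
  "level_cost n k M T = 6 + k * (24 + 2 * test_cost n M T)"

lemma level_prog:
  assumes "s 100 = enc_vecs cur" "s 101 = unary (Suc r)" "\<forall>\<alpha>\<in>set cur. Suc (r + length \<alpha>) = n" "length cur \<le> k"
    "s 2 = unary t" "s 9 = unary k" "s 15 = unary T" "s 18 = unary M"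
  shows "triple (queries n f) level_prog s (level_pmf t k M T f r cur)
    (\<lambda>cur' s'. s' 100 = enc_vecs cur' \<and> s' 101 = unary r \<and> same {100..119} s s') (level_cost n k M T) (k * (4 * M))"
proof -
  define I where "I es new s' \<longleftrightarrow> s' 100 = enc_vecs es \<and> s' 101 = unary r \<and> (\<forall>\<alpha>\<in>set es. Suc (r + length \<alpha>) = n) \<and>
    holds_new t k new s' \<and> same {100..119} s s'" for es new s'
  have 1: "det (queries n f) [Assign 101 (Tl (Var 101)), Assign 102 Null, Assign 103 (Var 2), Assign 104 (Var 9)] s (I cur []) 4"
    by (rule det_straight) (use assms in \<open>auto simp: I_def holds_new_def\<close>)
  have 2: "triple (queries n f) [While (Var 100) node_prog] s1 (level_pmf t k M T f r cur) (I [])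
     (length cur * Suc (2 * test_cost n M T + 23) + 1) (length cur * (4 * M))" if "I cur [] s1" for s1
    unfolding level_pmf_def
  proof (rule triple_foldM[where I = I, OF that])
    fix \<alpha> es new s' assume *: "I (\<alpha> # es) new s'"
    have "triple (queries n f) node_prog s' (foldM (\<lambda>b. cand_pmf t k M T r f (b # \<alpha>)) [0, 1] new) (I es) (2 * test_cost n M T + 23) (4 * M)"
      by (rule triple_weaken, rule node_prog[where cur = es]) (use * assms in \<open>auto simp: I_def\<close>)
    then show "eval_expr s' (Var 100) \<noteq> Nul \<and> triple (queries n f) node_prog s' (foldM (\<lambda>b. cand_pmf t k M T r f (b # \<alpha>)) [0, 1] new) (I es)
       (2 * test_cost n M T + 23) (4 * M)" using * by (simp add: I_def)
  qed (auto simp: I_def)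
  have 3: "triple (queries n f) [Assign 100 (Var 102)] s1 (return_pmf new)
     (\<lambda>cur' s'. s' 100 = enc_vecs cur' \<and> s' 101 = unary r \<and> same {100..119} s s') 1 0" if "I [] new s1" for s1 new
    by (intro det_triple det_straight) (use that in \<open>auto simp: I_def holds_new_def\<close>)
  have le: "length cur * c \<le> k * c" for c using assms(4) by (intro mult_right_mono) auto
  have "triple (queries n f) level_prog s (bind_pmf (level_pmf t k M T f r cur) return_pmf)
    (\<lambda>cur' s'. s' 100 = enc_vecs cur' \<and> s' 101 = unary r \<and> same {100..119} s s')
    (4 + (length cur * Suc (2 * test_cost n M T + 23) + 1 + 1)) (length cur * (4 * M) + 0)"
    unfolding level_prog_def by (rule triple_det[OF 1], rule triple_append[OF 2], assumption, rule 3, assumption)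
  then show ?thesis unfolding bind_return_pmf' by (rule triple_weaken') (use le[of "24 + 2 * test_cost n M T"] le[of "4 * M"] in \<open>auto simp: level_cost_def\<close>)
qed

lemma foldM_invariant:
  assumes "a' \<in> set_pmf (foldM B es a)" "P a" "\<And>e a a'. e \<in> set es \<Longrightarrow> P a \<Longrightarrow> a' \<in> set_pmf (B e a) \<Longrightarrow> P a'"
  shows "P a'"
  using assms
proof (induction es arbitrary: a)
  case (Cons e es)
  obtain a1 where a1: "a1 \<in> set_pmf (B e a)" "a' \<in> set_pmf (foldM B es a1)" using Cons.prems(1) by auto
  show ?case by (rule Cons.IH[OF a1(2)]) (use Cons.prems a1 in auto)
qed simp

text \<open>The cap on the length holds on every run and not only with high probability, as a
  worst-case bound on the prover's running time demands. Padding respects it because t \<le>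
  k.\<close>

lemma set_level_pmf:
  assumes "cur' \<in> set_pmf (level_pmf t k M T f r cur)" "t \<le> k" "\<forall>\<alpha>\<in>set cur. length \<alpha> = l"
  shows "length cur' \<le> k \<and> (\<forall>\<alpha>\<in>set cur'. length \<alpha> = Suc l)"
proof (rule foldM_invariant[OF assms(1)[unfolded level_pmf_def]])
  fix \<alpha> new new' assume \<alpha>: "\<alpha> \<in> set cur" and new: "length new \<le> k \<and> (\<forall>\<alpha>\<in>set new. length \<alpha> = Suc l)"
    and "new' \<in> set_pmf (foldM (\<lambda>b. cand_pmf t k M T r f (b # \<alpha>)) [0, 1] new)"
  from this(3,2) show "length new' \<le> k \<and> (\<forall>\<alpha>\<in>set new'. length \<alpha> = Suc l)"
    by (rule foldM_invariant) (use \<alpha> assms in \<open>auto simp: cand_pmf_def extend_def split: if_splits\<close>)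
qed auto

definition search_prog :: prog where
  "search_prog = [Assign 100 (Mk Null Null), Assign 101 (Var 1)] @ [While (Var 101) level_prog]"

definition search_cost :: "nat \<Rightarrow> nat \<Rightarrow> nat \<Rightarrow> nat \<Rightarrow> nat" where
  "search_cost n k M T = 3 + n * (level_cost n k M T + 1)"

lemma search_prog:
  assumes "s 1 = unary n" "s 2 = unary t" "s 9 = unary k" "s 15 = unary T" "s 18 = unary M" "t \<le> k" "1 \<le> k"
  shows "triple (queries n f) search_prog s (search_pmf n t k M T f)
    (\<lambda>cur s'. s' 100 = enc_vecs cur \<and> length cur \<le> k \<and> (\<forall>\<alpha>\<in>set cur. length \<alpha> = n) \<and> same {100..119} s s') (search_cost n k M T) (n * (k * (4 * M)))"
proof -
  define I where "I es cur s' \<longleftrightarrow> es = rev [0..<length es] \<and> length es \<le> n \<and> s' 100 = enc_vecs cur \<and> s' 101 = unary (length es) \<and>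
    length cur \<le> k \<and> (\<forall>\<alpha>\<in>set cur. length \<alpha> = n - length es) \<and> same {100..119} s s'" for es cur s'
  have 1: "det (queries n f) [Assign 100 (Mk Null Null), Assign 101 (Var 1)] s (I (rev [0..<n]) [[]]) 2"
    by (rule det_straight) (use assms in \<open>auto simp: I_def\<close>)
  have 2: "triple (queries n f) [While (Var 101) level_prog] s1 (search_pmf n t k M T f) (I [])
     (length (rev [0..<n]) * Suc (level_cost n k M T) + 1) (length (rev [0..<n]) * (k * (4 * M)))" if "I (rev [0..<n]) [[]] s1" for s1
    unfolding search_pmf_def
  proof (rule triple_foldM[where I = I, OF that])
    fix r es cur s' assume *: "I (r # es) cur s'"
    then have r: "r = length es" "es = rev [0..<length es]" "length es < n" by (auto simp: I_def)
    have "triple (queries n f) level_prog s' (level_pmf t k M T f r cur) (I es) (level_cost n k M T) (k * (4 * M))"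
    proof (rule triple_weaken, rule level_prog)
      fix cur' s'' assume c: "cur' \<in> set_pmf (level_pmf t k M T f r cur)" and
        s'': "s'' 100 = enc_vecs cur' \<and> s'' 101 = unary r \<and> same {100..119} s' s''"
      have "length cur' \<le> k \<and> (\<forall>\<alpha>\<in>set cur'. length \<alpha> = Suc (n - length (r # es)))"
        by (rule set_level_pmf[OF c assms(6)]) (use * in \<open>auto simp: I_def\<close>)
      moreover have "Suc (n - length (r # es)) = n - length es" using r by simp
      ultimately show "I es cur' s''" using * s'' r by (auto simp: I_def)
    qed (use * r assms in \<open>auto simp: I_def\<close>)
    then show "eval_expr s' (Var 101) \<noteq> Nul \<and> triple (queries n f) level_prog s' (level_pmf t k M T f r cur) (I es) (level_cost n k M T) (k * (4 * M))"
      using * by (simp add: I_def)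
  qed (auto simp: I_def)
  have "triple (queries n f) search_prog s (search_pmf n t k M T f) (I [])
     (2 + (length (rev [0..<n]) * Suc (level_cost n k M T) + 1)) (length (rev [0..<n]) * (k * (4 * M)))"
    unfolding search_prog_def by (rule triple_det[OF 1 2])
  then show ?thesis by (rule triple_weaken) (auto simp: I_def search_cost_def)
qed

section \<open>Messages of the honest prover\<close>

definition message_prog :: prog where
  "message_prog = [Assign 0 Null] @ [While (Var 100) ([Assign 105 (Hd (Var 100))] @
     [While (Var 105) [Assign 0 (Mk (Hd (Var 105)) (Var 0)), Assign 105 (Tl (Var 105))]] @ [Assign 100 (Tl (Var 100))])]"

lemma push_loop:
  assumes "s x = enc_bits v" "s 0 = enc_bits m" "x \<noteq> 0"
  shows "det acc [While (Var x) [Assign 0 (Mk (Hd (Var x)) (Var 0)), Assign x (Tl (Var x))]] s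
     (\<lambda>s'. s' 0 = enc_bits (rev v @ m) \<and> same {0, x} s s') (3 * length v + 1)"
proof -
  define I where "I j g s' \<longleftrightarrow> length (fst g) = j \<and> s' x = enc_bits (fst g) \<and> s' 0 = enc_bits (snd g) \<and>
     rev (fst g) @ snd g = rev v @ m \<and> same {0, x} s s'" for j g s'
  show ?thesis
  proof (rule det_gloop[where I = I and m = "length v" and g = "(v, m)"])
    fix j g s' assume *: "I (Suc j) g s'"
    obtain a v' m' where g: "g = (a # v', m')" using * unfolding I_def by (cases g; cases "fst g") auto
    have "I j (v', a # m') (after [Assign 0 (Mk (Hd (Var x)) (Var 0)), Assign x (Tl (Var x))] s')"
      using * assms(3) unfolding g by (auto simp: I_def bhd_def)
    then show "det acc [Assign 0 (Mk (Hd (Var x)) (Var 0)), Assign x (Tl (Var x))] s' (I j (tl (fst g), hd (fst g) # snd g)) 2"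
      by (intro det_straight) (auto simp: g)
  next
    show "I (length v) (v, m) s" using assms by (auto simp: I_def)
  qed (auto simp: I_def)
qed

lemma message_prog:
  assumes "s 100 = enc_vecs cur" "\<forall>\<alpha>\<in>set cur. length \<alpha> = n" "length cur \<le> k"
  shows "det acc message_prog s (\<lambda>s'. s' 0 = enc_bits (list_message cur) \<and> same {0, 100, 105} s s') (2 + k * (3 * n + 4))"
proof -
  define I where "I es m s' \<longleftrightarrow> s' 100 = enc_vecs es \<and> s' 0 = enc_bits m \<and> set es \<subseteq> set cur \<and> same {0, 100, 105} s s'" for es m s'
  let ?loop = "[While (Var 105) [Assign 0 (Mk (Hd (Var 105)) (Var 0)), Assign 105 (Tl (Var 105))]]"
  have 1: "det acc [Assign 0 Null] s (I cur []) 1"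
    by (rule det_straight) (use assms in \<open>auto simp: I_def\<close>)
  have 2: "det acc [While (Var 100) ([Assign 105 (Hd (Var 100))] @ ?loop @ [Assign 100 (Tl (Var 100))])] s1
     (I [] (list_message cur)) (length cur * Suc (3 * n + 3) + 1)" if "I cur [] s1" for s1
    unfolding list_message_def
  proof (rule det_fold[where I = I, OF that])
    fix \<alpha> es m s' assume *: "I (\<alpha> # es) m s'"
    then have len: "length \<alpha> = n" using assms by (auto simp: I_def)
    have a: "det acc [Assign 105 (Hd (Var 100))] s' (\<lambda>s2. s2 105 = enc_bits \<alpha> \<and> same {105} s' s2) 1"
      by (rule det_straight) (use * in \<open>auto simp: I_def\<close>)
    have b: "det acc ?loop s2 (\<lambda>s3. s3 0 = enc_bits (rev \<alpha> @ m) \<and> same {0, 105} s' s3) (3 * n + 1)"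
      if "s2 105 = enc_bits \<alpha> \<and> same {105} s' s2" for s2
      by (rule det_weaken, rule push_loop[where v = \<alpha> and m = m]) (use that * len in \<open>auto simp: I_def\<close>)
    have c: "det acc [Assign 100 (Tl (Var 100))] s3 (I es (rev \<alpha> @ m)) 1"
      if "s3 0 = enc_bits (rev \<alpha> @ m) \<and> same {0, 105} s' s3" for s3
      by (rule det_straight) (use that * in \<open>auto simp: I_def\<close>)
    have "det acc ([Assign 105 (Hd (Var 100))] @ ?loop @ [Assign 100 (Tl (Var 100))]) s' (I es (rev \<alpha> @ m)) (3 * n + 3)"
      by (rule det_seq[OF a det_det[OF b c]]) auto
    then show "eval_expr s' (Var 100) \<noteq> Nul \<and>
      det acc ([Assign 105 (Hd (Var 100))] @ ?loop @ [Assign 100 (Tl (Var 100))]) s' (I es (rev \<alpha> @ m)) (3 * n + 3)"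
      using * by (simp add: I_def)
  qed (auto simp: I_def)
  have "length cur * Suc (3 * n + 3) \<le> k * Suc (3 * n + 3)" using assms(3) by (intro mult_right_mono) auto
  then have le: "1 + (length cur * Suc (3 * n + 3) + 1) \<le> 2 + k * (3 * n + 4)" by (simp add: add.commute)
  show ?thesis
    unfolding message_prog_def by (rule det_weaken, rule det_det[OF 1 2], assumption) (use le in \<open>auto simp: I_def\<close>)
qed

definition pstage1 :: prog where
  "pstage1 = params @ search_prog @ message_prog @ [Assign 50 one]"

definition pstage1_cost :: "nat \<Rightarrow> nat \<Rightarrow> nat" where
  "pstage1_cost n G = params_cost n G + (search_cost n (G ^ 16) (G ^ 28 * (n + G)) (G ^ 16 * (n + G)) + (2 + G ^ 16 * (3 * n + 4) + 1))"

lemma pstage1: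
  assumes s: "s 1 = unary n" "s 2 = unary t" "s 3 = unary N" "s 4 = unary D" and G: "G = big_g t N D"
  shows "\<exists>q. triple (queries n f) pstage1 s (search_pmf n t (G ^ 16) (G ^ 28 * (n + G)) (G ^ 16 * (n + G)) f)
    (\<lambda>cur s'. s' 0 = enc_bits (list_message cur) \<and> length cur \<le> G ^ 16 \<and> (\<forall>\<alpha>\<in>set cur. length \<alpha> = n) \<and> s' 1 = unary n \<and> s' 50 \<noteq> Nul)
    (pstage1_cost n G) q"
proof -
  let ?k = "G ^ 16" and ?M = "G ^ 28 * (n + G)" and ?T = "G ^ 16 * (n + G)"
  let ?R = "\<lambda>cur s'. s' 0 = enc_bits (list_message cur) \<and> length cur \<le> ?k \<and> (\<forall>\<alpha>\<in>set cur. length \<alpha> = n) \<and> s' 1 = unary n \<and> s' 50 \<noteq> Nul"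
  have G1: "G \<ge> 1" "t \<le> G" using G by (auto simp: big_g_def)
  then have tk: "t \<le> ?k" "1 \<le> ?k" using self_le_power[of G 16] by auto
  note 1 = params[of s n t N D G "queries n f", OF s G]
  have 2: "triple (queries n f) (search_prog @ message_prog @ [Assign 50 one]) s1 (search_pmf n t ?k ?M ?T f) ?R
     (search_cost n ?k ?M ?T + (2 + ?k * (3 * n + 4) + 1)) (n * (?k * (4 * ?M)))"
    if s1: "s1 9 = unary (G ^ 16) \<and> s1 11 = unary (G ^ 64) \<and> s1 13 = unary (G ^ 56) \<and>
    s1 15 = unary (G ^ 16 * (n + G)) \<and> s1 18 = unary (G ^ 28 * (n + G)) \<and> same ({5..18} \<union> {98, 99}) s s1" for s1
  proof -
    have 3: "triple (queries n f) search_prog s1 (search_pmf n t ?k ?M ?T f)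
      (\<lambda>cur s'. s' 100 = enc_vecs cur \<and> length cur \<le> ?k \<and> (\<forall>\<alpha>\<in>set cur. length \<alpha> = n) \<and> same {100..119} s1 s') (search_cost n ?k ?M ?T) (n * (?k * (4 * ?M)))"
      by (rule search_prog) (use s1 s tk in simp_all)
    have 4: "triple (queries n f) (message_prog @ [Assign 50 one]) s2 (return_pmf cur) ?R (2 + ?k * (3 * n + 4) + 1) 0"
      if s2: "s2 100 = enc_vecs cur \<and> length cur \<le> ?k \<and> (\<forall>\<alpha>\<in>set cur. length \<alpha> = n) \<and> same {100..119} s1 s2" for s2 cur
    proof (rule det_triple, rule det_det, rule message_prog)
      fix s3 assume s3: "s3 0 = enc_bits (list_message cur) \<and> same {0, 100, 105} s2 s3"
      show "det (queries n f) [Assign 50 one] s3 (?R cur) 1"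
        by (rule det_straight) (use s3 s2 s1 s in auto)
    qed (use s2 in auto)
    have "triple (queries n f) (search_prog @ message_prog @ [Assign 50 one]) s1 (bind_pmf (search_pmf n t ?k ?M ?T f) return_pmf) ?R
     (search_cost n ?k ?M ?T + (2 + ?k * (3 * n + 4) + 1)) (n * (?k * (4 * ?M)) + 0)"
      by (rule triple_append[OF 3], rule 4, assumption)
    then show ?thesis unfolding bind_return_pmf' by (rule triple_weaken') auto
  qed
  show ?thesis
    unfolding pstage1_def pstage1_cost_def by (rule exI, rule triple_det[OF 1 2])
qed

definition replies :: "(bit list \<Rightarrow> real) \<Rightarrow> (bit list \<times> bit list) list \<Rightarrow> bit list" where
  "replies f ps = concat (map (\<lambda>(u, v). [lab f u, lab f v]) ps)"

definition interleave :: "bit list \<Rightarrow> bit list \<Rightarrow> bit list" where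
  "interleave xs ys = concat (map2 (\<lambda>a b. [a, b]) xs ys)"

lemma interleave_simps [simp]: "interleave [] ys = []" "interleave (x # xs) (y # ys) = x # y # interleave xs ys"
  by (simp_all add: interleave_def)

text \<open>Pushing pairs of letters reverses both points; the receiver, who pushes again while
  reading, restores them.\<close>

lemma push_pair_interleave:
  "length u = length v \<Longrightarrow> push_pair (u, v) m = interleave (rev u) (rev v) @ m"
proof (induction u v arbitrary: m rule: list_induct2)
  case (Cons a u b v)
  have "interleave (rev u @ [a]) (rev v @ [b]) = interleave (rev u) (rev v) @ [a, b]"
    using Cons.hyps by (simp add: interleave_def)
  then show ?case using Cons by simp
qed simp

definition unpair_prog :: prog where
  "unpair_prog = [Assign 121 Null, Assign 122 Null, Assign 123 (Var 1)] @
     [While (Var 123) [Assign 121 (Mk (Hd (Var 0)) (Var 121)), Assign 122 (Mk (Hd (Tl (Var 0))) (Var 122)),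
        Assign 0 (Tl (Tl (Var 0))), Assign 123 (Tl (Var 123))]]"

lemma unpair_prog:
  assumes "s 0 = enc_bits (push_pair (u, v) m)" "s 1 = unary n" "length u = n" "length v = n"
  shows "det acc unpair_prog s (\<lambda>s'. s' 0 = enc_bits m \<and> s' 121 = enc_bits u \<and> s' 122 = enc_bits v \<and>
     same {0, 121, 122, 123} s s') (5 * n + 4)"
proof -
  let ?body = "[Assign 121 (Mk (Hd (Var 0)) (Var 121)), Assign 122 (Mk (Hd (Tl (Var 0))) (Var 122)),
        Assign 0 (Tl (Tl (Var 0))), Assign 123 (Tl (Var 123))]"
  define I where "I j g s' \<longleftrightarrow> (case g of (xs, ys, u', v') \<Rightarrow> length xs = j \<and> length ys = j \<and> s' 0 = enc_bits (interleave xs ys @ m) \<and>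
     s' 121 = enc_bits u' \<and> s' 122 = enc_bits v' \<and> s' 123 = unary j \<and> rev xs @ u' = u \<and> rev ys @ v' = v \<and> same {0, 121, 122, 123} s s')" for j g s'
  define h :: "bit list \<times> bit list \<times> bit list \<times> bit list \<Rightarrow> bit list \<times> bit list \<times> bit list \<times> bit list"
    where "h g = (case g of (xs, ys, u', v') \<Rightarrow> (tl xs, tl ys, hd xs # u', hd ys # v'))" for g
  have 1: "det acc [Assign 121 Null, Assign 122 Null, Assign 123 (Var 1)] s (I n (rev u, rev v, [], [])) 3"
    by (rule det_straight) (use assms in \<open>auto simp: I_def push_pair_interleave\<close>)
  have 2: "det acc [While (Var 123) ?body] s1 (\<lambda>s'. s' 0 = enc_bits m \<and> s' 121 = enc_bits u \<and> s' 122 = enc_bits v \<and>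
     same {0, 121, 122, 123} s s') (5 * n + 1)" if "I n (rev u, rev v, [], []) s1" for s1
  proof (rule det_gloop[where I = I and m = n and h = "\<lambda>_. h", OF that])
    fix j g s' assume *: "I (Suc j) g s'"
    obtain a xs b ys u' v' where g: "g = (a # xs, b # ys, u', v')"
      using * unfolding I_def by (auto simp: length_Suc_conv)
    have "I j (xs, ys, a # u', b # v') (after ?body s')"
      using * unfolding g by (auto simp: I_def bhd_def)
    then show "det acc ?body s' (I j (h g)) 4"
      by (intro det_straight) (auto simp: g h_def)
  qed (auto simp: I_def)
  show ?thesis unfolding unpair_prog_def by (rule det_seq[OF 1 2]) auto
qed

definition pstage2 :: prog where
  "pstage2 = [Assign 120 Null] @ [While (Var 0) (unpair_prog @ Ask 124 (Var 121) # Ask 125 (Var 122) #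
     [Assign 120 (Mk (Var 125) (Mk (Var 124) (Var 120)))])] @
     [While (Var 120) [Assign 0 (Mk (Hd (Var 120)) (Var 0)), Assign 120 (Tl (Var 120))]]"

definition pstage2_cost :: "nat \<Rightarrow> nat \<Rightarrow> nat" where
  "pstage2_cost n R = 3 + R * (5 * n + 20)"

lemma fold_replies:
  "fold (\<lambda>p a. lab f (snd p) # lab f (fst p) # a) ps a = rev (replies f ps) @ a"
  by (induction ps arbitrary: a) (auto simp: replies_def)

lemma length_replies: "length (replies f ps) = 2 * length ps"
  by (induction ps) (auto simp: replies_def)

text \<open>The loop stops when the message is used up. This is where \<open>n \<ge> 1\<close>
  enters: points of length 0 would leave no trace in the message.\<close>

lemma pstage2:
  assumes "s 0 = enc_bits (message ps)" "s 1 = unary n" "\<forall>(u, v)\<in>set ps. length u = n \<and> length v = n" "n \<ge> 1"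
  shows "triple (queries n f) pstage2 s (return_pmf ()) (\<lambda>_ s'. s' 0 = enc_bits (replies f ps)) (pstage2_cost n (length ps)) (2 * length ps)"
proof -
  let ?f = "\<lambda>p a. lab f (snd p) # lab f (fst p) # a"
  define I where "I es a s' \<longleftrightarrow> s' 0 = enc_bits (message es) \<and> s' 120 = enc_bits a \<and> s' 1 = unary n \<and> set es \<subseteq> set ps" for es a and s' :: store
  have 1: "det (queries n f) [Assign 120 Null] s (I ps []) 1"
    by (rule det_straight) (use assms in \<open>auto simp: I_def\<close>)
  have 2: "triple (queries n f) [While (Var 0) (unpair_prog @ Ask 124 (Var 121) # Ask 125 (Var 122) #
     [Assign 120 (Mk (Var 125) (Mk (Var 124) (Var 120)))])] s1 (foldM (\<lambda>p a. return_pmf (?f p a)) ps []) (I [])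
     (length ps * Suc (5 * n + 4 + 3) + 1) (length ps * 2)" if "I ps [] s1" for s1
  proof (rule triple_foldM[where I = I, OF that])
    fix p es a s' assume *: "I (p # es) a s'"
    obtain u v where p: "p = (u, v)" by (cases p)
    have uv: "length u = n" "length v = n" using * assms(3) by (auto simp: I_def p)
    have "message (p # es) \<noteq> []"
      using uv assms(4) by (cases u rule: rev_cases; cases v rule: rev_cases) (auto simp: p push_pair_interleave)
    moreover have "triple (queries n f) (unpair_prog @ Ask 124 (Var 121) # Ask 125 (Var 122) #
     [Assign 120 (Mk (Var 125) (Mk (Var 124) (Var 120)))]) s' (return_pmf (?f p a)) (I es) (5 * n + 4 + Suc (Suc 1)) (Suc (Suc 0))"
    proof (rule triple_det, rule unpair_prog[where u = u and v = v and m = "message es" and n = n])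
      fix s2 assume s2: "s2 0 = enc_bits (message es) \<and> s2 121 = enc_bits u \<and> s2 122 = enc_bits v \<and> same {0, 121, 122, 123} s' s2"
      show "triple (queries n f) (Ask 124 (Var 121) # Ask 125 (Var 122) # [Assign 120 (Mk (Var 125) (Mk (Var 124) (Var 120)))])
         s2 (return_pmf (?f p a)) (I es) (Suc (Suc 1)) (Suc (Suc 0))"
        by (rule triple_query[where v = u], simp_all add: s2 uv cube_def, rule triple_query[where v = v], simp_all add: s2 uv cube_def)
           (rule det_triple, rule det_straight, use * s2 in \<open>auto simp: I_def p\<close>)
    qed (use * uv in \<open>auto simp: I_def p\<close>)
    ultimately show "eval_expr s' (Var 0) \<noteq> Nul \<and> triple (queries n f) (unpair_prog @ Ask 124 (Var 121) # Ask 125 (Var 122) #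
     [Assign 120 (Mk (Var 125) (Mk (Var 124) (Var 120)))]) s' (return_pmf (?f p a)) (I es) (5 * n + 4 + 3) 2"
      using * unfolding I_def by (simp add: eval_nat_numeral)
  qed (auto simp: I_def)
  have f: "foldM (\<lambda>p a. return_pmf (?f p a)) ps [] = return_pmf (rev (replies f ps))"
    by (simp add: foldM_return fold_replies)
  have 3: "triple (queries n f) [While (Var 120) [Assign 0 (Mk (Hd (Var 120)) (Var 0)), Assign 120 (Tl (Var 120))]] s1
     (return_pmf ()) (\<lambda>_ s'. s' 0 = enc_bits (replies f ps)) (6 * length ps + 1) 0" if "I [] (rev (replies f ps)) s1" for s1
    by (rule det_triple, rule det_weaken, rule push_loop[where v = "rev (replies f ps)" and m = "[]"])
       (use that in \<open>auto simp: I_def length_replies\<close>)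
  have "triple (queries n f) pstage2 s (bind_pmf (foldM (\<lambda>p a. return_pmf (?f p a)) ps []) (\<lambda>_. return_pmf ()))
     (\<lambda>_ s'. s' 0 = enc_bits (replies f ps)) (1 + (length ps * Suc (5 * n + 4 + 3) + 1 + (6 * length ps + 1))) (length ps * 2 + 0)"
    unfolding pstage2_def
    by (rule triple_det[OF 1], rule triple_append[OF 2], assumption, rule 3) (simp add: f)
  then show ?thesis unfolding f bind_return_pmf by (rule triple_weaken') (auto simp: pstage2_cost_def algebra_simps)
qed

definition prover :: prog where
  "prover = [Cond (Var 50) pstage2 pstage1]"

section \<open>The search of the honest prover succeeds\<close>

definition fails :: "'a pmf \<Rightarrow> ('a \<Rightarrow> bool) \<Rightarrow> real" where
  "fails p P = measure p {x. \<not> P x}"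

lemma fails_nonneg: "0 \<le> fails p P"
  by (simp add: fails_def)

lemma fails_return [simp]: "P x \<Longrightarrow> fails (return_pmf x) P = 0"
  by (simp add: fails_def measure_return_pmf)

lemma fails_mono: "(\<And>x. x \<in> set_pmf p \<Longrightarrow> P x \<Longrightarrow> Q x) \<Longrightarrow> fails p Q \<le> fails p P"
  unfolding fails_def by (rule measure_pmf.finite_measure_mono_AE) (auto simp: AE_measure_pmf_iff)

lemma fails_conj: "fails p (\<lambda>x. P x \<and> Q x) \<le> fails p P + fails p Q"
proof -
  have "{x. \<not> (P x \<and> Q x)} = {x. \<not> P x} \<union> {x. \<not> Q x}" by auto
  then show ?thesis unfolding fails_def by (simp add: measure_Un_le)
qed

lemma fails_map: "fails (map_pmf f p) P = fails p (\<lambda>x. P (f x))"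
  by (simp add: fails_def vimage_def)

text \<open>Conditioning on the first stage: where \<open>P\<close> fails, the second stage is
  bounded by 1, and elsewhere by \<open>b\<close>.\<close>

lemma fails_bind:
  assumes "fails p P \<le> a" "\<And>x. x \<in> set_pmf p \<Longrightarrow> P x \<Longrightarrow> fails (f x) Q \<le> b" "0 \<le> b"
  shows "fails (bind_pmf p f) Q \<le> a + b"
proof -
  have a: "0 \<le> a" using assms(1) fails_nonneg[of p P] by linarith
  have "ennreal (fails (bind_pmf p f) Q) = (\<integral>\<^sup>+x. ennreal (fails (f x) Q) \<partial>p)"
    unfolding fails_def by (simp add: measure_pmf.emeasure_eq_measure[symmetric])
  also have "\<dots> \<le> (\<integral>\<^sup>+x. indicator {x. \<not> P x} x + ennreal b \<partial>p)"
  proof (rule nn_integral_mono_AE)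
    have "ennreal (fails (f x) Q) \<le> indicator {x. \<not> P x} x + ennreal b" if "x \<in> set_pmf p" for x
    proof (cases "P x")
      case True
      then show ?thesis using assms(2)[OF that] by (auto intro: ennreal_leI)
    next
      case False
      have "fails (f x) Q \<le> 1" by (simp add: fails_def)
      then have "ennreal (fails (f x) Q) \<le> 1" by simp
      then show ?thesis using False by (auto intro: order_trans simp: add_increasing2)
    qed
    then show "AE x in p. ennreal (fails (f x) Q) \<le> indicator {x. \<not> P x} x + ennreal b"
      by (simp add: AE_measure_pmf_iff)
  qed
  also have "\<dots> = ennreal (fails p P) + ennreal b"
    by (subst nn_integral_add) (auto simp: fails_def measure_pmf.emeasure_eq_measure)
  also have "\<dots> \<le> ennreal (a + b)"
    using assms(1,3) a by (simp add: fails_nonneg flip: ennreal_plus)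
  finally show ?thesis using a assms(3) by (simp del: ennreal_plus)
qed

text \<open>The invariant refers to the list still to be processed, so a round is judged only from
  states that satisfy it, and the failure probabilities of the rounds add up.\<close>

lemma fails_foldM:
  assumes "I es a" "\<And>e es a. I (e # es) a \<Longrightarrow> fails (B e a) (I es) \<le> p" "0 \<le> p"
  shows "fails (foldM B es a) (I []) \<le> real (length es) * p"
  using assms(1)
proof (induction es arbitrary: a)
  case (Cons e es)
  have "fails (bind_pmf (B e a) (foldM B es)) (I []) \<le> p + real (length es) * p"
    using assms Cons by (intro fails_bind[where P = "I es"]) auto
  then show ?case by (simp add: algebra_simps)
qed simp

lemma sum_list_sgb: "(\<Sum>b\<leftarrow>bs. sgb b) = real (zeros bs) - real (ones bs)"
  by (induction bs) (auto simp: sgb_def)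

lemma sgb_lab: "f x \<in> {-1, 1} \<Longrightarrow> sgb (lab f x) = f x"
  by (auto simp: lab_def)

abbreviation sign_valued :: "nat \<Rightarrow> (bit list \<Rightarrow> real) \<Rightarrow> bool" where
  "sign_valued n f \<equiv> \<forall>x\<in>cube n. f x \<in> {-1, 1}"

lemma parseval_sign:
  assumes "sign_valued n f"
  shows "(\<Sum>\<gamma>\<in>cube n. (fourier n f \<gamma>)\<^sup>2) = 1"
proof -
  have "expect (unif n) (\<lambda>x. (f x)\<^sup>2) = expect (unif n) (\<lambda>x. 1)"
    by (rule expect_unif_cong) (use assms in auto)
  then show ?thesis by (simp add: parseval)
qed

lemma finite_replicate_pmf [simp]:
  assumes "finite (set_pmf p)"
  shows "finite (set_pmf (replicate_pmf m p))"
  using finite_lists_length_eq[OF assms] by (auto simp: set_replicate_pmf lists_eq_set Collect_conj_eq Int_commute)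

text \<open>The prefix z, which the program draws last, is moved to the front by independence; then
  \<open>weight_expect\<close> applies.\<close>

lemma expect_stat:
  assumes "sign_valued n f" "r + length \<alpha> = n"
  shows "expect (stat_pmf r f \<alpha>) sgb = weight r f \<alpha>"
proof -
  let ?k = "length \<alpha>"
  have c: "stat_pmf r f \<alpha> = bind_pmf (unif r) (\<lambda>z. bind_pmf (unif ?k) (\<lambda>x. bind_pmf (unif ?k) (\<lambda>y.
     return_pmf (inner_prod \<alpha> x + inner_prod \<alpha> y + lab f (z @ x) + lab f (z @ y)))))"
    unfolding stat_pmf_def replicate_coin
    by (subst bind_commute_pmf[of "unif r"], rule bind_pmf_cong, rule refl, rule bind_commute_pmf)
  have "expect (stat_pmf r f \<alpha>) sgb = expect (unif r) (\<lambda>z. expect (unif ?k) (\<lambda>x. expect (unif ?k) (\<lambda>y.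
     sgb (inner_prod \<alpha> x + inner_prod \<alpha> y + lab f (z @ x) + lab f (z @ y)))))"
    unfolding c by (simp add: expect_bind)
  also have "\<dots> = expect (unif r) (\<lambda>z. expect (unif ?k) (\<lambda>x. expect (unif ?k) (\<lambda>y.
     f (z @ x) * f (z @ y) * chi \<alpha> x * chi \<alpha> y)))"
  proof (intro expect_unif_cong)
    fix z x y assume "z \<in> cube r" "x \<in> cube ?k" "y \<in> cube ?k"
    then have "z @ x \<in> cube n" "z @ y \<in> cube n" using assms(2) by (auto simp: cube_def)
    then show "sgb (inner_prod \<alpha> x + inner_prod \<alpha> y + lab f (z @ x) + lab f (z @ y)) = f (z @ x) * f (z @ y) * chi \<alpha> x * chi \<alpha> y"
      using assms(1) by (simp add: sgb_add sgb_lab chi_sgb del: insert_iff)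
  qed
  also have "\<dots> = weight r f \<alpha>" by (rule weight_expect) simp
  finally show ?thesis .
qed

lemma finite_bit_set [simp]: "finite (A :: bit set)"
proof -
  have "A \<subseteq> {0, 1}" by auto
  then show ?thesis by (rule finite_subset) simp
qed

text \<open>Hoeffding's bound with accuracy \<open>e\<close> on both sides. Between
  \<open>T / M - e\<close> and \<open>T / M + e\<close> either answer counts as correct.\<close>

lemma fails_test:
  assumes f: "sign_valued n f" "r + length \<alpha> = n" and M: "M > 0" and e: "e \<ge> 0"
  shows "fails (test_pmf M T r f \<alpha>) (\<lambda>b. (weight r f \<alpha> \<ge> T / M + e \<longrightarrow> b) \<and> (weight r f \<alpha> < T / M - e \<longrightarrow> \<not> b))
    \<le> 2 * exp (- (real M * e\<^sup>2 / 2))"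
proof -
  let ?w = "weight r f \<alpha>"
  have "fails (test_pmf M T r f \<alpha>) (\<lambda>b. (?w \<ge> T / M + e \<longrightarrow> b) \<and> (?w < T / M - e \<longrightarrow> \<not> b))
    \<le> fails (replicate_pmf M (stat_pmf r f \<alpha>)) (\<lambda>bs. \<bar>(\<Sum>b\<leftarrow>bs. sgb b) - real M * expect (stat_pmf r f \<alpha>) sgb\<bar> \<le> real M * e)"
    unfolding test_pmf_def fails_map
  proof (rule fails_mono)
    fix bs assume *: "\<bar>(\<Sum>b\<leftarrow>bs. sgb b) - real M * expect (stat_pmf r f \<alpha>) sgb\<bar> \<le> real M * e"
    let ?S = "real (zeros bs) - real (ones bs)"
    have S: "\<bar>?S - real M * ?w\<bar> \<le> real M * e"
      using * unfolding expect_stat[OF f] sum_list_sgb .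
    have 1: "T \<le> ?S" if "?w \<ge> T / M + e"
    proof -
      have "real M * (T / M + e) \<le> real M * ?w" using that by (intro mult_left_mono) auto
      then show ?thesis using S M by (simp add: algebra_simps)
    qed
    have 2: "?S < T" if "?w < T / M - e"
    proof -
      have "real M * ?w < real M * (T / M - e)" using that M by (intro mult_strict_left_mono) auto
      then show ?thesis using S M by (simp add: algebra_simps)
    qed
    show "(?w \<ge> T / M + e \<longrightarrow> T + ones bs \<le> zeros bs) \<and> (?w < T / M - e \<longrightarrow> \<not> T + ones bs \<le> zeros bs)"
      using 1 2 by linarith
  qed
  also have "\<dots> \<le> 2 * exp (- (real M * e\<^sup>2 / 2))"
    unfolding fails_def by (rule hoeffding_abs) (use e in auto)
  finally show ?thesis .
qed

text \<open>\<open>P\<close> is the set of suffixes examined so far. A light vector can enter only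
  as padding, hence at most \<open>t\<close> of them; this last clause is what keeps the list below
  its cap.\<close>

definition good_list :: "(bit list \<Rightarrow> real) \<Rightarrow> real \<Rightarrow> real \<Rightarrow> nat \<Rightarrow> bit list set \<Rightarrow> bit list list \<Rightarrow> bool" where
  "good_list w hi lo t P new \<longleftrightarrow> distinct new \<and> set new \<subseteq> P \<and> (\<forall>\<alpha>\<in>P. w \<alpha> \<ge> hi \<longrightarrow> \<alpha> \<in> set new) \<and>
     min t (card P) \<le> length new \<and> card {\<alpha> \<in> set new. w \<alpha> < lo} \<le> t"

text \<open>A light vector fails its test and is kept only while the list has fewer than
  \<open>t\<close> entries; a heavy one passes and finds room.\<close>

lemma good_list_extend:
  assumes g: "good_list w hi lo t P new" and P: "\<alpha> \<notin> P" "finite P"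
    and b: "w \<alpha> \<ge> hi \<longrightarrow> b" "w \<alpha> < lo \<longrightarrow> \<not> b" and k: "length new < k"
  shows "good_list w hi lo t (insert \<alpha> P) (extend t k \<alpha> new b)"
proof -
  have \<alpha>: "\<alpha> \<notin> set new" using g P by (auto simp: good_list_def)
  show ?thesis
  proof (cases "length new < t \<or> b")
    case True
    then have ex: "extend t k \<alpha> new b = \<alpha> # new" using k by (auto simp: extend_def)
    have "card {x \<in> set (\<alpha> # new). w x < lo} \<le> t"
    proof (cases "w \<alpha> < lo")
      case True
      then have "length new < t" using b \<open>length new < t \<or> b\<close> by auto
      have "card {x \<in> set (\<alpha> # new). w x < lo} \<le> card (set (\<alpha> # new))" by (intro card_mono) auto
      also have "\<dots> \<le> Suc (length new)" by (rule order_trans[OF card_length]) simp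
      finally show ?thesis using \<open>length new < t\<close> by simp
    next
      case False
      then have "{x \<in> set (\<alpha> # new). w x < lo} = {x \<in> set new. w x < lo}" by auto
      then show ?thesis using g by (simp add: good_list_def)
    qed
    then show ?thesis using g P \<alpha> unfolding ex by (auto simp: good_list_def)
  next
    case False
    then have ex: "extend t k \<alpha> new b = new" by (auto simp: extend_def)
    show ?thesis using g P b False unfolding ex by (auto simp: good_list_def)
  qed
qed

text \<open>Entries of weight at least \<open>lo\<close> number at most \<open>1 / lo\<close>,
  because the weights sum to at most 1, and the others number at most \<open>t\<close>. So the cap
  \<open>k\<close> is never reached and cannot keep out a heavy vector.\<close>

lemma good_list_length:
  assumes g: "good_list w hi lo t P new" and P: "finite P" and w: "\<And>\<alpha>. 0 \<le> w \<alpha>" "(\<Sum>\<alpha>\<in>P. w \<alpha>) \<le> 1"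
    and lo: "lo > 0" "real t + 1 / lo < real k"
  shows "length new < k"
proof -
  let ?A = "{\<alpha> \<in> set new. w \<alpha> < lo}" and ?B = "{\<alpha> \<in> set new. \<not> w \<alpha> < lo}"
  have "real (card ?B) * lo \<le> (\<Sum>\<alpha>\<in>?B. w \<alpha>)"
    using sum_bounded_below[of ?B lo w] by (auto simp: mult.commute)
  also have "\<dots> \<le> (\<Sum>\<alpha>\<in>P. w \<alpha>)" using g P w(1) by (intro sum_mono2) (auto simp: good_list_def)
  also have "\<dots> \<le> 1" by (rule w)
  finally have B: "real (card ?B) \<le> 1 / lo" using lo by (simp add: field_simps)
  have "length new = card (set new)" using g by (simp add: good_list_def distinct_card)
  also have "set new = ?A \<union> ?B" by auto
  also have "card \<dots> \<le> card ?A + card ?B" by (rule card_Un_le)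
  finally have "real (length new) \<le> real t + real (card ?B)" using g by (simp add: good_list_def)
  then show ?thesis using B lo by linarith
qed

lemma sum_weight_sign:
  assumes "sign_valued n f" "r + k = n"
  shows "(\<Sum>\<alpha>\<in>cube k. weight r f \<alpha>) = 1"
  using sum_weight[of r f k] parseval_sign[OF assms(1)] assms(2) by simp

context
  fixes n :: nat and f :: "bit list \<Rightarrow> real" and t k M T :: nat and e hi lo :: real
  assumes f: "sign_valued n f" and M: "M > 0" and e: "e \<ge> 0"
    and hi: "T / M + e \<le> hi" and lo: "lo \<le> T / M - e" "lo > 0" "real t + 1 / lo < real k" and k: "t \<le> k"
begin

lemma fails_cand:
  assumes g: "good_list (weight r f) hi lo t P new" and r: "r + length \<alpha> = n"
    and P: "P \<subseteq> cube (length \<alpha>)" "\<alpha> \<notin> P"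
  shows "fails (cand_pmf t k M T r f \<alpha> new) (good_list (weight r f) hi lo t (insert \<alpha> P)) \<le> 2 * exp (- (real M * e\<^sup>2 / 2))"
  unfolding cand_pmf_def fails_map
proof (rule order_trans[OF _ fails_test[OF f r M e]], rule fails_mono)
  fix b assume "(T / M + e \<le> weight r f \<alpha> \<longrightarrow> b) \<and> (weight r f \<alpha> < T / M - e \<longrightarrow> \<not> b)"
  then have b: "weight r f \<alpha> \<ge> hi \<longrightarrow> b" "weight r f \<alpha> < lo \<longrightarrow> \<not> b" using hi lo by auto
  have fin: "finite P" using P(1) by (rule finite_subset) simp
  \<comment> \<open>\<open>P\<close> is part of one level, and by Parseval the weights of a whole
    level sum to 1.\<close>
  have "(\<Sum>\<beta>\<in>P. weight r f \<beta>) \<le> (\<Sum>\<beta>\<in>cube (length \<alpha>). weight r f \<beta>)"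
    using P by (intro sum_mono2) (auto simp: weight_nonneg)
  also have "\<dots> = 1" by (rule sum_weight_sign[OF f r])
  finally have "length new < k"
    using good_list_length[OF g fin weight_nonneg _ lo(2,3)] by blast
  then show "good_list (weight r f) hi lo t (insert \<alpha> P) (extend t k \<alpha> new b)"
    using good_list_extend[OF g P(2) fin b] by blast
qed

lemma fails_node:
  assumes g: "good_list (weight r f) hi lo t P new" and r: "Suc (r + length \<alpha>) = n"
    and P: "P \<subseteq> cube (Suc (length \<alpha>))" "0 # \<alpha> \<notin> P" "1 # \<alpha> \<notin> P"
  shows "fails (foldM (\<lambda>b. cand_pmf t k M T r f (b # \<alpha>)) [0, 1] new) (good_list (weight r f) hi lo t ({0 # \<alpha>, 1 # \<alpha>} \<union> P))
    \<le> 2 * (2 * exp (- (real M * e\<^sup>2 / 2)))"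
proof -
  let ?p = "2 * exp (- (real M * e\<^sup>2 / 2))"
  have "fails (foldM (\<lambda>b. cand_pmf t k M T r f (b # \<alpha>)) [0, 1] new) (good_list (weight r f) hi lo t ({0 # \<alpha>, 1 # \<alpha>} \<union> P)) \<le> ?p + (?p + 0)"
    unfolding foldM.simps
  proof (rule fails_bind[where P = "good_list (weight r f) hi lo t (insert (0 # \<alpha>) P)"])
    show "fails (cand_pmf t k M T r f (0 # \<alpha>) new) (good_list (weight r f) hi lo t (insert (0 # \<alpha>) P)) \<le> ?p"
      by (rule fails_cand[OF g]) (use r P in auto)
  next
    fix new1 assume g1: "good_list (weight r f) hi lo t (insert (0 # \<alpha>) P) new1"
    show "fails (cand_pmf t k M T r f (1 # \<alpha>) new1 \<bind> return_pmf) (good_list (weight r f) hi lo t ({0 # \<alpha>, 1 # \<alpha>} \<union> P)) \<le> ?p + 0"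
    proof (rule fails_bind[where P = "good_list (weight r f) hi lo t (insert (1 # \<alpha>) (insert (0 # \<alpha>) P))"])
      show "fails (cand_pmf t k M T r f (1 # \<alpha>) new1) (good_list (weight r f) hi lo t (insert (1 # \<alpha>) (insert (0 # \<alpha>) P))) \<le> ?p"
        by (rule fails_cand[OF g1]) (use r P in \<open>auto simp: cube_def\<close>)
    qed (simp_all add: insert_commute)
  qed simp
  then show ?thesis by simp
qed

text \<open>A level with short suffixes may contain fewer than \<open>t\<close> vectors at all,
  hence the minimum.\<close>

definition good_level :: "nat \<Rightarrow> bit list list \<Rightarrow> bool" where
  "good_level r cur \<longleftrightarrow> distinct cur \<and> set cur \<subseteq> cube (n - r) \<and> length cur \<le> k \<and> min t (2 ^ (n - r)) \<le> length cur \<and>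
     (\<forall>\<alpha>\<in>cube (n - r). weight r f \<alpha> \<ge> hi \<longrightarrow> \<alpha> \<in> set cur)"

text \<open>Only children of listed suffixes are examined. A heavy vector is among them, since its
  parent is at least as heavy and therefore listed. Twice \<open>min t (2 ^ l)\<close> children
  suffice for the required length on the next level.\<close>

lemma fails_level:
  assumes cur: "good_level (Suc r) cur" and r: "Suc r \<le> n"
  shows "fails (level_pmf t k M T f r cur) (good_level r) \<le> real k * (2 * (2 * exp (- (real M * e\<^sup>2 / 2))))"
proof -
  let ?p = "2 * (2 * exp (- (real M * e\<^sup>2 / 2)))"
  define l where "l = n - Suc r"
  have l: "n - r = Suc l" "n - Suc r = l" "Suc (r + l) = n" using r by (auto simp: l_def)
  have cur': "distinct cur" "set cur \<subseteq> cube l" "length cur \<le> k" "min t (2 ^ l) \<le> length cur"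
    "\<forall>\<alpha>\<in>cube l. weight (Suc r) f \<alpha> \<ge> hi \<longrightarrow> \<alpha> \<in> set cur"
    using cur unfolding good_level_def l by auto
  define cs where "cs A = (\<lambda>\<alpha>. 0 # \<alpha>) ` A \<union> (\<lambda>\<alpha>. 1 # \<alpha>) ` A" for A :: "bit list set"
  \<comment> \<open>The witness \<open>A\<close> collects the suffixes already processed, and
    \<open>cs A\<close> their children.\<close>
  define I where "I es new \<longleftrightarrow> set es \<subseteq> cube l \<and> distinct es \<and> (\<exists>A. A \<inter> set es = {} \<and> A \<union> set es = set cur \<and>
     good_list (weight r f) hi lo t (cs A) new)" for es new
  have "fails (level_pmf t k M T f r cur) (I []) \<le> real (length cur) * ?p"
    unfolding level_pmf_def
  proof (rule fails_foldM)
    show "I cur []" using cur' by (auto simp: I_def cs_def good_list_def)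
  next
    fix \<alpha> es new assume *: "I (\<alpha> # es) new"
    then obtain A where A: "A \<inter> set (\<alpha> # es) = {}" "A \<union> set (\<alpha> # es) = set cur" "good_list (weight r f) hi lo t (cs A) new"
      unfolding I_def by auto
    have \<alpha>: "\<alpha> \<in> cube l" "set es \<subseteq> cube l" "distinct es" "\<alpha> \<notin> set es" using * by (auto simp: I_def)
    have cs: "{0 # \<alpha>, 1 # \<alpha>} \<union> cs A = cs (insert \<alpha> A)" by (auto simp: cs_def)
    have "fails (foldM (\<lambda>b. cand_pmf t k M T r f (b # \<alpha>)) [0, 1] new) (I es)
      \<le> fails (foldM (\<lambda>b. cand_pmf t k M T r f (b # \<alpha>)) [0, 1] new) (good_list (weight r f) hi lo t ({0 # \<alpha>, 1 # \<alpha>} \<union> cs A))"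
    proof (rule fails_mono)
      fix new' assume g: "good_list (weight r f) hi lo t ({0 # \<alpha>, 1 # \<alpha>} \<union> cs A) new'"
      show "I es new'"
        unfolding I_def using A \<alpha> g unfolding cs by (auto intro!: exI[of _ "insert \<alpha> A"])
    qed
    also have "\<dots> \<le> ?p"
    proof (rule fails_node[OF A(3)])
      have "A \<subseteq> cube l" using A(2) cur'(2) by auto
      then show "cs A \<subseteq> cube (Suc (length \<alpha>))" using \<alpha> by (auto simp: cs_def cube_def)
    qed (use \<alpha> A l in \<open>auto simp: cs_def cube_def\<close>)
    finally show "fails (foldM (\<lambda>b. cand_pmf t k M T r f (b # \<alpha>)) [0, 1] new) (I es) \<le> ?p" .
  qed simp
  also have "\<dots> \<le> real k * ?p" using cur' by (intro mult_right_mono) auto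
  finally have fl: "fails (level_pmf t k M T f r cur) (I []) \<le> real k * ?p" .
  have "fails (level_pmf t k M T f r cur) (good_level r) \<le> fails (level_pmf t k M T f r cur) (I [])"
  proof (rule fails_mono)
    fix new assume "new \<in> set_pmf (level_pmf t k M T f r cur)" and "I [] new"
    from this(1) have "length new \<le> k \<and> (\<forall>\<alpha>\<in>set new. length \<alpha> = Suc l)"
      by (rule set_level_pmf) (use k cur' in \<open>auto simp: cube_def\<close>)
    moreover have g: "good_list (weight r f) hi lo t (cs (set cur)) new" using \<open>I [] new\<close> by (auto simp: I_def)
    moreover have "card (cs (set cur)) = 2 * length cur"
      unfolding cs_def using cur'(1)
      by (subst card_Un_disjoint) (auto simp: card_image inj_on_def distinct_card)
    moreover have "\<alpha> \<in> cs (set cur)" if a: "\<alpha> \<in> cube (Suc l)" "weight r f \<alpha> \<ge> hi" for \<alpha>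
    proof -
      obtain b \<beta> where b: "\<alpha> = b # \<beta>" "\<beta> \<in> cube l" using a(1) by (cases \<alpha>) (auto simp: cube_def)
      have "weight r f \<alpha> \<le> weight (Suc r) f \<beta>"
        unfolding weight_Cons b(1) by (cases b) (auto simp: weight_nonneg)
      then have "\<beta> \<in> set cur" using cur'(5) b(2) a(2) by force
      then show ?thesis unfolding b(1) cs_def by (cases b) auto
    qed
    ultimately show "good_level r new"
      unfolding good_level_def l good_list_def using cur'(4) by (auto simp: cube_def)
  qed
  then show ?thesis using fl by linarith
qed

lemma fails_search:
  "fails (search_pmf n t k M T f) (\<lambda>cur. distinct cur \<and> set cur \<subseteq> cube n \<and> length cur \<le> k \<and> min t (2 ^ n) \<le> length cur \<and>
     (\<forall>\<gamma>\<in>cube n. (fourier n f \<gamma>)\<^sup>2 \<ge> hi \<longrightarrow> \<gamma> \<in> set cur)) \<le> real n * (real k * (2 * (2 * exp (- (real M * e\<^sup>2 / 2)))))"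
proof -
  let ?p = "real k * (2 * (2 * exp (- (real M * e\<^sup>2 / 2))))"
  define I where "I es cur \<longleftrightarrow> es = rev [0..<length es] \<and> length es \<le> n \<and> good_level (length es) cur" for es cur
  have A: "fails (search_pmf n t k M T f) (I []) \<le> real (length (rev [0..<n])) * ?p"
    unfolding search_pmf_def
  proof (rule fails_foldM)
    have "0 < 1 / lo" using lo(2) by simp
    then have "0 < real k" using lo(3) by linarith
    then have "1 \<le> k" by simp
    then show "I (rev [0..<n]) [[]]" by (auto simp: I_def good_level_def)
  next
    fix r es cur assume *: "I (r # es) cur"
    then have r: "r = length es" "es = rev [0..<length es]" "length es < n" and g: "good_level (Suc (length es)) cur" by (auto simp: I_def)
    have "fails (level_pmf t k M T f r cur) (I es) \<le> fails (level_pmf t k M T f r cur) (good_level r)"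
      by (rule fails_mono) (use r in \<open>auto simp: I_def\<close>)
    also have "\<dots> \<le> ?p" by (rule fails_level) (use r g in auto)
    finally show "fails (level_pmf t k M T f r cur) (I es) \<le> ?p" .
  qed simp
  have B: "fails (search_pmf n t k M T f) (\<lambda>cur. distinct cur \<and> set cur \<subseteq> cube n \<and> length cur \<le> k \<and> min t (2 ^ n) \<le> length cur \<and>
     (\<forall>\<gamma>\<in>cube n. (fourier n f \<gamma>)\<^sup>2 \<ge> hi \<longrightarrow> \<gamma> \<in> set cur)) \<le> fails (search_pmf n t k M T f) (I [])"
  proof (rule fails_mono)
    fix cur assume "I [] cur"
    then have g: "good_level 0 cur" by (simp add: I_def)
    have "weight 0 f \<gamma> = (fourier n f \<gamma>)\<^sup>2" if "\<gamma> \<in> cube n" for \<gamma>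
      using that by (simp add: weight_0 cube_def)
    then show "distinct cur \<and> set cur \<subseteq> cube n \<and> length cur \<le> k \<and> min t (2 ^ n) \<le> length cur \<and>
     (\<forall>\<gamma>\<in>cube n. (fourier n f \<gamma>)\<^sup>2 \<ge> hi \<longrightarrow> \<gamma> \<in> set cur)"
      using g unfolding good_level_def by simp
  qed
  show ?thesis using order_trans[OF B A] unfolding length_rev length_upt diff_zero .
qed

end

section \<open>Soundness and completeness\<close>

lemma expect_parity:
  assumes "sign_valued n f" "\<gamma> \<in> cube n"
  shows "expect (parity_pmf n f \<gamma>) sgb = fourier n f \<gamma> ^ 4"
proof -
  have "expect (parity_pmf n f \<gamma>) sgb = expect (replicate_pmf 4 (unif n)) (\<lambda>xs. \<Prod>x\<leftarrow>xs. sgb (lab f x + inner_prod \<gamma> x))"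
    by (simp add: parity_pmf_def sgb_sum_list)
  also have "\<dots> = expect (unif n) (\<lambda>x. sgb (lab f x + inner_prod \<gamma> x)) ^ 4"
    by (rule expect_exp_replicate) simp
  also have "expect (unif n) (\<lambda>x. sgb (lab f x + inner_prod \<gamma> x)) = fourier n f \<gamma>"
    unfolding fourier_def by (rule expect_unif_cong) (use assms in \<open>auto simp: sgb_add sgb_lab chi_sgb\<close>)
  finally show ?thesis .
qed

lemma set_score_all:
  assumes "cs \<in> set_pmf (score_all n f R L)"
  shows "map snd cs = rev L \<and> (\<forall>(c, \<gamma>)\<in>set cs. c \<le> R)"
proof -
  have "cs \<in> set_pmf (foldM (\<lambda>\<gamma> cs. map_pmf (\<lambda>bs. (zeros bs, \<gamma>) # cs) (replicate_pmf R (parity_pmf n f \<gamma>))) L cs0) \<Longrightarrow>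
    (\<forall>(c, \<gamma>)\<in>set cs0. c \<le> R) \<Longrightarrow> map snd cs = rev L @ map snd cs0 \<and> (\<forall>(c, \<gamma>)\<in>set cs. c \<le> R)" for cs0
  proof (induction L arbitrary: cs0)
    case (Cons \<gamma> L)
    then obtain bs where bs: "bs \<in> set_pmf (replicate_pmf R (parity_pmf n f \<gamma>))"
      "cs \<in> set_pmf (foldM (\<lambda>\<gamma> cs. map_pmf (\<lambda>bs. (zeros bs, \<gamma>) # cs) (replicate_pmf R (parity_pmf n f \<gamma>))) L ((zeros bs, \<gamma>) # cs0))"
      by auto
    have "zeros bs \<le> R" using bs(1) zeros_ones[of bs] by (simp add: set_replicate_pmf)
    then show ?case using Cons.IH[OF bs(2)] Cons.prems(2) by auto
  qed auto
  from this[of "[]"] assms show ?thesis by (simp add: score_all_def)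
qed

text \<open>With \<open>c\<close> zeros among \<open>R\<close> bits the signs sum to
  \<open>2 * c - R\<close>, so this says that the fourth power is estimated to accuracy
  \<eta>.\<close>

definition score_ok :: "nat \<Rightarrow> (bit list \<Rightarrow> real) \<Rightarrow> nat \<Rightarrow> real \<Rightarrow> nat \<times> bit list \<Rightarrow> bool" where
  "score_ok n f R \<eta> = (\<lambda>(c, \<gamma>). \<bar>2 * real c - real R - real R * fourier n f \<gamma> ^ 4\<bar> \<le> real R * \<eta>)"

lemma fails_score_all:
  assumes "sign_valued n f" "set L \<subseteq> cube n" "\<eta> \<ge> 0"
  shows "fails (score_all n f R L) (\<lambda>cs. \<forall>a\<in>set cs. score_ok n f R \<eta> a) \<le> real (length L) * (2 * exp (- (real R * \<eta>\<^sup>2 / 2)))"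
proof -
  define I where "I es cs \<longleftrightarrow> set es \<subseteq> cube n \<and> (\<forall>a\<in>set cs. score_ok n f R \<eta> a)" for es cs
  have "fails (score_all n f R L) (I []) \<le> real (length L) * (2 * exp (- (real R * \<eta>\<^sup>2 / 2)))"
    unfolding score_all_def
  proof (rule fails_foldM)
    fix \<gamma> es cs assume *: "I (\<gamma> # es) cs"
    have "fails (map_pmf (\<lambda>bs. (zeros bs, \<gamma>) # cs) (replicate_pmf R (parity_pmf n f \<gamma>))) (I es)
      \<le> fails (replicate_pmf R (parity_pmf n f \<gamma>)) (\<lambda>bs. \<bar>(\<Sum>b\<leftarrow>bs. sgb b) - real R * expect (parity_pmf n f \<gamma>) sgb\<bar> \<le> real R * \<eta>)"
      unfolding fails_map
    proof (rule fails_mono)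
      fix bs assume "bs \<in> set_pmf (replicate_pmf R (parity_pmf n f \<gamma>))"
        and "\<bar>(\<Sum>b\<leftarrow>bs. sgb b) - real R * expect (parity_pmf n f \<gamma>) sgb\<bar> \<le> real R * \<eta>"
      moreover have "real (zeros bs) - real (ones bs) = 2 * real (zeros bs) - real R" if "length bs = R"
        using zeros_ones[of bs] that by linarith
      ultimately have "score_ok n f R \<eta> (zeros bs, \<gamma>)"
        using * assms(1) by (simp add: set_replicate_pmf sum_list_sgb score_ok_def expect_parity I_def)
      then show "I es ((zeros bs, \<gamma>) # cs)" using * by (simp add: I_def)
    qed
    also have "\<dots> \<le> 2 * exp (- (real R * \<eta>\<^sup>2 / 2))"
      unfolding fails_def by (rule hoeffding_abs) (use assms in auto)
    finally show "fails (map_pmf (\<lambda>bs. (zeros bs, \<gamma>) # cs) (replicate_pmf R (parity_pmf n f \<gamma>))) (I es) \<le> 2 * exp (- (real R * \<eta>\<^sup>2 / 2))" .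
  qed (use assms in \<open>auto simp: I_def\<close>)
  moreover have "fails (score_all n f R L) (\<lambda>cs. \<forall>a\<in>set cs. score_ok n f R \<eta> a) \<le> fails (score_all n f R L) (I [])"
    by (rule fails_mono) (simp add: I_def)
  ultimately show ?thesis by linarith
qed

text \<open>The outcome bit that a true reply produces; by the fourth moment identity the mean of
  its sign is the total of the fourth powers.\<close>

definition truth :: "(bit list \<Rightarrow> real) \<Rightarrow> challenge \<Rightarrow> bit" where
  "truth f = (\<lambda>(x, y, z, b). lab f x + lab f y + lab f z + lab f (vadd x (vadd y z)))"

abbreviation total4 :: "nat \<Rightarrow> (bit list \<Rightarrow> real) \<Rightarrow> real" where
  "total4 n f \<equiv> (\<Sum>\<gamma>\<in>cube n. fourier n f \<gamma> ^ 4)"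

lemma finite_challenge [simp]: "finite (set_pmf (challenge_pmf n))"
  by (auto simp: challenge_pmf_def)

lemma expect_truth:
  assumes "sign_valued n f"
  shows "expect (challenge_pmf n) (\<lambda>r. sgb (truth f r)) = total4 n f"
proof -
  have "expect (challenge_pmf n) (\<lambda>r. sgb (truth f r)) = expect (unif n) (\<lambda>x. expect (unif n) (\<lambda>y. expect (unif n) (\<lambda>z.
     sgb (lab f x + lab f y + lab f z + lab f (vadd x (vadd y z))))))"
    unfolding challenge_pmf_def by (simp add: expect_bind truth_def)
  also have "\<dots> = expect (unif n) (\<lambda>x. expect (unif n) (\<lambda>y. expect (unif n) (\<lambda>z. f x * f y * f z * f (vadd x (vadd y z)))))"
    using assms by (intro expect_unif_cong) (simp add: sgb_add sgb_lab del: insert_iff)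
  finally show ?thesis by (simp add: fourth_moment)
qed

lemma fails_truth:
  assumes "sign_valued n f" "\<eta> \<ge> 0"
  shows "fails (replicate_pmf R (challenge_pmf n)) (\<lambda>rs. \<bar>(\<Sum>r\<leftarrow>rs. sgb (truth f r)) - real R * total4 n f\<bar> \<le> real R * \<eta>)
    \<le> 2 * exp (- (real R * \<eta>\<^sup>2 / 2))"
  unfolding fails_def expect_truth[OF assms(1), symmetric] by (rule hoeffding_abs) (use assms in auto)

section \<open>Undetected lies about the fourth point\<close>

primrec wlies :: "(bit list \<Rightarrow> real) \<Rightarrow> challenge list \<Rightarrow> bit list \<Rightarrow> nat" where
  "wlies f [] m = 0"
| "wlies f (r # rs) m = (case r of (x, y, z, b) \<Rightarrow> if reply_w b m = lab f (vadd x (vadd y z)) then 0 else 1) + wlies f rs (drop 2 m)"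

text \<open>A wrong reply flips one sign and lowers the sum by at most 2. Soundness needs only this
  direction, as lies that raise the sum make acceptance harder.\<close>

lemma outcomes_truth:
  "(\<Sum>r\<leftarrow>rs. sgb (truth f r)) - 2 * real (wlies f rs m) \<le> real (zeros (outcomes f rs m)) - real (ones (outcomes f rs m))"
proof -
  have ge: "- 1 \<le> sgb b" "sgb b \<le> 1" for b by (auto simp: sgb_def)
  have "(\<Sum>r\<leftarrow>rs. sgb (truth f r)) - 2 * real (wlies f rs m) \<le> (\<Sum>b\<leftarrow>outcomes f rs m. sgb b)"
  proof (induction rs arbitrary: m)
    case (Cons r rs)
    obtain x y z b where r: "r = (x, y, z, b)" by (cases r)
    show ?case
    proof (cases "reply_w b m = lab f (vadd x (vadd y z))")
      case True
      then show ?thesis using Cons[of "drop 2 m"] by (simp add: r truth_def add_ac)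
    next
      case False
      then show ?thesis using Cons[of "drop 2 m"] ge(2)[of "truth f r"] ge(1)[of "reply_w b m + lab f x + lab f y + lab f z"]
        by (simp add: r)
    qed
  qed simp
  then show ?thesis by (simp add: sum_list_sgb)
qed

text \<open>\<open>passing\<close> and \<open>cheats\<close> describe the check and the undetected lies in terms of what the prover sees
  and the coins that remain hidden from it.\<close>

primrec passing :: "(bit list \<Rightarrow> real) \<Rightarrow> (bit list \<times> bit list) list \<Rightarrow> bit list \<Rightarrow> bit list \<Rightarrow> bool" where
  "passing f [] bs m = True"
| "passing f (p # ps) bs m = (reply_z (hd bs) m = lab f (if hd bs = 1 then fst p else snd p) \<and> passing f ps (tl bs) (drop 2 m))"

primrec cheats :: "(bit list \<Rightarrow> real) \<Rightarrow> (bit list \<times> bit list) list \<Rightarrow> bit list \<Rightarrow> bit list \<Rightarrow> nat" where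
  "cheats f [] bs m = 0"
| "cheats f (p # ps) bs m = (if reply_w (hd bs) m = lab f (if hd bs = 1 then snd p else fst p) then 0 else 1) + cheats f ps (tl bs) (drop 2 m)"

definition side :: "challenge \<Rightarrow> bit" where "side r = snd (snd (snd r))"

lemma consistent_passing: "consistent f rs m \<longleftrightarrow> passing f (map shown rs) (map side rs) m"
  by (induction rs arbitrary: m) (auto simp: shown_def side_def)

lemma wlies_cheats: "wlies f rs m = cheats f (map shown rs) (map side rs) m"
  by (induction rs arbitrary: m) (auto simp: shown_def side_def)

text \<open>An exponential potential, with the reply \<open>m\<close> fixed while the hidden bits
  are random. For one pair the bit decides which of the two answers is checked: two true answers
  give the factors 1 and 1, a single lie gives 0 if it is checked and 2 if it is not, and two lies
  give 0 and 0. The average never exceeds 1, and the pairs multiply by independence.\<close>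

lemma expect_cheats:
  "expect (replicate_pmf (length ps) coin) (\<lambda>bs. if passing f ps bs m then 2 ^ cheats f ps bs m else 0) \<le> 1"
proof (induction ps arbitrary: m)
  case (Cons p ps)
  let ?h = "\<lambda>b. if reply_z b m = lab f (if b = 1 then fst p else snd p) then (if reply_w b m = lab f (if b = 1 then snd p else fst p) then 1 else 2) else 0 :: real"
  let ?g = "\<lambda>bs. if passing f ps bs (drop 2 m) then 2 ^ cheats f ps bs (drop 2 m) else 0 :: real"
  let ?E = "expect (replicate_pmf (length ps) coin) ?g"
  have "expect (replicate_pmf (length (p # ps)) coin) (\<lambda>bs. if passing f (p # ps) bs m then 2 ^ cheats f (p # ps) bs m else 0) =
    expect (bind_pmf coin (\<lambda>b. map_pmf (\<lambda>bs. b # bs) (replicate_pmf (length ps) coin)))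
      (\<lambda>bs. if passing f (p # ps) bs m then 2 ^ cheats f (p # ps) bs m else 0)"
    by (simp add: map_pmf_def)
  also have "\<dots> = expect coin (\<lambda>b. expect (replicate_pmf (length ps) coin)
      (\<lambda>bs. if passing f (p # ps) (b # bs) m then 2 ^ cheats f (p # ps) (b # bs) m else 0))"
    by (simp add: expect_bind del: passing.simps cheats.simps)
  also have "\<dots> = expect coin (\<lambda>b. expect (replicate_pmf (length ps) coin) (\<lambda>bs. ?h b * ?g bs))"
  proof -
    have "(if passing f (p # ps) (b # bs) m then 2 ^ cheats f (p # ps) (b # bs) m else 0) = ?h b * ?g bs" for b bs
      by simp
    then show ?thesis by presburger
  qed
  also have "\<dots> = expect coin (\<lambda>b. ?h b * ?E)"
    by simp
  also have "\<dots> = (?h 0 + ?h 1) / 2 * ?E"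
    by (subst integral_pmf_of_set) (auto simp: field_simps)
  also have "\<dots> \<le> 1 * 1"
  proof (rule mult_mono)
    show "(?h 0 + ?h 1) / 2 \<le> 1" by (auto simp: reply_z_def reply_w_def)
  qed (use Cons in \<open>auto intro!: integral_nonneg_AE\<close>)
  finally show ?case by simp
qed simp

text \<open>Markov's inequality for the potential: \<open>l\<close> undetected lies make it at least
  \<open>2 ^ l\<close>.\<close>

lemma fails_cheats:
  "fails (replicate_pmf (length ps) coin) (\<lambda>bs. passing f ps bs m \<longrightarrow> cheats f ps bs m < l) \<le> 1 / 2 ^ l"
proof -
  let ?p = "replicate_pmf (length ps) coin"
  let ?g = "\<lambda>bs. if passing f ps bs m then 2 ^ cheats f ps bs m else 0 :: real"
  have "fails ?p (\<lambda>bs. passing f ps bs m \<longrightarrow> cheats f ps bs m < l) \<le> measure ?p {bs. 2 ^ l \<le> ?g bs}"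
    unfolding fails_def by (rule measure_pmf.finite_measure_mono) (auto intro: power_increasing)
  also have "\<dots> \<le> expect ?p ?g / 2 ^ l"
    using integral_Markov_inequality_measure[of "measure_pmf ?p" ?g "{}" "2 ^ l"]
    by (simp add: integrable_measure_pmf_finite)
  also have "\<dots> \<le> 1 / 2 ^ l" by (intro divide_right_mono expect_cheats) simp
  finally show ?thesis .
qed

lemma map_replicate_pmf:
  fixes h :: "'a \<Rightarrow> 'b"
  shows "map_pmf (map h) (replicate_pmf m p) = replicate_pmf m (map_pmf h p)"
proof (induction m)
  case (Suc m)
  have rep: "replicate_pmf (Suc m) (q :: 'b pmf) = bind_pmf q (\<lambda>x. map_pmf (\<lambda>xs. x # xs) (replicate_pmf m q))" for q
    by (simp add: map_pmf_def)
  show ?case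
    unfolding rep[of "map_pmf h p"] bind_map_pmf Suc[symmetric]
    by (simp add: map_pmf_def bind_assoc_pmf bind_return_pmf)
qed simp

lemma replicate_pair_pmf:
  "replicate_pmf m (pair_pmf p q) = bind_pmf (replicate_pmf m p) (\<lambda>xs. bind_pmf (replicate_pmf m q) (\<lambda>ys. return_pmf (zip xs ys)))"
proof (induction m)
  case (Suc m)
  have "replicate_pmf (Suc m) (pair_pmf p q) = bind_pmf p (\<lambda>x. bind_pmf q (\<lambda>y. bind_pmf (replicate_pmf m p) (\<lambda>xs.
     bind_pmf (replicate_pmf m q) (\<lambda>ys. return_pmf ((x, y) # zip xs ys)))))"
    unfolding replicate_pmf.simps(2) Suc by (simp add: pair_pmf_def bind_assoc_pmf bind_return_pmf)
  also have "\<dots> = bind_pmf p (\<lambda>x. bind_pmf (replicate_pmf m p) (\<lambda>xs. bind_pmf q (\<lambda>y.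
     bind_pmf (replicate_pmf m q) (\<lambda>ys. return_pmf ((x, y) # zip xs ys)))))"
    by (rule bind_pmf_cong, rule refl, rule bind_commute_pmf)
  finally show ?case by (simp add: bind_assoc_pmf bind_return_pmf)
qed (simp add: bind_return_pmf)

text \<open>For fixed x and z the map from y to the fourth point is its own inverse, hence a
  bijection of the cube. Therefore the fourth point is uniform and independent of x and z.\<close>

lemma vadd_involution:
  assumes "length x = length y" "length y = length z"
  shows "vadd x (vadd (vadd x (vadd y z)) z) = y"
  using assms
proof (induction x y z rule: list_induct3)
  case (Cons a x b y c z)
  have "a + (a + (b + c) + c) = b" by (cases a; cases b; cases c) simp_all
  then show ?case using Cons by simp
qed simp

lemma bind_unif_shift:
  assumes "x \<in> cube n" "z \<in> cube n"
  shows "bind_pmf (unif n) (\<lambda>y. g (vadd x (vadd y z))) = bind_pmf (unif n) g"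
proof -
  have "bij_betw (\<lambda>y. vadd x (vadd y z)) (cube n) (cube n)"
    by (rule bij_betw_byWitness[where f' = "\<lambda>y. vadd x (vadd y z)"])
       (use assms in \<open>auto simp: vadd_involution cube_def\<close>)
  then have "map_pmf (\<lambda>y. vadd x (vadd y z)) (unif n) = unif n"
    by (rule map_pmf_of_set_bij_betw) auto
  then have "bind_pmf (unif n) g = bind_pmf (map_pmf (\<lambda>y. vadd x (vadd y z)) (unif n)) g" by simp
  then show ?thesis by (simp add: bind_map_pmf)
qed

text \<open>The prover's view of a challenge is independent of the side on which the label is known.\<close>

lemma challenge_law:
  "map_pmf (\<lambda>r. (shown r, side r)) (challenge_pmf n) = pair_pmf (pair_pmf (unif n) (unif n)) coin"
proof -
  let ?r = "\<lambda>z w b. return_pmf (if b = 1 then (z, w) else (w, z), b)"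
  have "map_pmf (\<lambda>r. (shown r, side r)) (challenge_pmf n) =
    bind_pmf (unif n) (\<lambda>x. bind_pmf (unif n) (\<lambda>y. bind_pmf (unif n) (\<lambda>z. bind_pmf coin (?r z (vadd x (vadd y z))))))"
    by (simp add: challenge_pmf_def map_bind_pmf shown_def side_def)
  also have "\<dots> = bind_pmf (unif n) (\<lambda>x. bind_pmf (unif n) (\<lambda>z. bind_pmf (unif n) (\<lambda>y. bind_pmf coin (?r z (vadd x (vadd y z))))))"
    by (rule bind_pmf_cong, rule refl, rule bind_commute_pmf)
  \<comment> \<open>For fixed x and z the fourth point w is uniform and takes the place of y;
    afterwards x no longer occurs.\<close>
  also have "\<dots> = bind_pmf (unif n) (\<lambda>x. bind_pmf (unif n) (\<lambda>z. bind_pmf (unif n) (\<lambda>w. bind_pmf coin (?r z w))))"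
    by (intro bind_pmf_cong refl bind_unif_shift) auto
  also have "\<dots> = bind_pmf (unif n) (\<lambda>z. bind_pmf (unif n) (\<lambda>w. bind_pmf coin (?r z w)))"
    by simp
  also have "\<dots> = bind_pmf (unif n) (\<lambda>z. bind_pmf coin (\<lambda>b. bind_pmf (unif n) (\<lambda>w. ?r z w b)))"
    by (rule bind_pmf_cong, rule refl, rule bind_commute_pmf)
  also have "\<dots> = bind_pmf coin (\<lambda>b. bind_pmf (unif n) (\<lambda>z. bind_pmf (unif n) (\<lambda>w. ?r z w b)))"
    by (rule bind_commute_pmf)
  \<comment> \<open>Two independent uniform points have the same law in either order; this is what
    hides the bit.\<close>
  also have "\<dots> = bind_pmf coin (\<lambda>b. bind_pmf (unif n) (\<lambda>u. bind_pmf (unif n) (\<lambda>v. return_pmf ((u, v), b))))"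
  proof (rule bind_pmf_cong, rule refl)
    fix b :: bit
    show "bind_pmf (unif n) (\<lambda>z. bind_pmf (unif n) (\<lambda>w. ?r z w b)) = bind_pmf (unif n) (\<lambda>u. bind_pmf (unif n) (\<lambda>v. return_pmf ((u, v), b)))"
      by (cases b) (simp_all, rule bind_commute_pmf)
  qed
  also have "\<dots> = pair_pmf (pair_pmf (unif n) (unif n)) coin"
    unfolding pair_pmf_def
    by (subst bind_commute_pmf) (simp add: bind_assoc_pmf bind_return_pmf, rule bind_pmf_cong, rule refl, rule bind_commute_pmf)
  finally show ?thesis .
qed

text \<open>\<open>A\<close> maps the verifier's message to the prover's reply, so the reply depends
  on the challenges only through the points shown. By \<open>challenge_law\<close> the hidden bits
  are independent of these points, and \<open>fails_cheats\<close> holds for each fixed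
  reply.\<close>

lemma fails_lies:
  "fails (bind_pmf (replicate_pmf R (challenge_pmf n)) (\<lambda>rs. map_pmf (Pair rs) (A (message (map shown rs)))))
     (\<lambda>(rs, m). consistent f rs m \<longrightarrow> wlies f rs m < l) \<le> 1 / 2 ^ l"
proof -
  let ?P = "\<lambda>((ps, bs), m). passing f ps bs m \<longrightarrow> cheats f ps bs m < l"
  let ?U = "replicate_pmf R (pair_pmf (unif n) (unif n))" and ?C = "replicate_pmf R coin"
  let ?h = "\<lambda>rs. (map shown rs, map side rs)"
  have un: "?h rs = (map fst qs, map snd qs)" if "qs = map (\<lambda>r. (shown r, side r)) rs" for rs qs
    using that by (simp add: o_def)
  have "map_pmf ?h (replicate_pmf R (challenge_pmf n)) =
    map_pmf (\<lambda>qs. (map fst qs, map snd qs)) (map_pmf (map (\<lambda>r. (shown r, side r))) (replicate_pmf R (challenge_pmf n)))"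
    by (simp add: pmf.map_comp o_def)
  also have "\<dots> = bind_pmf ?U (\<lambda>ps. bind_pmf ?C (\<lambda>bs. return_pmf (map fst (zip ps bs), map snd (zip ps bs))))"
    unfolding map_replicate_pmf challenge_law replicate_pair_pmf[of R "pair_pmf (unif n) (unif n)" coin]
    by (simp add: map_bind_pmf)
  also have "\<dots> = bind_pmf ?U (\<lambda>ps. bind_pmf ?C (\<lambda>bs. return_pmf (ps, bs)))"
    by (intro bind_pmf_cong refl) (auto simp: set_replicate_pmf)
  finally have law: "map_pmf ?h (replicate_pmf R (challenge_pmf n)) = bind_pmf ?U (\<lambda>ps. bind_pmf ?C (\<lambda>bs. return_pmf (ps, bs)))" .
  have "fails (bind_pmf (replicate_pmf R (challenge_pmf n)) (\<lambda>rs. map_pmf (Pair rs) (A (message (map shown rs)))))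
     (\<lambda>(rs, m). consistent f rs m \<longrightarrow> wlies f rs m < l) =
    fails (map_pmf (\<lambda>(rs, m). (?h rs, m)) (bind_pmf (replicate_pmf R (challenge_pmf n)) (\<lambda>rs. map_pmf (Pair rs) (A (message (map shown rs)))))) ?P"
    unfolding fails_map by (simp add: case_prod_unfold consistent_passing wlies_cheats)
  also have "map_pmf (\<lambda>(rs, m). (?h rs, m)) (bind_pmf (replicate_pmf R (challenge_pmf n)) (\<lambda>rs. map_pmf (Pair rs) (A (message (map shown rs))))) =
    bind_pmf (map_pmf ?h (replicate_pmf R (challenge_pmf n))) (\<lambda>q. map_pmf (Pair q) (A (message (fst q))))"
    by (simp add: map_bind_pmf bind_map_pmf pmf.map_comp o_def)
  also have "\<dots> = bind_pmf ?U (\<lambda>ps. bind_pmf ?C (\<lambda>bs. bind_pmf (A (message ps)) (\<lambda>m. return_pmf ((ps, bs), m))))"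
    unfolding law by (simp add: bind_assoc_pmf bind_return_pmf map_pmf_def)
  \<comment> \<open>The hidden bits are now drawn last, when the reply is already fixed.\<close>
  also have "\<dots> = bind_pmf ?U (\<lambda>ps. bind_pmf (A (message ps)) (\<lambda>m. map_pmf (\<lambda>bs. ((ps, bs), m)) ?C))"
    unfolding map_pmf_def by (rule bind_pmf_cong, rule refl, rule bind_commute_pmf)
  also have "fails \<dots> ?P \<le> 0 + (0 + 1 / 2 ^ l)"
  proof (rule fails_bind[where P = "\<lambda>_. True"], simp add: fails_def, rule fails_bind[where P = "\<lambda>_. True"], simp add: fails_def)
    fix ps m assume "ps \<in> set_pmf ?U"
    then have "length ps = R" by (simp add: set_replicate_pmf)
    then show "fails (map_pmf (\<lambda>bs. ((ps, bs), m)) ?C) ?P \<le> 1 / 2 ^ l"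
      unfolding fails_map using fails_cheats[of ps f m l] by simp
  qed simp_all
  finally show ?thesis by simp
qed

section \<open>The selected candidates\<close>

lemma fold_max_step:
  "fold max_step cs (b, rest) = (b', rest') \<Longrightarrow> \<forall>r\<in>set rest. fst r \<le> fst b \<Longrightarrow>
    mset (b' # rest') = mset (b # rest) + mset cs \<and> (\<forall>r\<in>set rest'. fst r \<le> fst b')"
proof (induction cs arbitrary: b rest)
  case (Cons c cs)
  show ?case
  proof (cases "fst c \<le> fst b")
    case True
    then show ?thesis using Cons.IH[of b "c # rest"] Cons.prems by (simp add: max_step_def)
  next
    case False
    then show ?thesis using Cons.IH[of c "b # rest"] Cons.prems by (force simp: max_step_def)
  qed
qed auto

text \<open>\<open>max_step\<close> reorders the remaining candidates, hence the formulation with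
  multisets. Every round removes a maximum of what is left, so it dominates all that remains after
  later rounds as well.\<close>

lemma select_Some:
  "select t cs out = Some l \<Longrightarrow> \<exists>sel rest. mset cs = mset sel + mset rest \<and> l = rev (map snd sel) @ out \<and> length sel = t \<and>
     (\<forall>a\<in>set sel. \<forall>r\<in>set rest. fst r \<le> fst a)"
proof (induction t cs out rule: select.induct)
  case (1 cs out)
  then show ?case by (intro exI[of _ "[]"] exI[of _ cs]) auto
next
  case (3 t c cs out)
  obtain b rest1 where br: "fold max_step cs (c, []) = (b, rest1)" by fastforce
  then have ms: "mset (b # rest1) = mset (c # cs)" "\<forall>r\<in>set rest1. fst r \<le> fst b"
    using fold_max_step[OF br] by auto
  have "select t rest1 (snd b # out) = Some l" using 3(2) br by simp
  from 3(1)[OF br[symmetric], unfolded snd_conv, OF this] obtain sel rest where s: "mset rest1 = mset sel + mset rest"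
    "l = rev (map snd sel) @ snd b # out" "length sel = t" "\<forall>a\<in>set sel. \<forall>r\<in>set rest. fst r \<le> fst a"
    by blast
  have "set rest \<subseteq> set rest1" using s(1) by (metis mset_subset_eq_add_right set_mset_mono set_mset_mset)
  then show ?case using s ms
    by (intro exI[of _ "b # sel"] exI[of _ rest]) (auto simp flip: ms(1))
qed auto

lemma select_total: "t \<le> length cs \<Longrightarrow> select t cs out \<noteq> None"
proof (induction t cs out rule: select.induct)
  case (3 t c cs out)
  obtain b rest1 where br: "fold max_step cs (c, []) = (b, rest1)" by fastforce
  then have "length rest1 = length cs" using max_step_set[OF br] by simp
  then show ?case using 3 br by simp
qed auto

text \<open>Distinctness of the candidates turns the \<open>t\<close> selected entries into a set of
  \<open>t\<close> vectors.\<close>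

lemma verdict_Some:
  assumes v: "verdict t f R Q rs m cs = Some l" and d: "distinct (map snd cs)"
  shows "set l \<subseteq> snd ` set cs" "card (set l) = t"
    "\<And>\<alpha> \<beta>. \<alpha> \<in> snd ` set cs \<Longrightarrow> \<alpha> \<notin> set l \<Longrightarrow> \<beta> \<in> set l \<Longrightarrow> \<exists>a b. (a, \<alpha>) \<in> set cs \<and> (b, \<beta>) \<in> set cs \<and> a \<le> b"
proof -
  have "select t cs [] = Some l" using v by (auto simp: verdict_def split: if_splits)
  then obtain sel rest where s: "mset cs = mset sel + mset rest" "l = rev (map snd sel)" "length sel = t"
    "\<forall>a\<in>set sel. \<forall>r\<in>set rest. fst r \<le> fst a"
    using select_Some[of t cs "[]" l] by auto
  have set: "set cs = set sel \<union> set rest"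
    using s(1) by (metis set_mset_mset set_mset_union)
  show "set l \<subseteq> snd ` set cs" unfolding s(2) set by auto
  have "mset (map snd cs) = mset (map snd sel @ map snd rest)" using s(1) by simp
  then have "distinct (map snd sel @ map snd rest)" using d by (metis mset_eq_imp_distinct_iff)
  then show "card (set l) = t" using s by (simp add: distinct_card flip: set_map)
  fix \<alpha> \<beta> assume "\<alpha> \<in> snd ` set cs" "\<alpha> \<notin> set l" "\<beta> \<in> set l"
  then obtain a b where "(a, \<alpha>) \<in> set rest" "(b, \<beta>) \<in> set sel" unfolding set s(2) by force
  then show "\<exists>a b. (a, \<alpha>) \<in> set cs \<and> (b, \<beta>) \<in> set cs \<and> a \<le> b"
    using s(4) set by fastforce
qed

lemma sum_scores:
  assumes "map snd cs = rev L" "distinct L"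
  shows "(\<Sum>(c, \<gamma>)\<leftarrow>cs. F \<gamma>) = (\<Sum>\<gamma>\<in>set L. F \<gamma> :: real)"
proof -
  have "(\<Sum>(c, \<gamma>)\<leftarrow>cs. F \<gamma>) = (\<Sum>\<gamma>\<leftarrow>map snd cs. F \<gamma>)" by (simp add: o_def case_prod_unfold)
  also have "\<dots> = (\<Sum>\<gamma>\<in>set L. F \<gamma>)"
    unfolding assms(1) using assms(2) by (subst sum_list_distinct_conv_sum_set) auto
  finally show ?thesis .
qed

lemma sum_list_score_bounds:
  assumes "\<forall>a\<in>set cs. score_ok n f R \<eta> a"
  shows "(\<Sum>(c, \<gamma>)\<leftarrow>cs. 2 * real c - real R) \<le> (\<Sum>(c, \<gamma>)\<leftarrow>cs. real R * fourier n f \<gamma> ^ 4 + real R * \<eta>)"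
    "(\<Sum>(c, \<gamma>)\<leftarrow>cs. real R * fourier n f \<gamma> ^ 4 - real R * \<eta>) \<le> (\<Sum>(c, \<gamma>)\<leftarrow>cs. 2 * real c - real R)"
  using assms by (auto intro!: sum_list_mono simp: score_ok_def abs_le_iff)

text \<open>The counting test of the machine, rewritten over the reals; scores of at most
  \<open>R\<close> make the truncated subtraction exact.\<close>

lemma accept_iff:
  assumes "\<forall>(c, \<gamma>)\<in>set cs. c \<le> R"
  shows "zeros o' + (\<Sum>(c, \<gamma>)\<leftarrow>cs. R - c) \<le> Q + ones o' + (\<Sum>(c, \<gamma>)\<leftarrow>cs. c) \<longleftrightarrow>
    real (zeros o') - real (ones o') \<le> real Q + (\<Sum>(c, \<gamma>)\<leftarrow>cs. 2 * real c - real R)"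
proof -
  have "real (\<Sum>(c, \<gamma>)\<leftarrow>cs. c) - real (\<Sum>(c, \<gamma>)\<leftarrow>cs. R - c) = (\<Sum>(c, \<gamma>)\<leftarrow>cs. 2 * real c - real R)"
    using assms by (induction cs) auto
  then show ?thesis by linarith
qed

lemma residual:
  assumes "set L \<subseteq> cube n"
  shows "total4 n f = (\<Sum>\<gamma>\<in>set L. fourier n f \<gamma> ^ 4) + (\<Sum>\<gamma>\<in>cube n - set L. fourier n f \<gamma> ^ 4)"
  using sum.subset_diff[OF assms, of "\<lambda>\<gamma>. fourier n f \<gamma> ^ 4"] by simp

text \<open>Errors are controlled for fourth powers, whereas the goal concerns absolute values.
  Since (|v| + d)^4 \<ge> |v|^4 + d^4, a gap of d^4 between the former costs at most d for the
  latter.\<close>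

lemma root4_gap:
  fixes u v :: real
  assumes "u ^ 4 \<le> v ^ 4 + d ^ 4" "d \<ge> 0"
  shows "\<bar>u\<bar> \<le> \<bar>v\<bar> + d"
proof (rule ccontr)
  assume "\<not> \<bar>u\<bar> \<le> \<bar>v\<bar> + d"
  then have "(\<bar>v\<bar> + d) ^ 4 < \<bar>u\<bar> ^ 4" using assms(2) by (intro power_strict_mono) auto
  moreover have "\<bar>v\<bar> ^ 4 + d ^ 4 \<le> (\<bar>v\<bar> + d) ^ 4"
  proof -
    have "(\<bar>v\<bar> + d) ^ 4 = \<bar>v\<bar> ^ 4 + d ^ 4 + (4 * (\<bar>v\<bar> ^ 3 * d) + 6 * (\<bar>v\<bar>\<^sup>2 * d\<^sup>2) + 4 * (\<bar>v\<bar> * d ^ 3))"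
      by (simp add: eval_nat_numeral algebra_simps)
    then show ?thesis using assms(2) by simp
  qed
  ultimately show False using assms(1) by simp
qed

text \<open>The comparison part of \<open>eps_top\<close>, for a list; that the list lies in the
  cube is a property of every run and is shown separately.\<close>

definition near_top :: "nat \<Rightarrow> (bit list \<Rightarrow> real) \<Rightarrow> real \<Rightarrow> bit list list \<Rightarrow> bool" where
  "near_top n f \<delta> l \<longleftrightarrow> (\<forall>\<alpha>\<in>cube n - set l. \<forall>\<beta>\<in>set l. \<bar>fourier n f \<alpha>\<bar> \<le> \<bar>fourier n f \<beta>\<bar> + \<delta>)"

section \<open>Acceptance when all estimates are accurate\<close>

context
  fixes n G t :: nat and f :: "bit list \<Rightarrow> real" and L :: "bit list list" and cs :: "(nat \<times> bit list) list"
    and rs :: "challenge list" and m :: "bit list" and g :: real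
  assumes f: "sign_valued n f" and G: "G \<ge> 10" and L: "distinct L" "set L \<subseteq> cube n" "length L \<le> G ^ 16"
    and cs: "map snd cs = rev L" "\<forall>(c, \<gamma>)\<in>set cs. c \<le> G ^ 64"
    and ok: "\<forall>a\<in>set cs. score_ok n f (G ^ 64) (1 / g ^ 28) a"
    and tr: "\<bar>(\<Sum>r\<leftarrow>rs. sgb (truth f r)) - real (G ^ 64) * total4 n f\<bar> \<le> real (G ^ 64) * (1 / g ^ 28)"
    and g: "g = real G"
begin

lemma g10: "g \<ge> 10" using G g by simp

lemma Reta: "g ^ 64 * (1 / g ^ 28) = g ^ 36"
  using g10 by (simp add: field_simps flip: power_add)

lemma R_pos: "real (G ^ 64) = g ^ 64"
  by (simp add: g)

lemma length_cs: "length cs \<le> G ^ 16"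
proof -
  have "length (map snd cs) = length L" unfolding cs by simp
  then show ?thesis using L by simp
qed

text \<open>A selected score is at least as large as an unselected one. With an error of G^36 on
  either side, the scaled fourth powers differ in the wrong direction by at most 2 * G^36, which is
  below G^64 * (1 / (3 * G))^4. The resulting gap is small enough for completeness and for
  soundness.\<close>

lemma in_L_gap:
  assumes v: "verdict t f (G ^ 64) Q rs m cs = Some l" and \<alpha>: "\<alpha> \<in> set L" "\<alpha> \<notin> set l" and \<beta>: "\<beta> \<in> set l"
  shows "\<bar>fourier n f \<alpha>\<bar> \<le> \<bar>fourier n f \<beta>\<bar> + 1 / (3 * g)"
proof (rule root4_gap)
  have d: "distinct (map snd cs)" "snd ` set cs = set L" using L cs(1) by (auto simp flip: set_map)
  obtain a b where ab: "(a, \<alpha>) \<in> set cs" "(b, \<beta>) \<in> set cs" "a \<le> b"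
    using verdict_Some(3)[OF v d(1), unfolded d(2), OF \<alpha> \<beta>] by blast
  have "g ^ 64 * fourier n f \<alpha> ^ 4 - g ^ 36 \<le> 2 * real a - g ^ 64"
    using bspec[OF ok ab(1)] unfolding score_ok_def prod.case Reta R_pos by linarith
  moreover have "2 * real b - g ^ 64 \<le> g ^ 64 * fourier n f \<beta> ^ 4 + g ^ 36"
    using bspec[OF ok ab(2)] unfolding score_ok_def prod.case Reta R_pos by linarith
  ultimately have "g ^ 64 * fourier n f \<alpha> ^ 4 \<le> g ^ 64 * fourier n f \<beta> ^ 4 + 2 * g ^ 36" using ab(3) by linarith
  also have "2 * g ^ 36 \<le> g ^ 64 * (1 / (3 * g)) ^ 4"
  proof -
    \<comment> \<open>The claim amounts to \<open>162 * g ^ 36 \<le> g ^ 60\<close>, where 162 = 2 *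
      3^4.\<close>
    have "10 ^ 24 \<le> g ^ 24" using g10 by (intro power_mono) auto
    then have "162 \<le> g ^ 24" by simp
    then have "162 * g ^ 36 \<le> g ^ 24 * g ^ 36" using g10 by (intro mult_right_mono) auto
    then have "2 * g ^ 36 \<le> g ^ 60 / 81" by (simp flip: power_add)
    also have "g ^ 60 / 81 = g ^ 64 * (1 / (3 * g)) ^ 4" using g10 by (simp add: power_divide power_mult_distrib field_simps flip: power_add)
    finally show ?thesis .
  qed
  finally have "g ^ 64 * fourier n f \<alpha> ^ 4 \<le> g ^ 64 * (fourier n f \<beta> ^ 4 + (1 / (3 * g)) ^ 4)" by (simp add: distrib_left)
  then show "fourier n f \<alpha> ^ 4 \<le> fourier n f \<beta> ^ 4 + (1 / (3 * g)) ^ 4"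
    using g10 by (simp add: mult_le_cancel_left)
qed (use g10 in simp)

text \<open>An error of G^36 for each of at most G^16 candidates adds up to at most G^52.\<close>

lemma score_sums:
  "(\<Sum>(c, \<gamma>)\<leftarrow>cs. 2 * real c - real (G ^ 64)) \<le> g ^ 64 * (\<Sum>\<gamma>\<in>set L. fourier n f \<gamma> ^ 4) + g ^ 52"
  "g ^ 64 * (\<Sum>\<gamma>\<in>set L. fourier n f \<gamma> ^ 4) - g ^ 52 \<le> (\<Sum>(c, \<gamma>)\<leftarrow>cs. 2 * real c - real (G ^ 64))"
proof -
  have lc: "real (length cs) * g ^ 36 \<le> g ^ 52"
  proof -
    have "real (length cs) \<le> real (G ^ 16)" using length_cs by (rule of_nat_mono)
    then have "real (length cs) \<le> g ^ 16" by (simp add: g)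
    then have "real (length cs) * g ^ 36 \<le> g ^ 16 * g ^ 36" using g10 by (intro mult_right_mono) auto
    then show ?thesis by (simp flip: power_add)
  qed
  have s: "(\<Sum>(c, \<gamma>)\<leftarrow>cs. g ^ 64 * fourier n f \<gamma> ^ 4) = g ^ 64 * (\<Sum>\<gamma>\<in>set L. fourier n f \<gamma> ^ 4)"
    unfolding sum_distrib_left using sum_scores[OF cs(1) L(1)] .
  have "(\<Sum>(c, \<gamma>)\<leftarrow>cs. g ^ 64 * fourier n f \<gamma> ^ 4 + g ^ 36) = g ^ 64 * (\<Sum>\<gamma>\<in>set L. fourier n f \<gamma> ^ 4) + real (length cs) * g ^ 36"
    unfolding s[symmetric] by (induction cs) (auto simp: algebra_simps)
  then show "(\<Sum>(c, \<gamma>)\<leftarrow>cs. 2 * real c - real (G ^ 64)) \<le> g ^ 64 * (\<Sum>\<gamma>\<in>set L. fourier n f \<gamma> ^ 4) + g ^ 52"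
    using sum_list_score_bounds(1)[OF ok] lc unfolding Reta R_pos by linarith
  have "(\<Sum>(c, \<gamma>)\<leftarrow>cs. g ^ 64 * fourier n f \<gamma> ^ 4 - g ^ 36) = g ^ 64 * (\<Sum>\<gamma>\<in>set L. fourier n f \<gamma> ^ 4) - real (length cs) * g ^ 36"
    unfolding s[symmetric] by (induction cs) (auto simp: algebra_simps)
  then show "g ^ 64 * (\<Sum>\<gamma>\<in>set L. fourier n f \<gamma> ^ 4) - g ^ 52 \<le> (\<Sum>(c, \<gamma>)\<leftarrow>cs. 2 * real c - real (G ^ 64))"
    using sum_list_score_bounds(2)[OF ok] lc unfolding Reta R_pos by linarith
qed

text \<open>Acceptance bounds the true total by the total over the list plus slack and errors, so
  the fourth powers outside the list sum to at most G^-4. Each coefficient outside is thus at most 1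
  / G in absolute value, which suffices against any \<beta>; within the list the scores
  decide.\<close>

lemma sound_det:
  assumes lies: "consistent f rs m \<longrightarrow> wlies f rs m < G" and v: "verdict t f (G ^ 64) (G ^ 56) rs m cs = Some l"
  shows "near_top n f (1 / g) l"
  unfolding near_top_def
proof (intro ballI)
  let ?o = "outcomes f rs m" and ?res = "\<Sum>\<gamma>\<in>cube n - set L. fourier n f \<gamma> ^ 4"
  fix \<alpha> \<beta> assume \<alpha>: "\<alpha> \<in> cube n - set l" and \<beta>: "\<beta> \<in> set l"
  show "\<bar>fourier n f \<alpha>\<bar> \<le> \<bar>fourier n f \<beta>\<bar> + 1 / g"
  proof (cases "\<alpha> \<in> set L")
    case True
    have "\<bar>fourier n f \<alpha>\<bar> \<le> \<bar>fourier n f \<beta>\<bar> + 1 / (3 * g)" using in_L_gap[OF v True _ \<beta>] \<alpha> by simp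
    also have "1 / (3 * g) \<le> 1 / g" using g10 by (intro divide_left_mono) auto
    finally show ?thesis by simp
  next
    case False
    have c: "consistent f rs m" and a: "zeros ?o + (\<Sum>(c, \<gamma>)\<leftarrow>cs. G ^ 64 - c) \<le> G ^ 56 + ones ?o + (\<Sum>(c, \<gamma>)\<leftarrow>cs. c)"
      using v by (auto simp: verdict_def split: if_splits)
    have "real (zeros ?o) - real (ones ?o) \<le> g ^ 56 + (\<Sum>(c, \<gamma>)\<leftarrow>cs. 2 * real c - real (G ^ 64))"
      using a unfolding accept_iff[OF cs(2)] by (simp add: g)
    moreover have "(\<Sum>r\<leftarrow>rs. sgb (truth f r)) - 2 * g \<le> real (zeros ?o) - real (ones ?o)"
      using outcomes_truth[of f rs m] lies c g by linarith
    moreover have "g ^ 64 * total4 n f - g ^ 36 \<le> (\<Sum>r\<leftarrow>rs. sgb (truth f r))"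
      using tr unfolding Reta R_pos by linarith
    ultimately have "g ^ 64 * ?res \<le> g ^ 56 + g ^ 36 + 2 * g + g ^ 52"
      using score_sums(1) unfolding residual[OF L(2)] distrib_left by linarith
    also have "\<dots> \<le> g ^ 60"
    proof -
      have "g ^ 36 \<le> g ^ 56" "g ^ 52 \<le> g ^ 56" "g ^ 1 \<le> g ^ 56" using g10 by (intro power_increasing; simp)+
      moreover have "5 * g ^ 56 \<le> g ^ 4 * g ^ 56"
      proof (rule mult_right_mono)
        have "10 ^ 4 \<le> g ^ 4" using g10 by (intro power_mono) auto
        then show "5 \<le> g ^ 4" by simp
      qed (use g10 in simp)
      moreover have "g ^ 4 * g ^ 56 = g ^ 60" by (simp flip: power_add)
      ultimately show ?thesis unfolding power_one_right by linarith
    qed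
    also have "g ^ 60 = g ^ 64 * (1 / g) ^ 4" using g10 by (simp add: power_divide field_simps flip: power_add)
    finally have res: "?res \<le> (1 / g) ^ 4" using g10 by (simp add: mult_le_cancel_left)
    have "fourier n f \<alpha> ^ 4 \<le> ?res" by (rule member_le_sum) (use \<alpha> False in auto)
    then have "\<bar>fourier n f \<alpha>\<bar> \<le> \<bar>0\<bar> + 1 / g" using res g10 by (intro root4_gap) auto
    then show ?thesis by simp
  qed
qed

text \<open>An honest list leaves out only squares below G^-10. Writing a fourth power as a square
  times a square and using Parseval, the rest is at most G^-10, and with the estimation errors this
  stays within the slack. An omitted coefficient is at most G^-5, hence below 1 / (3 * G).\<close>

lemma complete_det:
  assumes c: "consistent f rs m" and w: "real (zeros (outcomes f rs m)) - real (ones (outcomes f rs m)) = (\<Sum>r\<leftarrow>rs. sgb (truth f r))"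
    and t: "t \<le> length L" and heavy: "\<forall>\<gamma>\<in>cube n. (fourier n f \<gamma>)\<^sup>2 \<ge> 1 / g ^ 10 \<longrightarrow> \<gamma> \<in> set L"
  shows "\<exists>l. verdict t f (G ^ 64) (G ^ 56) rs m cs = Some l \<and> near_top n f (1 / (3 * g)) l"
proof -
  let ?o = "outcomes f rs m" and ?res = "\<Sum>\<gamma>\<in>cube n - set L. fourier n f \<gamma> ^ 4"
  have "?res \<le> (\<Sum>\<gamma>\<in>cube n - set L. 1 / g ^ 10 * (fourier n f \<gamma>)\<^sup>2)"
  proof (rule sum_mono)
    fix \<gamma> assume "\<gamma> \<in> cube n - set L"
    then have "(fourier n f \<gamma>)\<^sup>2 \<le> 1 / g ^ 10" using heavy by force
    then have "(fourier n f \<gamma>)\<^sup>2 * (fourier n f \<gamma>)\<^sup>2 \<le> 1 / g ^ 10 * (fourier n f \<gamma>)\<^sup>2" by (intro mult_right_mono) auto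
    then show "fourier n f \<gamma> ^ 4 \<le> 1 / g ^ 10 * (fourier n f \<gamma>)\<^sup>2" by (simp flip: power_add)
  qed
  also have "\<dots> \<le> (\<Sum>\<gamma>\<in>cube n. 1 / g ^ 10 * (fourier n f \<gamma>)\<^sup>2)" using g10 by (intro sum_mono2) auto
  also have "\<dots> = 1 / g ^ 10" by (simp only: sum_distrib_left[symmetric] parseval_sign[OF f] mult_1_right)
  finally have "g ^ 64 * ?res \<le> g ^ 64 * (1 / g ^ 10)" using g10 by (intro mult_left_mono) auto
  also have "g ^ 64 * (1 / g ^ 10) = g ^ 54" using g10 by (simp add: field_simps flip: power_add)
  finally have res: "g ^ 64 * ?res \<le> g ^ 54" .
  have num: "g ^ 54 + g ^ 36 + g ^ 52 \<le> g ^ 56"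
  proof -
    have "g ^ 36 \<le> g ^ 54" "g ^ 52 \<le> g ^ 54" using g10 by (intro power_increasing; simp)+
    moreover have "3 * g ^ 54 \<le> g ^ 2 * g ^ 54"
    proof (rule mult_right_mono)
      have "10 ^ 2 \<le> g ^ 2" using g10 by (intro power_mono) auto
      then show "3 \<le> g ^ 2" by simp
    qed (use g10 in simp)
    moreover have "g ^ 2 * g ^ 54 = g ^ 56" by (simp flip: power_add)
    ultimately show ?thesis by linarith
  qed
  have "(\<Sum>r\<leftarrow>rs. sgb (truth f r)) \<le> g ^ 64 * total4 n f + g ^ 36"
    using tr unfolding Reta R_pos by linarith
  then have "real (zeros ?o) - real (ones ?o) \<le> g ^ 56 + (\<Sum>(c, \<gamma>)\<leftarrow>cs. 2 * real c - real (G ^ 64))"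
    using score_sums(2) res num w unfolding residual[OF L(2)] distrib_left by linarith
  then have acc: "zeros ?o + (\<Sum>(c, \<gamma>)\<leftarrow>cs. G ^ 64 - c) \<le> G ^ 56 + ones ?o + (\<Sum>(c, \<gamma>)\<leftarrow>cs. c)"
    unfolding accept_iff[OF cs(2)] by (simp add: g)
  have "length (map snd cs) = length L" unfolding cs by simp
  then have "select t cs [] \<noteq> None" using t by (intro select_total) simp
  then obtain l where v: "verdict t f (G ^ 64) (G ^ 56) rs m cs = Some l"
    using c acc by (auto simp: verdict_def)
  have "near_top n f (1 / (3 * g)) l"
    unfolding near_top_def
  proof (intro ballI)
    fix \<alpha> \<beta> assume \<alpha>: "\<alpha> \<in> cube n - set l" and \<beta>: "\<beta> \<in> set l"
    show "\<bar>fourier n f \<alpha>\<bar> \<le> \<bar>fourier n f \<beta>\<bar> + 1 / (3 * g)"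
    proof (cases "\<alpha> \<in> set L")
      case True
      then show ?thesis using in_L_gap[OF v True _ \<beta>] \<alpha> by simp
    next
      case False
      then have "(fourier n f \<alpha>)\<^sup>2 \<le> 1 / g ^ 10" using heavy \<alpha> by force
      also have "1 / g ^ 10 \<le> 1 / (3 * g)\<^sup>2"
      proof (rule divide_left_mono)
        have "10 ^ 8 \<le> g ^ 8" using g10 by (intro power_mono) auto
        then have "9 * g ^ 2 \<le> g ^ 8 * g ^ 2" using g10 by (intro mult_right_mono) auto
        then show "(3 * g)\<^sup>2 \<le> g ^ 10" by (simp add: power_mult_distrib flip: power_add)
      qed (use g10 in auto)
      also have "\<dots> = (1 / (3 * g))\<^sup>2" by (simp add: power_divide)
      finally have "\<bar>fourier n f \<alpha>\<bar> \<le> 1 / (3 * g)" using g10 by (intro power2_le_imp_le[of "\<bar>_\<bar>"]) auto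
      then show ?thesis by simp
    qed
  qed
  then show ?thesis using v by blast
qed

end

text \<open>The terms bound the chances of at least G undetected lies, of a bad sample for the
  total, and of a bad score for one of at most G^16 candidates. Both Hoeffding exponents are G^64 *
  G^-56 / 2.\<close>

definition verifier_error :: "nat \<Rightarrow> real" where
  "verifier_error G = 1 / 2 ^ G + 2 * exp (- (real G ^ 8 / 2)) + real G ^ 16 * (2 * exp (- (real G ^ 8 / 2)))"

text \<open>The list is fixed before the challenges are drawn, and the examples for the scores are
  independent of the whole exchange, so the estimates keep their accuracy against every prover.
  \<open>A\<close> is the reply strategy that remains after the first message.\<close>

lemma fails_soundness:
  assumes f: "sign_valued n f" and G: "G \<ge> 10" and L: "distinct L" "set L \<subseteq> cube n" "length L \<le> G ^ 16"
  shows "fails (bind_pmf (replicate_pmf (G ^ 64) (challenge_pmf n)) (\<lambda>rs. bind_pmf (A (message (map shown rs)))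
     (\<lambda>m. map_pmf (verdict t f (G ^ 64) (G ^ 56) rs m) (score_all n f (G ^ 64) L))))
     (\<lambda>v. \<forall>l. v = Some l \<longrightarrow> near_top n f (1 / real G) l) \<le> verifier_error G"
proof -
  let ?g = "real G" and ?R = "G ^ 64" and ?\<eta> = "1 / real G ^ 28"
  let ?ch = "replicate_pmf ?R (challenge_pmf n)"
  let ?J = "bind_pmf ?ch (\<lambda>rs. map_pmf (Pair rs) (A (message (map shown rs))))"
  let ?e = "2 * exp (- (?g ^ 8 / 2))"
  have exp: "real ?R * ?\<eta>\<^sup>2 / 2 = ?g ^ 8 / 2" using G by (simp add: power_divide field_simps flip: power_mult power_add)
  let ?T = "\<lambda>rs. \<bar>(\<Sum>r\<leftarrow>rs. sgb (truth f r)) - real ?R * total4 n f\<bar> \<le> real ?R * ?\<eta>"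
  have 1: "fails ?J (\<lambda>(rs, m). ?T rs) \<le> ?e + 0"
  proof (rule fails_bind[where P = ?T])
    show "fails ?ch ?T \<le> ?e" using fails_truth[OF f, of ?\<eta> ?R] unfolding exp by simp
  qed (auto simp: fails_map fails_def)
  have 2: "fails ?J (\<lambda>(rs, m). consistent f rs m \<longrightarrow> wlies f rs m < G) \<le> 1 / 2 ^ G"
    by (rule fails_lies)
  have 3: "fails ?J (\<lambda>x. (case x of (rs, m) \<Rightarrow> ?T rs) \<and> (case x of (rs, m) \<Rightarrow> consistent f rs m \<longrightarrow> wlies f rs m < G)) \<le> 1 / 2 ^ G + ?e"
    using order_trans[OF fails_conj add_mono[OF 1 2]] by simp
  have 4: "fails (score_all n f ?R L) (\<lambda>cs. \<forall>a\<in>set cs. score_ok n f ?R ?\<eta> a) \<le> ?g ^ 16 * ?e"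
  proof -
    have "fails (score_all n f ?R L) (\<lambda>cs. \<forall>a\<in>set cs. score_ok n f ?R ?\<eta> a) \<le> real (length L) * ?e"
      using fails_score_all[OF f L(2), of ?\<eta> ?R] unfolding exp by simp
    also have "\<dots> \<le> real (G ^ 16) * ?e" using L(3) by (intro mult_right_mono of_nat_mono) auto
    finally show ?thesis by simp
  qed
  have eq: "bind_pmf ?ch (\<lambda>rs. bind_pmf (A (message (map shown rs))) (\<lambda>m. map_pmf (verdict t f ?R (G ^ 56) rs m) (score_all n f ?R L))) =
    bind_pmf ?J (\<lambda>(rs, m). map_pmf (verdict t f ?R (G ^ 56) rs m) (score_all n f ?R L))"
    by (simp add: bind_assoc_pmf bind_map_pmf)
  have "fails (bind_pmf ?J (\<lambda>(rs, m). map_pmf (verdict t f ?R (G ^ 56) rs m) (score_all n f ?R L)))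
     (\<lambda>v. \<forall>l. v = Some l \<longrightarrow> near_top n f (1 / ?g) l) \<le> (1 / 2 ^ G + ?e) + ?g ^ 16 * ?e"
  proof (rule fails_bind[OF 3])
    fix x assume x: "(case x of (rs, m) \<Rightarrow> ?T rs) \<and> (case x of (rs, m) \<Rightarrow> consistent f rs m \<longrightarrow> wlies f rs m < G)"
    obtain rs m where x': "x = (rs, m)" by (cases x)
    have "fails (map_pmf (verdict t f ?R (G ^ 56) rs m) (score_all n f ?R L)) (\<lambda>v. \<forall>l. v = Some l \<longrightarrow> near_top n f (1 / ?g) l)
      \<le> fails (score_all n f ?R L) (\<lambda>cs. \<forall>a\<in>set cs. score_ok n f ?R ?\<eta> a)"
      unfolding fails_map
    proof (rule fails_mono, intro allI impI)
      fix cs l assume "cs \<in> set_pmf (score_all n f ?R L)" and ok: "\<forall>a\<in>set cs. score_ok n f ?R ?\<eta> a"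
        and v: "verdict t f ?R (G ^ 56) rs m cs = Some l"
      then have cs: "map snd cs = rev L" "\<forall>(c, \<gamma>)\<in>set cs. c \<le> ?R" using set_score_all[of cs n f ?R L] by auto
      show "near_top n f (1 / ?g) l"
        by (rule sound_det[OF f G L cs ok _ refl _ v]) (use x[unfolded x' prod.case] in blast)+
    qed
    then show "fails (case x of (rs, m) \<Rightarrow> map_pmf (verdict t f ?R (G ^ 56) rs m) (score_all n f ?R L))
       (\<lambda>v. \<forall>l. v = Some l \<longrightarrow> near_top n f (1 / ?g) l) \<le> ?g ^ 16 * ?e"
      using 4 by (simp add: x')
  qed simp
  then show ?thesis unfolding eq verifier_error_def by simp
qed

lemma honest_replies:
  "consistent f rs (replies f (map shown rs)) \<and> outcomes f rs (replies f (map shown rs)) = map (truth f) rs"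
proof (induction rs)
  case (Cons r rs)
  obtain x y z b where r: "r = (x, y, z, b)" by (cases r)
  have d: "drop 2 (replies f (p # ps)) = replies f ps" for p ps by (simp add: replies_def case_prod_unfold)
  have h: "bhd (replies f (p # ps)) = lab f (fst p)" "bhd (tl (replies f (p # ps))) = lab f (snd p)" for p ps
    by (simp_all add: replies_def case_prod_unfold bhd_def)
  show ?case using Cons
    by (simp add: r d h reply_z_def reply_w_def shown_def truth_def add_ac)
qed simp

text \<open>True replies always pass the check and yield the true outcomes, so only the two
  estimates can fail. The error of the soundness case, which also contains the term for lies, serves
  as a common bound.\<close>

lemma fails_completeness:
  assumes f: "sign_valued n f" and G: "G \<ge> 10" and L: "distinct L" "set L \<subseteq> cube n" "length L \<le> G ^ 16"
    and t: "t \<le> length L" and heavy: "\<forall>\<gamma>\<in>cube n. (fourier n f \<gamma>)\<^sup>2 \<ge> 1 / real G ^ 10 \<longrightarrow> \<gamma> \<in> set L"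
  shows "fails (bind_pmf (replicate_pmf (G ^ 64) (challenge_pmf n)) (\<lambda>rs.
     map_pmf (verdict t f (G ^ 64) (G ^ 56) rs (replies f (map shown rs))) (score_all n f (G ^ 64) L)))
     (\<lambda>v. \<exists>l. v = Some l \<and> near_top n f (1 / (3 * real G)) l) \<le> verifier_error G"
proof -
  let ?g = "real G" and ?R = "G ^ 64" and ?\<eta> = "1 / real G ^ 28"
  let ?ch = "replicate_pmf ?R (challenge_pmf n)"
  let ?e = "2 * exp (- (?g ^ 8 / 2))"
  have exp: "real ?R * ?\<eta>\<^sup>2 / 2 = ?g ^ 8 / 2" using G by (simp add: power_divide field_simps flip: power_mult power_add)
  let ?T = "\<lambda>rs. \<bar>(\<Sum>r\<leftarrow>rs. sgb (truth f r)) - real ?R * total4 n f\<bar> \<le> real ?R * ?\<eta>"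
  have 1: "fails ?ch ?T \<le> ?e" using fails_truth[OF f, of ?\<eta> ?R] unfolding exp by simp
  have 4: "fails (score_all n f ?R L) (\<lambda>cs. \<forall>a\<in>set cs. score_ok n f ?R ?\<eta> a) \<le> ?g ^ 16 * ?e"
  proof -
    have "fails (score_all n f ?R L) (\<lambda>cs. \<forall>a\<in>set cs. score_ok n f ?R ?\<eta> a) \<le> real (length L) * ?e"
      using fails_score_all[OF f L(2), of ?\<eta> ?R] unfolding exp by simp
    also have "\<dots> \<le> real (G ^ 16) * ?e" using L(3) by (intro mult_right_mono of_nat_mono) auto
    finally show ?thesis by simp
  qed
  have "fails (bind_pmf ?ch (\<lambda>rs. map_pmf (verdict t f ?R (G ^ 56) rs (replies f (map shown rs))) (score_all n f ?R L)))
     (\<lambda>v. \<exists>l. v = Some l \<and> near_top n f (1 / (3 * ?g)) l) \<le> ?e + ?g ^ 16 * ?e"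
  proof (rule fails_bind[OF 1])
    fix rs assume T: "?T rs"
    let ?m = "replies f (map shown rs)"
    have w: "real (zeros (outcomes f rs ?m)) - real (ones (outcomes f rs ?m)) = (\<Sum>r\<leftarrow>rs. sgb (truth f r))"
      using honest_replies[of f rs] by (simp add: o_def flip: sum_list_sgb)
    have "fails (map_pmf (verdict t f ?R (G ^ 56) rs ?m) (score_all n f ?R L)) (\<lambda>v. \<exists>l. v = Some l \<and> near_top n f (1 / (3 * ?g)) l)
      \<le> fails (score_all n f ?R L) (\<lambda>cs. \<forall>a\<in>set cs. score_ok n f ?R ?\<eta> a)"
      unfolding fails_map
    proof (rule fails_mono)
      fix cs assume "cs \<in> set_pmf (score_all n f ?R L)" and ok: "\<forall>a\<in>set cs. score_ok n f ?R ?\<eta> a"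
      then have "map snd cs = rev L" "\<forall>(c, \<gamma>)\<in>set cs. c \<le> ?R" using set_score_all[of cs n f ?R L] by auto
      then show "\<exists>l. verdict t f ?R (G ^ 56) rs ?m cs = Some l \<and> near_top n f (1 / (3 * ?g)) l"
        using complete_det[OF f G L _ _ ok T refl _ w t heavy] honest_replies[of f rs] by blast
    qed
    then show "fails (map_pmf (verdict t f ?R (G ^ 56) rs ?m) (score_all n f ?R L)) (\<lambda>v. \<exists>l. v = Some l \<and> near_top n f (1 / (3 * ?g)) l) \<le> ?g ^ 16 * ?e"
      using 4 by linarith
  qed simp
  moreover have "0 \<le> 1 / (2 :: real) ^ G" by simp
  ultimately show ?thesis unfolding verifier_error_def by linarith
qed

text \<open>Everything is compared with e^G: from G^16 \<le> e^(16 G) and 4 \<le> e^G the exponent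
  17 G - G^8 / 2 remains, which is at most -G for G \<ge> 10, and 1 / e^G \<le> 1 / 2^G.\<close>

lemma verifier_error_le:
  assumes "G \<ge> 10"
  shows "verifier_error G \<le> 2 / 2 ^ G"
proof -
  let ?g = "real G"
  have g: "?g \<ge> 10" using assms by simp
  have ge1: "?g ^ 16 \<ge> 1" using g by simp
  have "2 * exp (- (?g ^ 8 / 2)) + ?g ^ 16 * (2 * exp (- (?g ^ 8 / 2))) \<le> ?g ^ 16 * (4 * exp (- (?g ^ 8 / 2)))"
    using mult_right_mono[OF ge1, of "2 * exp (- (?g ^ 8 / 2))"] by simp
  also have "\<dots> \<le> exp ?g ^ 16 * (exp ?g * exp (- (?g ^ 8 / 2)))"
  proof (intro mult_mono power_mono)
    show "?g \<le> exp ?g" using exp_ge_add_one_self[of ?g] by linarith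
    show "4 \<le> exp ?g" using exp_ge_add_one_self[of ?g] g by linarith
  qed (use g in auto)
  also have "\<dots> = exp (17 * ?g - ?g ^ 8 / 2)"
    by (simp flip: exp_of_nat_mult exp_add)
  also have "\<dots> \<le> exp (- ?g)"
  proof -
    have "10 ^ 7 \<le> ?g ^ 7" using g by (intro power_mono) auto
    then have "36 * ?g \<le> ?g ^ 7 * ?g" using g by (intro mult_right_mono) auto
    then show ?thesis by (simp flip: power_Suc2)
  qed
  also have "\<dots> = 1 / exp 1 ^ G" by (simp add: exp_minus field_simps flip: exp_of_nat_mult)
  also have "\<dots> \<le> 1 / 2 ^ G"
    using exp_ge_add_one_self[of 1] by (intro divide_left_mono power_mono) auto
  finally show ?thesis unfolding verifier_error_def by simp
qed

section \<open>Resource bounds\<close>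

text \<open>This class is closed under the arithmetic of the cost formulas, so polynomial bounds
  follow by decomposing the formulas instead of estimating them. The arguments are the inputs as the
  machine sees them, with \<open>N\<close> and \<open>D\<close> rounded.\<close>

definition poly_bounded :: "(nat \<Rightarrow> nat \<Rightarrow> nat \<Rightarrow> nat \<Rightarrow> nat) \<Rightarrow> bool" where
  "poly_bounded F \<longleftrightarrow> (\<exists>c d. \<forall>n t N D. F n t N D \<le> c * (1 + n + t + N + D) ^ d)"

lemma poly_boundedI: "(\<And>n t N D. F n t N D \<le> c * (1 + n + t + N + D) ^ d) \<Longrightarrow> poly_bounded F"
  unfolding poly_bounded_def by blast

lemma poly_bounded_const: "poly_bounded (\<lambda>n t N D. c)"
  by (rule poly_boundedI[where c = c and d = 0]) simp

lemma poly_bounded_var: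
  "poly_bounded (\<lambda>n t N D. n)" "poly_bounded (\<lambda>n t N D. t)" "poly_bounded (\<lambda>n t N D. N)" "poly_bounded (\<lambda>n t N D. D)"
  by (rule poly_boundedI[where c = 1 and d = 1]; simp)+

lemma poly_bounded_add:
  assumes "poly_bounded F" "poly_bounded F'"
  shows "poly_bounded (\<lambda>n t N D. F n t N D + F' n t N D)"
proof -
  obtain c d c' d' where F: "\<And>n t N D. F n t N D \<le> c * (1 + n + t + N + D) ^ d" "\<And>n t N D. F' n t N D \<le> c' * (1 + n + t + N + D) ^ d'"
    using assms unfolding poly_bounded_def by blast
  show ?thesis
  proof (rule poly_boundedI)
    fix n t N D :: nat
    let ?X = "1 + n + t + N + D"
    have "c * ?X ^ d \<le> c * ?X ^ (d + d')" "c' * ?X ^ d' \<le> c' * ?X ^ (d + d')"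
      by (intro mult_left_mono power_increasing; simp)+
    then have "F n t N D + F' n t N D \<le> c * ?X ^ (d + d') + c' * ?X ^ (d + d')"
      using F[of n t N D] by linarith
    then show "F n t N D + F' n t N D \<le> (c + c') * ?X ^ (d + d')" by (simp only: distrib_right)
  qed
qed

lemma poly_bounded_mult:
  assumes "poly_bounded F" "poly_bounded F'"
  shows "poly_bounded (\<lambda>n t N D. F n t N D * F' n t N D)"
proof -
  obtain c d c' d' where F: "\<And>n t N D. F n t N D \<le> c * (1 + n + t + N + D) ^ d" "\<And>n t N D. F' n t N D \<le> c' * (1 + n + t + N + D) ^ d'"
    using assms unfolding poly_bounded_def by blast
  show ?thesis
  proof (rule poly_boundedI)
    fix n t N D :: nat
    have "F n t N D * F' n t N D \<le> (c * (1 + n + t + N + D) ^ d) * (c' * (1 + n + t + N + D) ^ d')"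
      by (intro mult_mono F) auto
    then show "F n t N D * F' n t N D \<le> (c * c') * (1 + n + t + N + D) ^ (d + d')"
      by (simp only: power_add mult_ac)
  qed
qed

lemma poly_bounded_power: "poly_bounded F \<Longrightarrow> poly_bounded (\<lambda>n t N D. F n t N D ^ k)"
  by (induction k) (auto intro: poly_bounded_const poly_bounded_mult)

lemmas poly_bounded_intros = poly_bounded_const poly_bounded_var poly_bounded_add poly_bounded_mult poly_bounded_power

lemma poly_bounded_G: "poly_bounded (\<lambda>n t N D. big_g t N D)"
  unfolding big_g_def by (intro poly_bounded_intros)

lemma poly_bounded_Suc: "poly_bounded F \<Longrightarrow> poly_bounded (\<lambda>n t N D. Suc (F n t N D))"
  unfolding Suc_eq_plus1 by (intro poly_bounded_intros)

lemma poly_bounded_mcost: "poly_bounded F \<Longrightarrow> poly_bounded F' \<Longrightarrow> poly_bounded (\<lambda>n t N D. mcost (F n t N D) (F' n t N D))"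
  unfolding mcost_def by (intro poly_bounded_intros)

lemma poly_bounded_params: "poly_bounded (\<lambda>n t N D. params_cost n (big_g t N D))"
  unfolding params_cost_def by (intro poly_bounded_intros poly_bounded_mcost poly_bounded_G)

definition verifier_cost :: "nat \<Rightarrow> nat \<Rightarrow> nat \<Rightarrow> nat \<Rightarrow> nat" where
  "verifier_cost n t N D = (let G = big_g t N D in Suc (stage1_cost n G) + Suc (stage2_cost n t (G ^ 16) (G ^ 64)))"

definition prover_cost :: "nat \<Rightarrow> nat \<Rightarrow> nat \<Rightarrow> nat \<Rightarrow> nat" where
  "prover_cost n t N D = (let G = big_g t N D in Suc (pstage1_cost n G) + Suc (pstage2_cost n (G ^ 64)))"

definition verifier_asks :: "nat \<Rightarrow> nat \<Rightarrow> nat \<Rightarrow> nat \<Rightarrow> nat" where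
  "verifier_asks n t N D = (let G = big_g t N D in 3 * G ^ 64 + 4 * G ^ 16 * G ^ 64)"

definition message_sizes :: "nat \<Rightarrow> nat \<Rightarrow> nat \<Rightarrow> nat \<Rightarrow> nat" where
  "message_sizes n t N D = (let G = big_g t N D in G ^ 16 + 4 * G ^ 64)"

lemma poly_bounded_verifier_cost: "poly_bounded verifier_cost"
proof -
  have "poly_bounded (\<lambda>n t N D. verifier_cost n t N D)"
    unfolding verifier_cost_def Let_def stage1_cost_def stage2_cost_def parse_cost_def chall_cost_def score_cost_def select_cost_def
    by (intro poly_bounded_intros poly_bounded_Suc poly_bounded_params poly_bounded_G)
  then show ?thesis .
qed

lemma poly_bounded_prover_cost: "poly_bounded prover_cost"
proof -
  have "poly_bounded (\<lambda>n t N D. prover_cost n t N D)"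
    unfolding prover_cost_def Let_def pstage1_cost_def pstage2_cost_def search_cost_def level_cost_def test_cost_def
    by (intro poly_bounded_intros poly_bounded_Suc poly_bounded_params poly_bounded_G)
  then show ?thesis .
qed

lemma poly_bounded_verifier_asks: "poly_bounded verifier_asks"
proof -
  have "poly_bounded (\<lambda>n t N D. verifier_asks n t N D)"
    unfolding verifier_asks_def Let_def by (intro poly_bounded_intros poly_bounded_G)
  then show ?thesis .
qed

lemma poly_bounded_message_sizes: "poly_bounded message_sizes"
proof -
  have "poly_bounded (\<lambda>n t N D. message_sizes n t N D)"
    unfolding message_sizes_def Let_def by (intro poly_bounded_intros poly_bounded_G)
  then show ?thesis .
qed

abbreviation eps_in :: "real \<Rightarrow> nat" where "eps_in \<epsilon> \<equiv> nat \<lceil>1 / \<epsilon>\<rceil>"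
abbreviation delta_in :: "real \<Rightarrow> nat" where "delta_in \<delta> \<equiv> nat \<lceil>log 2 (1 / \<delta>)\<rceil>"

lemma nat_ceiling_le: "real (nat \<lceil>x\<rceil>) \<le> max 0 x + 1"
proof (cases "x \<ge> 0")
  case True
  then have "real (nat \<lceil>x\<rceil>) = real_of_int \<lceil>x\<rceil>" by simp
  then show ?thesis by linarith
next
  case False
  then have "nat \<lceil>x\<rceil> = 0" by simp
  then show ?thesis by simp
qed

text \<open>Rounding up adds at most 1 to each of the two real parameters, which the factor 3
  absorbs.\<close>

lemma param_size_ge:
  assumes "\<epsilon> > 0"
  shows "1 + real t + real (eps_in \<epsilon>) + real (delta_in \<delta>) \<le> 3 * param_size t \<epsilon> \<delta>" "1 \<le> param_size t \<epsilon> \<delta>"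
proof -
  have "real (eps_in \<epsilon>) \<le> 1 / \<epsilon> + 1" using nat_ceiling_le[of "1 / \<epsilon>"] assms by simp
  moreover have "real (delta_in \<delta>) \<le> max 0 (log 2 (1 / \<delta>)) + 1" by (rule nat_ceiling_le)
  moreover have "0 < 1 / \<epsilon>" using assms by simp
  moreover have "0 \<le> max 0 (log 2 (1 / \<delta>))" by simp
  ultimately have "1 + real t + real (eps_in \<epsilon>) + real (delta_in \<delta>) \<le> 3 * param_size t \<epsilon> \<delta> \<and> 1 \<le> param_size t \<epsilon> \<delta>"
    unfolding param_size_def by (intro conjI) (simp only: distrib_left; linarith)+
  then show "1 + real t + real (eps_in \<epsilon>) + real (delta_in \<delta>) \<le> 3 * param_size t \<epsilon> \<delta>" "1 \<le> param_size t \<epsilon> \<delta>" by auto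
qed

text \<open>Coefficient and exponent are merged into one constant that may be enlarged at will, so
  that several bounds can share it. Bounds without the dimension are obtained at
  \<open>n = 0\<close>.\<close>

lemma poly_bound_real:
  assumes "poly_bounded F"
  obtains c :: nat where "\<And>n t \<epsilon> \<delta> c'. \<epsilon> > 0 \<Longrightarrow> c \<le> c' \<Longrightarrow> real (F n t (eps_in \<epsilon>) (delta_in \<delta>)) \<le> time_bound c' n t \<epsilon> \<delta>"
    "\<And>t \<epsilon> \<delta> c'. \<epsilon> > 0 \<Longrightarrow> c \<le> c' \<Longrightarrow> real (F 0 t (eps_in \<epsilon>) (delta_in \<delta>)) \<le> sample_bound c' t \<epsilon> \<delta>"
proof -
  obtain a d where F: "\<And>n t N D. F n t N D \<le> a * (1 + n + t + N + D) ^ d"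
    using assms unfolding poly_bounded_def by blast
  define c where "c = a * 3 ^ d + d"
  have *: "real (F n t (eps_in \<epsilon>) (delta_in \<delta>)) \<le> real c' * (real n + param_size t \<epsilon> \<delta>) ^ c'" if "\<epsilon> > 0" "c \<le> c'" for n t \<epsilon> \<delta> c'
  proof -
    let ?Y = "real n + param_size t \<epsilon> \<delta>"
    let ?X = "1 + n + t + eps_in \<epsilon> + delta_in \<delta>"
    have Y: "1 \<le> ?Y" using param_size_ge(2)[OF that(1), of t \<delta>] by simp
    have X: "real ?X \<le> 3 * ?Y" using param_size_ge(1)[OF that(1), of t \<delta>] by simp
    have "real (F n t (eps_in \<epsilon>) (delta_in \<delta>)) \<le> real (a * ?X ^ d)" using F by (rule of_nat_mono)
    also have "\<dots> = real a * real ?X ^ d" by simp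
    also have "\<dots> \<le> real a * (3 * ?Y) ^ d" by (intro mult_left_mono power_mono X) auto
    also have "\<dots> = real (a * 3 ^ d) * ?Y ^ d" unfolding power_mult_distrib by simp
    also have "\<dots> \<le> real c' * ?Y ^ c'"
      using that(2) Y by (intro mult_mono of_nat_mono power_increasing) (auto simp: c_def)
    finally show ?thesis .
  qed
  show thesis
    by (rule that[of c]) (use * *[of _ _ 0] in \<open>auto simp: time_bound_def sample_bound_def\<close>)
qed

lemma delta_in_le:
  assumes "\<delta> > 0"
  shows "1 / 2 ^ delta_in \<delta> \<le> \<delta>"
proof -
  have "log 2 (1 / \<delta>) \<le> real (delta_in \<delta>)" by linarith
  then have "2 powr log 2 (1 / \<delta>) \<le> 2 powr real (delta_in \<delta>)" by (intro powr_mono) auto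
  then have "1 / \<delta> \<le> 2 ^ delta_in \<delta>" using assms by (simp add: powr_realpow)
  then show ?thesis using assms by (simp add: field_simps)
qed

lemma eps_in_le:
  assumes "\<epsilon> > 0"
  shows "1 / real (big_g t (eps_in \<epsilon>) D) \<le> \<epsilon>"
proof -
  have "1 / \<epsilon> \<le> real (eps_in \<epsilon>)" by linarith
  then have "1 / \<epsilon> \<le> real (big_g t (eps_in \<epsilon>) D)" by (simp add: big_g_def)
  moreover have "0 < real (big_g t (eps_in \<epsilon>) D)" by (simp add: big_g_def)
  ultimately show ?thesis using assms by (simp add: field_simps)
qed

text \<open>G exceeds \<open>D\<close>, so the factor 2 in the error is paid for by one more power
  of 2.\<close>

lemma verifier_error_delta:
  assumes "\<delta> > 0"
  shows "verifier_error (big_g t N (delta_in \<delta>)) \<le> \<delta>"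
proof -
  have "verifier_error (big_g t N D) \<le> 1 / 2 ^ D" for D
  proof -
    have "verifier_error (big_g t N D) \<le> 2 / 2 ^ big_g t N D" by (rule verifier_error_le) (simp add: big_g_def)
    also have "\<dots> \<le> 2 / 2 ^ Suc D" by (intro divide_left_mono power_increasing) (auto simp: big_g_def)
    finally show ?thesis by simp
  qed
  then show ?thesis using delta_in_le[OF assms] order_trans by blast
qed

lemma near_top_eps_top:
  "near_top n f \<eta> l \<Longrightarrow> set l \<subseteq> cube n \<Longrightarrow> \<eta> \<le> \<epsilon> \<Longrightarrow> eps_top n \<epsilon> f (set l)"
  unfolding near_top_def eps_top_def by force

section \<open>Candidate lists read from messages\<close>

lemma parse_distinct: "distinct L \<Longrightarrow> distinct (parse k n m L)"
  by (induction k arbitrary: m L) auto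

lemma parse_superset: "set L \<subseteq> set (parse k n m L)"
proof (induction k arbitrary: m L)
  case (Suc k)
  show ?case using Suc[of "List.insert (pop n m []) L" "drop n m"] by auto
qed simp

lemma pop_rev: "pop (length v) (v @ m) w = rev v @ w"
  by (induction v arbitrary: w) (auto simp: bhd_def)

text \<open>Reading further blocks only inserts more vectors, so every vector sent survives. A
  message of fewer than \<open>k\<close> blocks is filled up with the zero vector, hence an
  inclusion rather than an equality.\<close>

lemma parse_messages:
  assumes "length us \<le> k" "\<forall>u\<in>set us. length u = n"
  shows "set us \<subseteq> set (parse k n (concat (map rev us)) L)"
  using assms
proof (induction us arbitrary: k L)
  case (Cons u us)
  then obtain k' where k: "k = Suc k'" "length us \<le> k'" by (cases k) auto
  have "pop n (rev u @ concat (map rev us)) [] = u" using pop_rev[of "rev u"] Cons.prems by simp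
  moreover have "drop n (rev u @ concat (map rev us)) = concat (map rev us)" using Cons.prems by simp
  ultimately have "parse k n (concat (map rev (u # us))) L = parse k' n (concat (map rev us)) (List.insert u L)"
    by (simp add: k)
  then show ?case using Cons.IH[OF k(2), of "List.insert u L"] Cons.prems
    parse_superset[of "List.insert u L" k' n "concat (map rev us)"] by auto
qed simp

lemma list_message_concat: "list_message cur = concat (map rev (rev cur))"
proof -
  have "fold (\<lambda>\<alpha> m. rev \<alpha> @ m) cur m = concat (map rev (rev cur)) @ m" for m
    by (induction cur arbitrary: m) auto
  then show ?thesis by (simp add: list_message_def)
qed

definition candidates :: "nat \<Rightarrow> nat \<Rightarrow> bit list \<Rightarrow> bit list list" where
  "candidates G n m = parse (G ^ 16) n m []"

lemma candidates:
  "distinct (candidates G n m)" "set (candidates G n m) \<subseteq> cube n" "length (candidates G n m) \<le> G ^ 16"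
  using parse_distinct[of "[]" "G ^ 16" n m] parse_length[of "[]" n "G ^ 16" m] length_parse[of "G ^ 16" n m "[]"]
  by (auto simp: candidates_def cube_def)

lemma candidates_honest:
  assumes "length cur \<le> G ^ 16" "\<forall>\<alpha>\<in>set cur. length \<alpha> = n"
  shows "set cur \<subseteq> set (candidates G n (list_message cur))"
  using parse_messages[of "rev cur" "G ^ 16" n "[]"] assms by (simp add: candidates_def list_message_concat)

text \<open>There are n levels with at most G^16 suffixes each, two tests for every suffix, and a
  two-sided Hoeffding bound with exponent G^28 * (n + G) * G^-26 / 2. The summand n in the number of
  trials is what beats the union bound over the n levels.\<close>

definition search_error :: "nat \<Rightarrow> nat \<Rightarrow> real" where
  "search_error G n = real n * (real (G ^ 16) * (2 * (2 * exp (- (real G ^ 2 * (real n + real G) / 2)))))"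

text \<open>The threshold T / M is G^-12 and the accuracy G^-13. Suffixes of weight at least G^-10
  pass and those below G^-12 / 2 fail, so a list has at most 2 * G^12 entries of larger weight and
  at most \<open>t\<close> others, fewer than G^16 in all.\<close>

lemma fails_honest_search:
  assumes f: "sign_valued n f" and G: "G \<ge> 10" "t \<le> G"
  shows "fails (search_pmf n t (G ^ 16) (G ^ 28 * (n + G)) (G ^ 16 * (n + G)) f)
    (\<lambda>cur. distinct cur \<and> set cur \<subseteq> cube n \<and> length cur \<le> G ^ 16 \<and> min t (2 ^ n) \<le> length cur \<and>
     (\<forall>\<gamma>\<in>cube n. (fourier n f \<gamma>)\<^sup>2 \<ge> 1 / real G ^ 10 \<longrightarrow> \<gamma> \<in> set cur)) \<le> search_error G n"
proof -
  let ?g = "real G" and ?M = "G ^ 28 * (n + G)" and ?T = "G ^ 16 * (n + G)"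
  have g: "?g \<ge> 10" using G by simp
  have TM: "real ?T / real ?M = 1 / ?g ^ 12"
  proof -
    have T: "real ?T > 0" using G by simp
    have "real ?M = ?g ^ 12 * real ?T" by (simp flip: power_add mult.assoc)
    then show ?thesis using T g by (simp add: divide_simps)
  qed
  have e: "1 / ?g ^ 13 \<le> 1 / ?g ^ 12 / 10"
    using g by (simp add: field_simps power_add[of _ 12 1, simplified])
  have h: "1 / ?g ^ 12 \<le> 1 / ?g ^ 10 / 100"
  proof -
    have "100 * ?g ^ 10 \<le> ?g ^ 2 * ?g ^ 10"
      using power_mono[of 10 ?g 2] g by (intro mult_right_mono) auto
    then have "100 * ?g ^ 10 \<le> ?g ^ 12" by (simp flip: power_add)
    then show ?thesis using g by (simp add: field_simps)
  qed
  have p: "0 < 1 / ?g ^ 12" using g by simp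
  have add_small: "c \<le> a / 10 \<Longrightarrow> a \<le> b / 100 \<Longrightarrow> 0 < a \<Longrightarrow> a + c \<le> b" for a b c :: real by linarith
  have sub_small: "c \<le> a / 10 \<Longrightarrow> 0 < a \<Longrightarrow> a / 2 \<le> a - c" for a c :: real by linarith
  have hi: "real ?T / real ?M + 1 / ?g ^ 13 \<le> 1 / ?g ^ 10" unfolding TM by (rule add_small[OF e h p])
  have lo: "1 / ?g ^ 12 / 2 \<le> real ?T / real ?M - 1 / ?g ^ 13" unfolding TM by (rule sub_small[OF e p])
  have k: "real t + 1 / (1 / ?g ^ 12 / 2) < real (G ^ 16)"
  proof -
    have "real t \<le> ?g ^ 1" using G by simp
    also have "\<dots> \<le> ?g ^ 12" using g by (intro power_increasing) auto
    finally have "real t + 2 * ?g ^ 12 \<le> 3 * ?g ^ 12" by simp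
    also have "\<dots> < ?g ^ 4 * ?g ^ 12"
    proof (rule mult_strict_right_mono)
      have "10 ^ 4 \<le> ?g ^ 4" using g by (intro power_mono) auto
      then show "3 < ?g ^ 4" by simp
    qed (use g in simp)
    also have "\<dots> = ?g ^ 16" by (simp flip: power_add)
    finally show ?thesis by simp
  qed
  have tk: "t \<le> G ^ 16" using G self_le_power[of G 16] by simp
  have M: "?M > 0" using G by simp
  have E: "real ?M * (1 / ?g ^ 13)\<^sup>2 / 2 = ?g ^ 2 * (real n + ?g) / 2"
    using g by (simp add: power_divide field_simps flip: power_mult)
  show ?thesis
    unfolding search_error_def E[symmetric] by (rule fails_search[OF f M _ hi lo _ k tk]) (use p g in auto)
qed

text \<open>For fixed positive G the error is dominated by a constant times n * e^(-n/2).\<close>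

lemma search_error_tendsto: "(\<lambda>n. search_error G n) \<longlonglongrightarrow> 0"
proof (cases "G = 0")
  case False
  let ?C = "real (G ^ 16) * 4"
  have "(\<lambda>n. real n * exp (- 1 / 2) ^ n) \<longlonglongrightarrow> 0" by (rule powser_times_n_limit_0) simp
  moreover have "exp (- 1 / 2) ^ n = exp (- (real n / 2))" for n by (simp flip: exp_of_nat_mult)
  ultimately have "(\<lambda>n. real n * exp (- (real n / 2))) \<longlonglongrightarrow> 0" by simp
  then have lim: "(\<lambda>n. ?C * (real n * exp (- (real n / 2)))) \<longlonglongrightarrow> 0" by (rule tendsto_mult_right_zero)
  have le: "search_error G n \<le> ?C * (real n * exp (- (real n / 2)))" for n
  proof -
    have "1 * real n \<le> real G ^ 2 * (real n + real G)" using False by (intro mult_mono) auto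
    then have "exp (- (real G ^ 2 * (real n + real G) / 2)) \<le> exp (- (real n / 2))" by simp
    then have "?C * real n * exp (- (real G ^ 2 * (real n + real G) / 2)) \<le> ?C * real n * exp (- (real n / 2))"
      by (intro mult_left_mono) auto
    then show ?thesis unfolding search_error_def by (simp add: mult_ac)
  qed
  show ?thesis
  proof (rule tendsto_sandwich[OF _ _ tendsto_const lim])
    show "\<forall>\<^sub>F n in sequentially. 0 \<le> search_error G n" by (simp add: search_error_def)
    show "\<forall>\<^sub>F n in sequentially. search_error G n \<le> ?C * (real n * exp (- (real n / 2)))"
      by (intro always_eventually allI le)
  qed
qed (simp add: search_error_def)

section \<open>The interaction\<close>

lemma initial_store:
  "store (initial n t \<epsilon> \<delta>) 1 = unary n" "store (initial n t \<epsilon> \<delta>) 2 = unary t"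
  "store (initial n t \<epsilon> \<delta>) 3 = unary (eps_in \<epsilon>)" "store (initial n t \<epsilon> \<delta>) 4 = unary (delta_in \<delta>)"
  "store (initial n t \<epsilon> \<delta>) 50 = Nul" "steps (initial n t \<epsilon> \<delta>) = 0" "asks (initial n t \<epsilon> \<delta>) = 0"
  by (simp_all add: initial_def)

lemmas initial_store' = initial_store initial_store(1)[unfolded One_nat_def]

lemma set_challenge_pmf:
  assumes "r \<in> set_pmf (challenge_pmf n)"
  obtains x y z b where "r = (x, y, z, b)" "length x = n" "length y = n" "length z = n"
  using assms by (auto simp: challenge_pmf_def dest!: cubeD)

text \<open>Probabilities of results in the real interaction become probabilities in an abstract
  game. The further relation \<open>X\<close>, which in applications carries the resource bounds, is
  dropped here.\<close>

lemma measure_rel_spmf: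
  assumes "rel_spmf (\<lambda>v r. h r = k v \<and> X v r) (spmf_of_pmf p) I"
  shows "measure (measure_spmf I) {r. B (h r)} = measure p {v. B (k v)}"
proof -
  have "rel_spmf (\<lambda>v r. k v = h r) (spmf_of_pmf p) I"
    by (rule rel_spmf_mono[OF assms]) auto
  then have "rel_spmf (=) (map_spmf k (spmf_of_pmf p)) (map_spmf h I)"
    by (simp add: spmf_rel_map del: map_spmf_of_pmf)
  then have "map_spmf k (spmf_of_pmf p) = map_spmf h I" by (simp only: spmf_rel_eq)
  then have "measure (measure_spmf (map_spmf h I)) {x. B x} = measure (measure_spmf (map_spmf k (spmf_of_pmf p))) {x. B x}"
    by simp
  then show ?thesis by (simp add: measure_map_spmf vimage_def del: map_spmf_of_pmf)
qed

section \<open>Coupling the interaction with an abstract game\<close>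

context
  fixes n t :: nat and \<epsilon> \<delta> :: real and f :: "bit list \<Rightarrow> real"
  assumes n: "n \<ge> 1"
begin

abbreviation "D0 \<equiv> delta_in \<delta>"
abbreviation "N0 \<equiv> eps_in \<epsilon>"
abbreviation "G0 \<equiv> big_g t N0 D0"
abbreviation "ch \<equiv> replicate_pmf (G0 ^ 64) (challenge_pmf n)"
abbreviation "decide m1 rs m3 \<equiv> map_pmf (verdict t f (G0 ^ 64) (G0 ^ 56) rs m3) (score_all n f (G0 ^ 64) (candidates G0 n m1))"

definition after_stage1 :: "bit list \<Rightarrow> challenge list \<Rightarrow> bit list \<times> config \<Rightarrow> bool" where
  "after_stage1 m1 rs x \<longleftrightarrow> fst x = message (map shown rs) \<and> length rs = G0 ^ 64 \<and> (\<forall>r\<in>set rs. r \<in> set_pmf (challenge_pmf n)) \<and>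
     store (snd x) 2 = unary t \<and> store (snd x) 11 = unary (G0 ^ 64) \<and> store (snd x) 13 = unary (G0 ^ 56) \<and>
     store (snd x) 20 = enc_vecs (candidates G0 n m1) \<and> store (snd x) 30 = enc_list (map (enc_chall f) rs) \<and> store (snd x) 50 \<noteq> Nul \<and>
     steps (snd x) \<le> Suc (stage1_cost n G0) \<and> asks (snd x) \<le> 3 * G0 ^ 64"

lemma machine_stage1:
  "rel_spmf (after_stage1 m1) (spmf_of_pmf ch) (machine (examples n f) verifier (initial n t \<epsilon> \<delta>) m1)"
proof -
  let ?C = "initial n t \<epsilon> \<delta>"
  let ?R = "\<lambda>rs s'. s' 0 = enc_bits (message (map shown rs)) \<and> s' 2 = unary t \<and> s' 11 = unary (G0 ^ 64) \<and> s' 13 = unary (G0 ^ 56) \<and>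
      s' 20 = enc_vecs (parse (G0 ^ 16) n m1 []) \<and> s' 30 = enc_list (map (enc_chall f) rs) \<and> s' 50 \<noteq> Nul"
  have "triple (examples n f) verifier ((store ?C)(0 := enc_bits m1)) ch
    (\<lambda>rs s'. rs \<in> set_pmf ch \<and> ?R rs s') (Suc (stage1_cost n G0)) (3 * G0 ^ 64)"
    by (rule triple_weaken, rule verifier_stage1[where m = m1 and n = n and N = N0 and D = D0, OF _ _ _ _ _ _ refl])
       (simp_all add: initial_store')
  from rel_spmf_activate[OF this] have "rel_spmf (\<lambda>rs C'. after_stage1 m1 rs (dec_bits (store C' 0), C')) (spmf_of_pmf ch) (activate (examples n f) verifier ?C m1)"
    by (rule rel_spmf_mono) (auto simp: after_stage1_def initial_store candidates_def set_replicate_pmf)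
  then show ?thesis unfolding machine_def by (simp add: spmf_rel_map)
qed

lemma activate_stage2:
  assumes "after_stage1 m1 rs (m2, C)"
  shows "rel_spmf (\<lambda>v C'. dec_output (store C' 0) = map_option set v \<and> v \<in> set_pmf (decide m1 rs m3) \<and>
     steps C' \<le> verifier_cost n t N0 D0 \<and> asks C' \<le> verifier_asks n t N0 D0)
     (spmf_of_pmf (decide m1 rs m3)) (activate (examples n f) verifier C m3)"
proof -
  note a = assms[unfolded after_stage1_def fst_conv snd_conv]
  have "triple (examples n f) verifier ((store C)(0 := enc_bits m3)) (decide m1 rs m3)
    (\<lambda>v s'. v \<in> set_pmf (decide m1 rs m3) \<and> dec_output (s' 0) = map_option set v) (Suc (stage2_cost n t (G0 ^ 16) (G0 ^ 64))) (4 * G0 ^ 16 * G0 ^ 64)"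
    by (rule triple_weaken, rule verifier_stage2[where L = "candidates G0 n m1" and rs = rs and k = "G0 ^ 16"])
       (use a candidates[of G0 n m1] in \<open>auto simp: cube_def\<close>)
  from rel_spmf_activate[OF this] show ?thesis
    by (rule rel_spmf_mono) (use a in \<open>auto simp: verifier_cost_def verifier_asks_def Let_def\<close>)
qed

lemma set_decide:
  assumes "v \<in> set_pmf (decide m1 rs m3)" "v = Some l"
  shows "set l \<subseteq> cube n" "card (set l) = t"
proof -
  obtain cs where cs: "cs \<in> set_pmf (score_all n f (G0 ^ 64) (candidates G0 n m1))" "verdict t f (G0 ^ 64) (G0 ^ 56) rs m3 cs = Some l"
    using assms by auto
  have m: "map snd cs = rev (candidates G0 n m1)" using set_score_all[OF cs(1)] by simp
  then have d: "distinct (map snd cs)" "snd ` set cs = set (candidates G0 n m1)"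
    using candidates(1)[of G0 n m1] by (auto simp flip: set_map)
  show "set l \<subseteq> cube n" "card (set l) = t"
    using verdict_Some(1,2)[OF cs(2) d(1)] d(2) candidates(2)[of G0 n m1] by auto
qed

lemma length_message:
  "\<forall>r\<in>set rs. r \<in> set_pmf (challenge_pmf n) \<Longrightarrow> length (message (map shown rs)) = length rs * (2 * n)"
proof (induction rs)
  case (Cons r rs)
  obtain x y z b where r: "r = (x, y, z, b)" by (cases r)
  have "length x = n" "length y = n" "length z = n" using Cons.prems by (auto simp: r elim: set_challenge_pmf)
  moreover have "length (push_pair (u, v) m) = 2 * length u + length m" if "length u = length v" for u v m
  proof -
    have "length (interleave xs ys) = 2 * length xs" if "length xs = length ys" for xs ys
      using that by (induction xs ys rule: list_induct2) auto
    then show ?thesis using that by (simp add: push_pair_interleave)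
  qed
  ultimately show ?case using Cons by (auto simp: r shown_def)
qed simp

definition good_run :: "'s outcome \<Rightarrow> bit list list option \<Rightarrow> bool" where
  "good_run r v \<longleftrightarrow> (\<forall>l. v = Some l \<longrightarrow> set l \<subseteq> cube n \<and> card (set l) = t) \<and>
     steps (verifier_end r) \<le> verifier_cost n t N0 D0 \<and> asks (verifier_end r) \<le> verifier_asks n t N0 D0 \<and>
     length (msg2 r) \<le> n * message_sizes n t N0 D0"

text \<open>The prover's moves are coupled with themselves, so the prover stays arbitrary; only the
  verifier's activations are replaced by their abstract laws. The resource bounds of
  \<open>good_run\<close> travel along inside the relation.\<close>

lemma interact_rel:
  "rel_spmf (\<lambda>v r. result r = map_option set v \<and> good_run r v)
    (bind_spmf (P p0 []) (\<lambda>(m1, p1). bind_spmf (spmf_of_pmf ch) (\<lambda>rs.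
       bind_spmf (P p1 (message (map shown rs))) (\<lambda>(m3, p2). bind_spmf (spmf_of_pmf (decide m1 rs m3)) return_spmf))))
    (interact n t \<epsilon> \<delta> f verifier P p0)" (is "rel_spmf ?R _ _")
  unfolding interact_def
proof (rule rel_spmf_bind_reflI, goal_cases)
  case (1 x)
  obtain m1 p1 where x: "x = (m1, p1)" by (cases x)
  show ?case unfolding x prod.case
  proof (rule rel_spmf_bindI[OF machine_stage1], goal_cases)
    case (1 rs y)
    obtain m2 C where y: "y = (m2, C)" by (cases y)
    have s1: "after_stage1 m1 rs (m2, C)" using 1 unfolding y .
    then have m2: "m2 = message (map shown rs)" and rs: "length rs = G0 ^ 64" "\<forall>r\<in>set rs. r \<in> set_pmf (challenge_pmf n)"
      by (auto simp: after_stage1_def)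
    show ?case unfolding y prod.case m2[symmetric]
    proof (rule rel_spmf_bind_reflI, goal_cases)
      case (1 z)
      obtain m3 p2 where z: "z = (m3, p2)" by (cases z)
      show ?case unfolding z prod.case
      proof (rule rel_spmf_bindI[OF activate_stage2[OF s1]])
        fix v C' assume c: "dec_output (store C' 0) = map_option set v \<and> v \<in> set_pmf (decide m1 rs m3) \<and>
          steps C' \<le> verifier_cost n t N0 D0 \<and> asks C' \<le> verifier_asks n t N0 D0"
        have "length m2 \<le> n * message_sizes n t N0 D0"
          unfolding m2 length_message[OF rs(2)] rs(1) message_sizes_def Let_def by (simp add: algebra_simps)
        then have "good_run (Outcome p2 C' m1 m2 m3 (dec_output (store C' 0))) v"
          using c set_decide unfolding good_run_def outcome.sel by blast
        then show "rel_spmf ?R (return_spmf v) (return_spmf (Outcome p2 C' m1 m2 m3 (dec_output (store C' 0))))"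
          using c by simp
      qed
    qed
  qed
qed

definition after_pstage1 :: "bit list list \<Rightarrow> bit list \<times> config \<Rightarrow> bool" where
  "after_pstage1 cur x \<longleftrightarrow> fst x = list_message cur \<and> length cur \<le> G0 ^ 16 \<and> (\<forall>\<alpha>\<in>set cur. length \<alpha> = n) \<and>
     store (snd x) 1 = unary n \<and> store (snd x) 50 \<noteq> Nul \<and> steps (snd x) \<le> Suc (pstage1_cost n G0)"

abbreviation "search \<equiv> search_pmf n t (G0 ^ 16) (G0 ^ 28 * (n + G0)) (G0 ^ 16 * (n + G0)) f"

lemma machine_pstage1:
  "rel_spmf after_pstage1 (spmf_of_pmf search) (machine (queries n f) prover (initial n t \<epsilon> \<delta>) [])"
proof -
  let ?C = "initial n t \<epsilon> \<delta>" and ?s = "(store (initial n t \<epsilon> \<delta>))(0 := enc_bits [])"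
  have s: "?s 1 = unary n" "?s 2 = unary t" "?s 3 = unary N0" "?s 4 = unary D0" "?s 50 = Nul"
    by (simp_all add: initial_store')
  obtain q where q: "triple (queries n f) pstage1 ?s search
    (\<lambda>cur s'. s' 0 = enc_bits (list_message cur) \<and> length cur \<le> G0 ^ 16 \<and> (\<forall>\<alpha>\<in>set cur. length \<alpha> = n) \<and> s' 1 = unary n \<and> s' 50 \<noteq> Nul)
    (pstage1_cost n G0) q"
    using pstage1[of ?s n t N0 D0 G0 f, OF s(1-4) refl] by blast
  have "triple (queries n f) prover ?s search
    (\<lambda>cur s'. s' 0 = enc_bits (list_message cur) \<and> length cur \<le> G0 ^ 16 \<and> (\<forall>\<alpha>\<in>set cur. length \<alpha> = n) \<and> s' 1 = unary n \<and> s' 50 \<noteq> Nul)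
    (Suc (pstage1_cost n G0)) q"
    unfolding prover_def by (rule triple_Cond) (use q s(5) in simp)
  from rel_spmf_activate[OF this] have "rel_spmf (\<lambda>cur C'. after_pstage1 cur (dec_bits (store C' 0), C')) (spmf_of_pmf search) (activate (queries n f) prover ?C [])"
    by (rule rel_spmf_mono) (auto simp: after_pstage1_def initial_store)
  then show ?thesis unfolding machine_def by (simp add: spmf_rel_map)
qed

lemma machine_pstage2:
  assumes p: "after_pstage1 cur (m1, p1)" and rs: "length rs = G0 ^ 64" "\<forall>r\<in>set rs. r \<in> set_pmf (challenge_pmf n)"
  shows "rel_spmf (\<lambda>_ x. fst x = replies f (map shown rs) \<and> steps (snd x) \<le> prover_cost n t N0 D0)
     (spmf_of_pmf (return_pmf ())) (machine (queries n f) prover p1 (message (map shown rs)))"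
proof -
  note a = p[unfolded after_pstage1_def fst_conv snd_conv]
  have sh: "\<forall>(u, v)\<in>set (map shown rs). length u = n \<and> length v = n"
  proof -
    have "length (fst (shown r)) = n \<and> length (snd (shown r)) = n" if "r \<in> set_pmf (challenge_pmf n)" for r
      using that by (auto simp: shown_def elim!: set_challenge_pmf)
    then show ?thesis using rs(2) by (auto simp: case_prod_unfold)
  qed
  have "triple (queries n f) prover ((store p1)(0 := enc_bits (message (map shown rs)))) (return_pmf ())
     (\<lambda>_ s'. s' 0 = enc_bits (replies f (map shown rs))) (Suc (pstage2_cost n (length (map shown rs)))) (2 * length (map shown rs))"
    unfolding prover_def
    by (rule triple_Cond) (use pstage2[OF _ _ sh n] a in simp)
  from rel_spmf_activate[OF this]
  have "rel_spmf (\<lambda>_ C'. dec_bits (store C' 0) = replies f (map shown rs) \<and> steps C' \<le> prover_cost n t N0 D0)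
     (spmf_of_pmf (return_pmf ())) (activate (queries n f) prover p1 (message (map shown rs)))"
    by (rule rel_spmf_mono) (use a rs in \<open>auto simp: prover_cost_def Let_def\<close>)
  then show ?thesis unfolding machine_def by (simp add: spmf_rel_map)
qed

lemma length_list_message:
  assumes "\<forall>\<alpha>\<in>set cur. length \<alpha> = n"
  shows "length (list_message cur) = length cur * n"
proof -
  have "\<forall>\<alpha>\<in>set us. length \<alpha> = n \<Longrightarrow> length (concat (map rev us)) = length us * n" for us :: "bit list list"
    by (induction us) auto
  from this[of "rev cur"] show ?thesis using assms by (simp add: list_message_concat)
qed

definition honest_game :: "bit list list option pmf" where
  "honest_game = bind_pmf search (\<lambda>cur. bind_pmf ch (\<lambda>rs. decide (list_message cur) rs (replies f (map shown rs))))"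

lemma interact_honest_rel:
  "rel_spmf (\<lambda>v r. result r = map_option set v \<and> good_run r v \<and> steps (prover_end r) \<le> prover_cost n t N0 D0 \<and>
      length (msg1 r) + length (msg2 r) + length (msg3 r) \<le> n * message_sizes n t N0 D0)
    (spmf_of_pmf honest_game) (interact_honest n t \<epsilon> \<delta> f verifier prover)" (is "rel_spmf ?R _ _")
proof -
  \<comment> \<open>The one-point draw stands for the honest prover's second move, which is
    deterministic; it gives the game the same stages as the interaction.\<close>
  have eq: "spmf_of_pmf honest_game = bind_spmf (spmf_of_pmf search) (\<lambda>cur. bind_spmf (spmf_of_pmf ch) (\<lambda>rs.
     bind_spmf (spmf_of_pmf (return_pmf ())) (\<lambda>_. bind_spmf (spmf_of_pmf (decide (list_message cur) rs (replies f (map shown rs)))) return_spmf)))"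
    by (simp add: honest_game_def spmf_of_pmf_bind bind_return_pmf return_bind_spmf del: map_spmf_of_pmf)
  show ?thesis
    unfolding eq interact_def
  proof (rule rel_spmf_bindI[OF machine_pstage1], goal_cases)
    case (1 cur x)
    obtain m1 p1 where x: "x = (m1, p1)" by (cases x)
    have p: "after_pstage1 cur (m1, p1)" using 1 unfolding x .
    then have m1: "m1 = list_message cur" and cur: "length cur \<le> G0 ^ 16" "\<forall>\<alpha>\<in>set cur. length \<alpha> = n"
      by (auto simp: after_pstage1_def)
    show ?case unfolding x prod.case
    proof (rule rel_spmf_bindI[OF machine_stage1], goal_cases)
      case (1 rs y)
      obtain m2 C where y: "y = (m2, C)" by (cases y)
      have s1: "after_stage1 m1 rs (m2, C)" using 1 unfolding y .
      then have m2: "m2 = message (map shown rs)" and rs: "length rs = G0 ^ 64" "\<forall>r\<in>set rs. r \<in> set_pmf (challenge_pmf n)"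
        by (auto simp: after_stage1_def)
      show ?case unfolding y prod.case m2
      proof (rule rel_spmf_bindI[OF machine_pstage2[OF p rs]], goal_cases)
        case (1 u z)
        obtain m3 p2 where z: "z = (m3, p2)" by (cases z)
        have m3: "m3 = replies f (map shown rs)" and p2: "steps p2 \<le> prover_cost n t N0 D0" using 1 by (simp_all add: z)
        show ?case unfolding z prod.case m1[symmetric] m3[symmetric] m2[symmetric]
        proof (rule rel_spmf_bindI[OF activate_stage2[OF s1]])
          fix v C' assume c: "dec_output (store C' 0) = map_option set v \<and> v \<in> set_pmf (decide m1 rs m3) \<and>
            steps C' \<le> verifier_cost n t N0 D0 \<and> asks C' \<le> verifier_asks n t N0 D0"
          let ?R = "G0 ^ 64"
          have l2: "length m2 = n * (2 * ?R)" unfolding m2 length_message[OF rs(2)] rs(1) by simp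
          have "length m1 \<le> n * G0 ^ 16"
            using cur mult_right_mono[OF cur(1), of n] by (simp add: m1 length_list_message mult.commute)
          \<comment> \<open>The replies consist of two bits per challenge whatever the dimension is;
            charging them to a bound proportional to n uses \<open>n \<ge> 1\<close>.\<close>
          moreover have "length m3 \<le> n * (2 * ?R)"
            using n rs(1) mult_right_mono[OF n, of "2 * ?R"] by (simp add: m3 length_replies)
          moreover have "n * message_sizes n t N0 D0 = n * G0 ^ 16 + (n * (2 * ?R) + n * (2 * ?R))"
            by (simp add: message_sizes_def Let_def algebra_simps)
          ultimately have l: "length m1 + length m2 + length m3 \<le> n * message_sizes n t N0 D0" "length m2 \<le> n * message_sizes n t N0 D0"
            using l2 by linarith+
          then have "good_run (Outcome p2 C' m1 m2 m3 (dec_output (store C' 0))) v"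
            using c set_decide unfolding good_run_def outcome.sel by blast
          then show "rel_spmf (\<lambda>v r. result r = map_option set v \<and> good_run r v \<and> steps (prover_end r) \<le> prover_cost n t N0 D0 \<and>
              length (msg1 r) + length (msg2 r) + length (msg3 r) \<le> n * message_sizes n t N0 D0)
             (return_spmf v) (return_spmf (Outcome p2 C' m1 m2 m3 (dec_output (store C' 0))))"
            using c l p2 by simp
        qed
      qed
    qed
  qed
qed

end

section \<open>Error and resource bounds for complete interactions\<close>

lemma rel_spmf_setD:
  assumes "rel_spmf R p q" "r \<in> set_spmf q"
  shows "\<exists>v. R v r"
proof -
  obtain pq where "\<And>x y. (x, y) \<in> set_spmf pq \<Longrightarrow> R x y" "q = map_spmf snd pq"
    using assms(1) by (rule rel_spmfE) auto
  then show ?thesis using assms(2) by fastforce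
qed

lemma rel_spmf_lossless:
  assumes "rel_spmf R p q" "lossless_spmf p"
  shows "lossless_spmf q"
  using rel_spmf_weightD[OF assms(1)] assms(2) by (simp add: lossless_spmf_def)

lemma measure_fails: "measure (measure_pmf p) {x. P x} = 1 - fails p P"
proof -
  have "UNIV - {x. \<not> P x} = {x. P x}" by auto
  then show ?thesis using measure_pmf.prob_compl[of "{x. \<not> P x}" p] by (simp add: fails_def)
qed

text \<open>A prover that always answers is a family of \<open>pmf\<close>s, to which the calculus
  of failure probabilities applies.\<close>

lemma valid_prover_pmf:
  assumes "valid_prover P"
  obtains P' where "\<And>p m. P p m = spmf_of_pmf (P' p m)"
proof -
  have "\<forall>p m. \<exists>q. P p m = spmf_of_pmf q" using assms by (simp add: valid_prover_def lossless_spmf_conv_spmf_of_pmf)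
  then show thesis using that by metis
qed

context
  fixes n t :: nat and \<epsilon> \<delta> :: real and f :: "bit list \<Rightarrow> real"
  assumes n: "n \<ge> 1" and \<epsilon>: "\<epsilon> > 0" and \<delta>: "\<delta> > 0" and f: "sign_valued n f"
begin

abbreviation "G1 \<equiv> big_g t (eps_in \<epsilon>) (delta_in \<delta>)"

lemma G1: "G1 \<ge> 10" "t \<le> G1" "1 / real G1 \<le> \<epsilon>"
  using eps_in_le[OF \<epsilon>] by (auto simp: big_g_def)

definition adversary_game :: "(nat \<Rightarrow> bit list \<Rightarrow> (bit list \<times> nat) pmf) \<Rightarrow> nat \<Rightarrow> bit list list option pmf" where
  "adversary_game P p0 = bind_pmf (P p0 []) (\<lambda>(m1, p1). bind_pmf (replicate_pmf (G1 ^ 64) (challenge_pmf n)) (\<lambda>rs.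
     bind_pmf (map_pmf fst (P p1 (message (map shown rs)))) (\<lambda>m3.
       map_pmf (verdict t f (G1 ^ 64) (G1 ^ 56) rs m3) (score_all n f (G1 ^ 64) (candidates G1 n m1)))))"

lemma adversary_rel:
  assumes "\<And>p m. P p m = spmf_of_pmf (P' p m)"
  shows "rel_spmf (\<lambda>v r. result r = map_option set v \<and> good_run n t \<epsilon> \<delta> r v) (spmf_of_pmf (adversary_game P' p0)) (interact n t \<epsilon> \<delta> f verifier P p0)"
proof -
  have eq: "spmf_of_pmf (adversary_game P' p0) = bind_spmf (P p0 []) (\<lambda>(m1, p1). bind_spmf (spmf_of_pmf (replicate_pmf (G1 ^ 64) (challenge_pmf n))) (\<lambda>rs.
       bind_spmf (P p1 (message (map shown rs))) (\<lambda>(m3, p2). bind_spmf (spmf_of_pmf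
         (map_pmf (verdict t f (G1 ^ 64) (G1 ^ 56) rs m3) (score_all n f (G1 ^ 64) (candidates G1 n m1)))) return_spmf)))"
    unfolding assms adversary_game_def
    by (simp add: spmf_of_pmf_bind case_prod_unfold bind_map_pmf del: map_spmf_of_pmf)
  show ?thesis unfolding eq by (rule interact_rel[OF n])
qed

lemma set_verdict_cube:
  assumes "v \<in> set_pmf (map_pmf (verdict t f R Q rs m) (score_all n f R (candidates G1 n m1)))" "v = Some l"
  shows "set l \<subseteq> cube n"
proof -
  obtain cs where cs: "cs \<in> set_pmf (score_all n f R (candidates G1 n m1))" "verdict t f R Q rs m cs = Some l"
    using assms by auto
  have m: "map snd cs = rev (candidates G1 n m1)" using set_score_all[OF cs(1)] by simp
  then have d: "distinct (map snd cs)" "snd ` set cs = set (candidates G1 n m1)"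
    using candidates(1)[of G1 n m1] by (auto simp flip: set_map)
  show ?thesis using verdict_Some(1)[OF cs(2) d(1)] d(2) candidates(2)[of G1 n m1] by auto
qed

text \<open>For each first message and state of the prover, \<open>fails_soundness\<close> applies
  to the candidates read from this message, with the prover's next move as reply strategy. Averaging
  over them preserves the bound.\<close>

lemma adversary_fails: "fails (adversary_game P p0) (\<lambda>v. \<forall>l. v = Some l \<longrightarrow> eps_top n \<epsilon> f (set l)) \<le> \<delta>"
proof -
  have "fails (adversary_game P p0) (\<lambda>v. \<forall>l. v = Some l \<longrightarrow> eps_top n \<epsilon> f (set l)) \<le>
    fails (adversary_game P p0) (\<lambda>v. \<forall>l. v = Some l \<longrightarrow> near_top n f (1 / real G1) l)"
  proof (rule fails_mono, intro allI impI)
    fix v l assume v: "v \<in> set_pmf (adversary_game P p0)" and nt: "\<forall>l. v = Some l \<longrightarrow> near_top n f (1 / real G1) l" and l: "v = Some l"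
    obtain m1 rs m3 where "v \<in> set_pmf (map_pmf (verdict t f (G1 ^ 64) (G1 ^ 56) rs m3) (score_all n f (G1 ^ 64) (candidates G1 n m1)))"
      using v unfolding adversary_game_def by (auto simp: case_prod_unfold simp del: set_map_pmf)
    then have "set l \<subseteq> cube n" using l by (rule set_verdict_cube)
    then show "eps_top n \<epsilon> f (set l)" using near_top_eps_top[of n f "1 / real G1" l \<epsilon>] nt l G1(3) by blast
  qed
  also have "\<dots> \<le> 0 + \<delta>"
    unfolding adversary_game_def
  proof (rule fails_bind[where P = "\<lambda>_. True"], goal_cases)
    case (2 x)
    obtain m1 p1 where x: "x = (m1, p1)" by (cases x)
    show ?case
      unfolding x prod.case
      using fails_soundness[OF f G1(1) candidates, where A = "\<lambda>m. map_pmf fst (P p1 m)" and t = t] verifier_error_delta[OF \<delta>, of t "eps_in \<epsilon>"]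
      by (rule order_trans)
  qed (use \<delta> in \<open>auto simp: fails_def\<close>)
  finally show ?thesis by simp
qed

text \<open>For t \<le> 2^n a successful search sends at least \<open>t\<close> distinct vectors, so
  the verifier's list has enough entries for the selection. What remains are the failures of the
  search and of the verifier's estimates.\<close>

lemma honest_fails:
  assumes t: "t \<le> 2 ^ n"
  shows "fails (honest_game n t \<epsilon> \<delta> f) (\<lambda>v. \<exists>l. v = Some l \<and> eps_top n (\<epsilon> / 3) f (set l)) \<le> search_error G1 n + \<delta>"
proof -
  have G3: "1 / (3 * real G1) \<le> \<epsilon> / 3" using G1(3) by simp
  have "fails (honest_game n t \<epsilon> \<delta> f) (\<lambda>v. \<exists>l. v = Some l \<and> eps_top n (\<epsilon> / 3) f (set l)) \<le>
    fails (honest_game n t \<epsilon> \<delta> f) (\<lambda>v. \<exists>l. v = Some l \<and> near_top n f (1 / (3 * real G1)) l)"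
  proof (rule fails_mono)
    fix v assume v: "v \<in> set_pmf (honest_game n t \<epsilon> \<delta> f)" and "\<exists>l. v = Some l \<and> near_top n f (1 / (3 * real G1)) l"
    then obtain l where l: "v = Some l" "near_top n f (1 / (3 * real G1)) l" by blast
    obtain m1 rs m3 where "v \<in> set_pmf (map_pmf (verdict t f (G1 ^ 64) (G1 ^ 56) rs m3) (score_all n f (G1 ^ 64) (candidates G1 n m1)))"
      using v unfolding honest_game_def[OF n] by (auto simp: case_prod_unfold simp del: set_map_pmf)
    then have "set l \<subseteq> cube n" using l(1) by (rule set_verdict_cube)
    then show "\<exists>l. v = Some l \<and> eps_top n (\<epsilon> / 3) f (set l)" using near_top_eps_top[OF l(2) _ G3] l(1) by blast
  qed
  also have "\<dots> \<le> search_error G1 n + \<delta>"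
    unfolding honest_game_def[OF n]
  proof (rule fails_bind[OF fails_honest_search[OF f G1(1,2)]])
    fix cur assume *: "distinct cur \<and> set cur \<subseteq> cube n \<and> length cur \<le> G1 ^ 16 \<and> min t (2 ^ n) \<le> length cur \<and>
       (\<forall>\<gamma>\<in>cube n. 1 / real G1 ^ 10 \<le> (fourier n f \<gamma>)\<^sup>2 \<longrightarrow> \<gamma> \<in> set cur)"
    let ?L = "candidates G1 n (list_message cur)"
    have sub: "set cur \<subseteq> set ?L" by (rule candidates_honest) (use * in \<open>auto simp: cube_def\<close>)
    have "t \<le> length cur" using * t by simp
    also have "\<dots> = card (set cur)" using * by (simp add: distinct_card)
    also have "\<dots> \<le> length ?L" using card_mono[OF _ sub] card_length[of ?L] by simp
    finally have tL: "t \<le> length ?L" .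
    have heavy: "\<forall>\<gamma>\<in>cube n. 1 / real G1 ^ 10 \<le> (fourier n f \<gamma>)\<^sup>2 \<longrightarrow> \<gamma> \<in> set ?L" using * sub by blast
    show "fails (bind_pmf (replicate_pmf (G1 ^ 64) (challenge_pmf n)) (\<lambda>rs.
       map_pmf (verdict t f (G1 ^ 64) (G1 ^ 56) rs (replies f (map shown rs))) (score_all n f (G1 ^ 64) ?L)))
       (\<lambda>v. \<exists>l. v = Some l \<and> near_top n f (1 / (3 * real G1)) l) \<le> \<delta>"
      using fails_completeness[OF f G1(1) candidates tL heavy] verifier_error_delta[OF \<delta>, of t "eps_in \<epsilon>"]
      by (rule order_trans)
  qed (use \<delta> in simp)
  finally show ?thesis .
qed

end

lemma verifier_admissibleI:
  assumes n: "n \<ge> 1" and \<epsilon>: "\<epsilon> > 0"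
    and rel: "rel_spmf (\<lambda>v r. result r = map_option set v \<and> good_run n t \<epsilon> \<delta> r v) (spmf_of_pmf p) I"
    and c: "\<And>n t \<epsilon> \<delta>. \<epsilon> > 0 \<Longrightarrow> real (verifier_cost n t (eps_in \<epsilon>) (delta_in \<delta>)) \<le> time_bound c n t \<epsilon> \<delta>"
      "\<And>t \<epsilon> \<delta>. \<epsilon> > 0 \<Longrightarrow> real (verifier_asks 0 t (eps_in \<epsilon>) (delta_in \<delta>)) \<le> sample_bound c t \<epsilon> \<delta>"
      "\<And>t \<epsilon> \<delta>. \<epsilon> > 0 \<Longrightarrow> real (message_sizes 0 t (eps_in \<epsilon>) (delta_in \<delta>)) \<le> sample_bound c t \<epsilon> \<delta>"
  shows "verifier_admissible c n t \<epsilon> \<delta> I"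
  unfolding verifier_admissible_def
proof (intro conjI ballI)
  show "lossless_spmf I" by (rule rel_spmf_lossless[OF rel]) simp
  fix r assume "r \<in> set_spmf I"
  then obtain v where v: "result r = map_option set v" "good_run n t \<epsilon> \<delta> r v" using rel_spmf_setD[OF rel] by blast
  note g = v(2)[unfolded good_run_def[OF n]]
  \<comment> \<open>The number of asks is bounded independently of n, so the value at dimension 0
    serves for all n.\<close>
  have "real (asks (verifier_end r)) \<le> real (verifier_asks 0 t (eps_in \<epsilon>) (delta_in \<delta>))"
    using g by (intro of_nat_mono) (simp add: verifier_asks_def)
  then show "real (asks (verifier_end r)) \<le> sample_bound c t \<epsilon> \<delta>" using c(2)[OF \<epsilon>, of t \<delta>] by linarith
  have "real (steps (verifier_end r)) \<le> real (verifier_cost n t (eps_in \<epsilon>) (delta_in \<delta>))"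
    using g by (intro of_nat_mono) simp
  then show "real (steps (verifier_end r)) \<le> time_bound c n t \<epsilon> \<delta>" using c(1)[OF \<epsilon>, of n t \<delta>] by linarith
  have "real (length (msg2 r)) \<le> real n * real (message_sizes 0 t (eps_in \<epsilon>) (delta_in \<delta>))"
    using g by (simp add: message_sizes_def flip: of_nat_mult)
  also have "\<dots> \<le> comm_bound c n t \<epsilon> \<delta>"
    unfolding comm_bound_def using c(3)[OF \<epsilon>, of t \<delta>] by (intro mult_left_mono) (auto simp: sample_bound_def)
  finally show "real (length (msg2 r)) \<le> comm_bound c n t \<epsilon> \<delta>" .
  show "\<forall>\<Lambda>. result r = Some \<Lambda> \<longrightarrow> \<Lambda> \<subseteq> cube n \<and> card \<Lambda> = t"
    using g v(1) by auto
qed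

lemma honest_admissibleI:
  assumes n: "n \<ge> 1" and \<epsilon>: "\<epsilon> > 0"
    and rel: "rel_spmf (\<lambda>v r. result r = map_option set v \<and> good_run n t \<epsilon> \<delta> r v \<and> steps (prover_end r) \<le> prover_cost n t (eps_in \<epsilon>) (delta_in \<delta>) \<and>
      length (msg1 r) + length (msg2 r) + length (msg3 r) \<le> n * message_sizes n t (eps_in \<epsilon>) (delta_in \<delta>)) (spmf_of_pmf p) I"
    and c: "\<And>n t \<epsilon> \<delta>. \<epsilon> > 0 \<Longrightarrow> real (prover_cost n t (eps_in \<epsilon>) (delta_in \<delta>)) \<le> time_bound c n t \<epsilon> \<delta>"
      "\<And>t \<epsilon> \<delta>. \<epsilon> > 0 \<Longrightarrow> real (message_sizes 0 t (eps_in \<epsilon>) (delta_in \<delta>)) \<le> sample_bound c t \<epsilon> \<delta>"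
  shows "honest_admissible c n t \<epsilon> \<delta> I"
  unfolding honest_admissible_def
proof (intro conjI ballI)
  fix r assume "r \<in> set_spmf I"
  then obtain v where v: "steps (prover_end r) \<le> prover_cost n t (eps_in \<epsilon>) (delta_in \<delta>)"
    "length (msg1 r) + length (msg2 r) + length (msg3 r) \<le> n * message_sizes n t (eps_in \<epsilon>) (delta_in \<delta>)"
    using rel_spmf_setD[OF rel] by blast
  have "real (steps (prover_end r)) \<le> real (prover_cost n t (eps_in \<epsilon>) (delta_in \<delta>))" using v(1) by (rule of_nat_mono)
  then show "real (steps (prover_end r)) \<le> time_bound c n t \<epsilon> \<delta>" using c(1)[OF \<epsilon>, of n t \<delta>] by linarith
  have "real (length (msg1 r) + length (msg2 r) + length (msg3 r)) \<le> real (n * message_sizes n t (eps_in \<epsilon>) (delta_in \<delta>))"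
    using v(2) by (rule of_nat_mono)
  also have "\<dots> = real n * real (message_sizes 0 t (eps_in \<epsilon>) (delta_in \<delta>))"
    by (simp add: message_sizes_def)
  also have "\<dots> \<le> comm_bound c n t \<epsilon> \<delta>"
    unfolding comm_bound_def using c(2)[OF \<epsilon>, of t \<delta>] by (intro mult_left_mono) (auto simp: sample_bound_def)
  finally show "real (length (msg1 r) + length (msg2 r) + length (msg3 r)) \<le> comm_bound c n t \<epsilon> \<delta>" .
qed

text \<open>For t > 2^n no set of t vectors exists and the verifier must reject. The summand 1 makes
  the completeness bound trivial in these finitely many dimensions.\<close>

definition protocol_error :: "real \<Rightarrow> real \<Rightarrow> nat \<Rightarrow> nat \<Rightarrow> real" where
  "protocol_error \<epsilon> \<delta> t n = (if t \<le> 2 ^ n then 0 else 1) + search_error (big_g t (eps_in \<epsilon>) (delta_in \<delta>)) n"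

lemma protocol_error_tendsto: "(\<lambda>n. protocol_error \<epsilon> \<delta> t n) \<longlonglongrightarrow> 0"
proof -
  have "\<forall>\<^sub>F n in sequentially. (if t \<le> 2 ^ n then 0 else 1 :: real) = 0"
    unfolding eventually_sequentially
  proof (intro exI[of _ t] allI impI)
    fix n assume "t \<le> n"
    then have "t \<le> 2 ^ n" using less_exp[of n] by linarith
    then show "(if t \<le> 2 ^ n then 0 else 1 :: real) = 0" by simp
  qed
  then have "(\<lambda>n. if t \<le> 2 ^ n then 0 else 1 :: real) \<longlonglongrightarrow> 0" by (rule tendsto_eventually)
  from tendsto_add[OF this search_error_tendsto[of "big_g t (eps_in \<epsilon>) (delta_in \<delta>)"]] show ?thesis
    unfolding protocol_error_def by simp
qed

lemma protocol_error_nonneg: "0 \<le> protocol_error \<epsilon> \<delta> t n"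
  by (simp add: protocol_error_def search_error_def)

theorem theorem4p2:
  shows "\<exists>(V :: prog) (Q :: prog) (c :: nat) (err :: real \<Rightarrow> real \<Rightarrow> nat \<Rightarrow> nat \<Rightarrow> real).
    (\<forall>\<epsilon> \<delta> t. \<epsilon> > 0 \<and> \<delta> > 0 \<longrightarrow> (\<lambda>n. err \<epsilon> \<delta> t n) \<longlonglongrightarrow> 0) \<and>
    (\<forall>(n :: nat) (t :: nat) (\<epsilon> :: real) (\<delta> :: real) (f :: bit list \<Rightarrow> real).
       n \<ge> 1 \<and> \<epsilon> > 0 \<and> \<delta> > 0 \<and> (\<forall>x \<in> cube n. f x \<in> {-1, 1}) \<longrightarrow>
         verifier_admissible c n t \<epsilon> \<delta> (interact_honest n t \<epsilon> \<delta> f V Q) \<and>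
         honest_admissible c n t \<epsilon> \<delta> (interact_honest n t \<epsilon> \<delta> f V Q) \<and>
         measure (measure_spmf (interact_honest n t \<epsilon> \<delta> f V Q))
           {r. \<exists>\<Lambda>. result r = Some \<Lambda> \<and> eps_top n (\<epsilon> / 3) f \<Lambda>} \<ge> 1 - \<delta> - err \<epsilon> \<delta> t n \<and>
         (\<forall>P p0. valid_prover P \<longrightarrow>
            verifier_admissible c n t \<epsilon> \<delta> (interact n t \<epsilon> \<delta> f V P p0) \<and>
            measure (measure_spmf (interact n t \<epsilon> \<delta> f V P p0))
              {r. \<exists>\<Lambda>. result r = Some \<Lambda> \<and> \<not> eps_top n \<epsilon> f \<Lambda>} \<le> \<delta> + err \<epsilon> \<delta> t n))"
proof -
  obtain c1 where c1: "\<And>n t \<epsilon> \<delta> c. \<epsilon> > 0 \<Longrightarrow> c1 \<le> c \<Longrightarrow> real (verifier_cost n t (eps_in \<epsilon>) (delta_in \<delta>)) \<le> time_bound c n t \<epsilon> \<delta>"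
    using poly_bounded_verifier_cost by (rule poly_bound_real) blast
  obtain c2 where c2: "\<And>n t \<epsilon> \<delta> c. \<epsilon> > 0 \<Longrightarrow> c2 \<le> c \<Longrightarrow> real (prover_cost n t (eps_in \<epsilon>) (delta_in \<delta>)) \<le> time_bound c n t \<epsilon> \<delta>"
    using poly_bounded_prover_cost by (rule poly_bound_real) blast
  obtain c3 where c3: "\<And>t \<epsilon> \<delta> c. \<epsilon> > 0 \<Longrightarrow> c3 \<le> c \<Longrightarrow> real (verifier_asks 0 t (eps_in \<epsilon>) (delta_in \<delta>)) \<le> sample_bound c t \<epsilon> \<delta>"
    using poly_bounded_verifier_asks by (rule poly_bound_real) blast
  obtain c4 where c4: "\<And>t \<epsilon> \<delta> c. \<epsilon> > 0 \<Longrightarrow> c4 \<le> c \<Longrightarrow> real (message_sizes 0 t (eps_in \<epsilon>) (delta_in \<delta>)) \<le> sample_bound c t \<epsilon> \<delta>"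
    using poly_bounded_message_sizes by (rule poly_bound_real) blast
  \<comment> \<open>Each of the four bounds holds for every larger constant too, so the sum serves
    all of them.\<close>
  define c where "c = c1 + c2 + c3 + c4"
  have C: "c1 \<le> c" "c2 \<le> c" "c3 \<le> c" "c4 \<le> c" by (simp_all add: c_def)
  show ?thesis
  proof (rule exI[of _ verifier], rule exI[of _ prover], rule exI[of _ c], rule exI[of _ protocol_error], intro conjI allI impI; (elim conjE)?)
    fix \<epsilon> \<delta> :: real and t :: nat
    show "(\<lambda>n. protocol_error \<epsilon> \<delta> t n) \<longlonglongrightarrow> 0" by (rule protocol_error_tendsto)
  next
    fix n t :: nat and \<epsilon> \<delta> :: real and f :: "bit list \<Rightarrow> real"
    assume n: "n \<ge> 1" and \<epsilon>: "\<epsilon> > 0" and \<delta>: "\<delta> > 0" and f: "sign_valued n f"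
    let ?I = "interact_honest n t \<epsilon> \<delta> f verifier prover"
    note hrel = interact_honest_rel[OF n, of t \<epsilon> \<delta> f]
    have hrel': "rel_spmf (\<lambda>v r. result r = map_option set v \<and> good_run n t \<epsilon> \<delta> r v) (spmf_of_pmf (honest_game n t \<epsilon> \<delta> f)) ?I"
      by (rule rel_spmf_mono[OF hrel]) auto
    show "verifier_admissible c n t \<epsilon> \<delta> ?I"
      by (rule verifier_admissibleI[OF n \<epsilon> hrel']) (use c1 c3 c4 C in auto)
    show "honest_admissible c n t \<epsilon> \<delta> ?I"
      by (rule honest_admissibleI[OF n \<epsilon> hrel]) (use c2 c4 C in auto)
    show "1 - \<delta> - protocol_error \<epsilon> \<delta> t n \<le> measure (measure_spmf ?I) {r. \<exists>\<Lambda>. result r = Some \<Lambda> \<and> eps_top n (\<epsilon> / 3) f \<Lambda>}"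
    proof (cases "t \<le> 2 ^ n")
      case True
      have "measure (measure_spmf ?I) {r. \<exists>\<Lambda>. result r = Some \<Lambda> \<and> eps_top n (\<epsilon> / 3) f \<Lambda>} =
        1 - fails (honest_game n t \<epsilon> \<delta> f) (\<lambda>v. \<exists>\<Lambda>. map_option set v = Some \<Lambda> \<and> eps_top n (\<epsilon> / 3) f \<Lambda>)"
        unfolding measure_rel_spmf[OF hrel', of "\<lambda>x. \<exists>\<Lambda>. x = Some \<Lambda> \<and> eps_top n (\<epsilon> / 3) f \<Lambda>"] measure_fails ..
      moreover have "(\<lambda>v. \<exists>\<Lambda>. map_option set v = Some \<Lambda> \<and> eps_top n (\<epsilon> / 3) f \<Lambda>) = (\<lambda>v. \<exists>l. v = Some l \<and> eps_top n (\<epsilon> / 3) f (set l))"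
        by (auto simp: fun_eq_iff)
      ultimately show ?thesis using honest_fails[OF n \<epsilon> \<delta> f True] True by (simp add: protocol_error_def)
    next
      case False
      have "0 \<le> search_error (big_g t (eps_in \<epsilon>) (delta_in \<delta>)) n" by (simp add: search_error_def)
      then have "1 - \<delta> - protocol_error \<epsilon> \<delta> t n \<le> 0" using False \<delta> by (simp add: protocol_error_def)
      then show ?thesis by (rule order_trans) simp
    qed
    fix P :: "nat party" and p0 assume "valid_prover P"
    then obtain P' where P': "\<And>p m. P p m = spmf_of_pmf (P' p m)" by (rule valid_prover_pmf) blast
    let ?J = "interact n t \<epsilon> \<delta> f verifier P p0"
    note arel = adversary_rel[OF n \<epsilon> \<delta> f P', where t = t and ?p0.0 = p0]
    show "verifier_admissible c n t \<epsilon> \<delta> ?J"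
      by (rule verifier_admissibleI[OF n \<epsilon> arel]) (use c1 c3 c4 C in auto)
    have "measure (measure_spmf ?J) {r. \<exists>\<Lambda>. result r = Some \<Lambda> \<and> \<not> eps_top n \<epsilon> f \<Lambda>} =
      measure (adversary_game n t \<epsilon> \<delta> f P' p0) {v. \<exists>\<Lambda>. map_option set v = Some \<Lambda> \<and> \<not> eps_top n \<epsilon> f \<Lambda>}"
      by (rule measure_rel_spmf[OF arel])
    also have "\<dots> = fails (adversary_game n t \<epsilon> \<delta> f P' p0) (\<lambda>v. \<forall>l. v = Some l \<longrightarrow> eps_top n \<epsilon> f (set l))"
      unfolding fails_def by (rule arg_cong[where f = "measure _"]) auto
    also have "\<dots> \<le> \<delta>" by (rule adversary_fails[OF n \<epsilon> \<delta> f])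
    finally show "measure (measure_spmf ?J) {r. \<exists>\<Lambda>. result r = Some \<Lambda> \<and> \<not> eps_top n \<epsilon> f \<Lambda>} \<le> \<delta> + protocol_error \<epsilon> \<delta> t n"
      using protocol_error_nonneg[of \<epsilon> \<delta> t n] by linarith
  qed
qed

end
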